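(* Let $Y$ be a compact, connected, oriented 3-orbifold whose singular set $\Sigma Y$ is an oriented link $L_1\cup\dots\cup L_k$ and whose boundary is empty or a union of tori. Let $\mathbf e$ be an orbifold Euler structure on $Y$ and $\omega$ a homology orientation on $|Y|$. Let $\phi_l:\mathbb{Z}[H_1^{orb}(Y)]\to F_l$ be the inclusion of $\mathbb{Z}[H_1^{orb}(Y)]$ into its quotient ring followed by projection to the $l$-th field in the canonical splitting $Q(\mathbb{Z}[H_1^{orb}(Y)])=\bigoplus_{l=1}^rF_l$. Then $\tau^{\phi_l}(Y,\mathbf e,\omega)$ does not depend on the orientation and order of the cells away from $\Sigma Y$, the lift in $|\widehat Y|$ representing $\mathbf e$, or on the sequence $\{\omega_n\}_{n=0}^3$ of bases realizing $\omega$.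
   Context: **Orbifolds.** $Y$ is a 3-orbifold with underlying space $|Y|$, a compact 3-manifold, and singular set the oriented link $\Sigma Y=L_1\cup\dots\cup L_k$. Centered around each $L_i$ is a neighborhood $N_i=(S^1\times D^2)/\mathbb{Z}_{\alpha_i}$, where $\mathbb{Z}_{\alpha_i}$ acts by rotations about the core and $L_i=S^1\times\mathbf 0$. Let $X$ be the complement in $|Y|$ of the interiors of the $N_i$, and $\mu_i$ the meridian of $L_i$, oriented so that its linking number with $L_i$ is $1$. $H_1^{orb}(Y)$ is the abelianization of the orbifold fundamental group (the deck group of the orbifold universal cover), and $H_1^{orb}(Y)\cong H_1(X)/\langle\mu_1^{\alpha_1},\dots,\mu_k^{\alpha_k}\rangle$ (written multiplicatively). $\widehat Y$ is the orbifold cover of $Y$ with deck group $H_1^{orb}(Y)$: start with the regular cover of $X$ with deck group $H_1^{orb}(Y)$ and extend it canonically over its boundary so as to cover the $N_i$. $|\widehat Y|$ is its underlying space. **Cells.** Each $N_i$ is equipped with the following (open) cell decomposition of $S^1\times D^2$: on the boundary torus, the 0-cell $(1,1)$, the two 1-cells $(S^1-\mathbf 1)\times\mathbf 1$ and $\mathbf 1\times(\partial D^2-\mathbf 1)$, and one 2-cell; in the interior, the 0-cell $(1,0)$, the 1-cells $\mathbf 1\times int([0,1])$ and $(S^1-\mathbf 1)\times\mathbf 0$, the 2-cells $(S^1-\mathbf 1)\times int([0,1])$ and $\mathbf 1\times int(D^2)$, and the 3-cell $(S^1-\mathbf 1)\times int(D^2)$. In particular $L_i$ consists of one 0-cell $e_i^0=(1,0)$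 and one 1-cell $e_i^1=(S^1-\mathbf 1)\times\mathbf 0$. These are extended to a cell decomposition of $|Y|$, which is fixed; the cells away from $\Sigma Y$ are denoted $\{e_j\}_{j\in J}$. The decomposition lifts to $|\widehat Y|$, and $H_1^{orb}(Y)$ acts on the lifts of each cell; the action on the lifts of cells in $L_i$ need not be free, since $\langle\mu_i\rangle$ fixes them. **Orbifold Euler structures.** Let $h_1,\dots,h_k$ denote the homology classes in $H_1^{orb}(Y)$ induced by the oriented singular curves $L_1,\dots,L_k$. Consider lifts $\hat e=\{\hat e_j\}_{j\in J}\cup\bigcup_{i=1}^k\{\hat e_i^0,\hat e_i^1\}$ of the cells of $|Y|$ to $|\widehat Y|$ (one cell over each cell of $|Y|$) such that $\partial(\hat e_i^1)=\pm(h_i-1)\hat e_i^0$ for every $i\in\{1,\dots,k\}$. For two such lifts $\hat e,\hat f$ put $\hat f/\hat e=\prod_{j\in J}(\hat f_j/\hat e_j)^{(-1)^{\dim e_j}}$, where $\hat f_j/\hat e_j$ is the unique element of $H_1^{orb}(Y)$ that takes $\hat e_j$ to $\hat f_j$; set $\hat e\sim\hat f$ when $\hat f/\hat e=1$. An orbifold Euler structure on $Y$ is an equivalence class of such lifts. **Homology orientation.** An orientation $\omega$ of the real vector space $\bigoplus_{n=0}^3H_n(|Y|,\mathbb{R})$. **Torsion of a based complex.** Let $C=(0\to C_m\to\dots\to C_0\to0)$ be a chain complex of finite-dimensional vector spaces over a field, with differentials $\partial_i:C_{i+1}\to C_i$, ordered bases $c_i$ of $C_i$, and ordered bases of $H_i(C)$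 with representatives $h_i$. Choose sequences $b_i$ of vectors in $C_i$ such that $\partial_{i-1}(b_i)$ is an ordered basis of $\mathrm{Im}(\partial_{i-1})$. Then $\tau(C)=(-1)^{|C|}\prod_{i=0}^m[\partial_i(b_{i+1})h_ib_i/c_i]^{(-1)^{i+1}}$, where $[a/c]$ is the determinant of the change of basis matrix from $c$ to $a$ and $|C|=\sum_{i=0}^m\big(\sum_{r=0}^i\dim C_r\big)\big(\sum_{r=0}^i\dim H_r(C)\big)\in\mathbb{Z}_2$. **The fields $F_l$.** $Q(R)$ denotes the (total) quotient ring of $R$. $Q(\mathbb{Z}[H_1^{orb}(Y)])$ splits canonically (up to order of the factors) as a finite direct sum of fields $F_1,\dots,F_r$, indexed by equivalence classes of characters of the torsion subgroup of $H_1^{orb}(Y)$. **The element $\tau^{\phi_l}(Y,\mathbf e,\omega)$.** Let $C(|\widehat Y|)$ be the cellular chain complex of $|\widehat Y|$ with $\mathbb{Z}$ coefficients, a complex of (possibly non-free) $\mathbb{Z}[H_1^{orb}(Y)]$-modules, and $C^{\phi_l}(|\widehat Y|)=C(|\widehat Y|)\otimes_{\phi_l}F_l$. Order and orient the cells in $|Y|$; the orientation and order of the singular curves in $\Sigma Y$ induce a natural orientation and order of the cells in $\Sigma Y$. Pick a lift in $|\widehat Y|$ representing $\mathbf e$; each cell in the lift inherits an orientation, and cells of the same dimension inherit an ordering. This bases $C^{\phi_l}(|\widehat Y|)$ over $F_l$: the basis consists of the elements $\hat c\otimes1$ for $\hat c$ in the lift, omitting those with $\hat c$ over an $L_i$ with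 $\phi_l(\mu_i)\ne1$ (for these $\hat c\otimes 1=0$). For every $n\in\{0,1,2,3\}$ pick an ordered basis $\omega_n$ of $H_n(|Y|,\mathbb{R})$ so that the sequence $\{\omega_n\}_{n=0}^3$ realizes $\omega$; let $\tau_0$ be the sign of the torsion of the cellular chain complex $C(|Y|,\mathbb{R})$, based by the oriented ordered cells and with homology bases $\omega_n$. If $C^{\phi_l}(|\widehat Y|)$ is acyclic, set $\tau^{\phi_l}(Y,\mathbf e,\omega)=\tau_0\cdot\tau(C^{\phi_l}(|\widehat Y|))$; otherwise set $\tau^{\phi_l}(Y,\mathbf e,\omega)=0$.
   Formalization: Lifts in an Euler structure must also have each singular 1-cell start at the chosen 0-cell (the boundary equation alone fails if h_i or its square lies in the group of μ_i), and the positions of the link cells in the order of cells are fixed. *)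

theory Defs
  imports "HOL-Analysis.Analysis" "HOL-Homology.Homology" "HOL-Algebra.QuotRing" "HOL-Algebra.Module"
    "Jordan_Normal_Form.Determinant"
begin

section \<open>Linear algebra over a field given as a type\<close>

text \<open>The ground field is a type of class \<open>field\<close>; vector spaces are module records
  over \<open>field_ring\<close>, so that subquotients are available.\<close>

definition field_ring :: "'f::field ring" where
  "field_ring = \<lparr>carrier = UNIV, mult = (*), one = 1, zero = 0, add = (+)\<rparr>"

definition lin_comb :: "('f::field, 'v) module \<Rightarrow> (nat \<Rightarrow> 'f) \<Rightarrow> 'v list \<Rightarrow> 'v" where
  "lin_comb M a xs = (\<Oplus>\<^bsub>M\<^esub>i\<in>{..<length xs}. a i \<odot>\<^bsub>M\<^esub> (xs ! i))"

definition ordered_basis :: "('f::field, 'v) module \<Rightarrow> 'v list \<Rightarrow> bool" where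
  "ordered_basis M xs \<longleftrightarrow> set xs \<subseteq> carrier M \<and>
     (\<forall>v\<in>carrier M. \<exists>!a. a \<in> {..<length xs} \<rightarrow>\<^sub>E UNIV \<and> v = lin_comb M a xs)"

definition coords :: "('f::field, 'v) module \<Rightarrow> 'v list \<Rightarrow> 'v \<Rightarrow> nat \<Rightarrow> 'f" where
  "coords M xs v = (THE a. a \<in> {..<length xs} \<rightarrow>\<^sub>E UNIV \<and> v = lin_comb M a xs)"

text \<open>\<open>[a/c]\<close>. It is only meaningful for two ordered bases; the value 0 elsewhere is a
  totalization.\<close>

definition basis_det :: "('f::field, 'v) module \<Rightarrow> 'v list \<Rightarrow> 'v list \<Rightarrow> 'f" where
  "basis_det M a c = (if ordered_basis M a \<and> ordered_basis M c
     then Determinant.det (Matrix.mat (length c) (length c) (\<lambda>(i, j). coords M c (a ! i) j))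
     else 0)"

definition quot_module :: "('f::field, 'v) module \<Rightarrow> 'v set \<Rightarrow> ('f, 'v set) module" where
  "quot_module M N = \<lparr>carrier = a_rcosets\<^bsub>M\<^esub> N, mult = undefined, one = undefined,
     zero = N, add = (\<lambda>A B. A <+>\<^bsub>M\<^esub> B),
     smult = (\<lambda>a A. N <+>\<^bsub>M\<^esub> ((\<lambda>x. a \<odot>\<^bsub>M\<^esub> x) ` A))\<rparr>"

definition submodule_span :: "('f::field, 'v) module \<Rightarrow> 'v set \<Rightarrow> 'v set" where
  "submodule_span M A = \<Inter>{N. submodule N field_ring M \<and> A \<subseteq> N}"

section \<open>Chain complexes and torsion\<close>

text \<open>A complex \<open>0 \<rightarrow> C m \<rightarrow> \<dots> \<rightarrow> C 0 \<rightarrow> 0\<close> with differentials \<open>d i : C (i+1) \<rightarrow> C i\<close>;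
  values of \<open>C\<close> and \<open>d\<close> beyond \<open>m\<close> are ignored.\<close>

definition cycles :: "(nat \<Rightarrow> ('f::field, 'v) module) \<Rightarrow> (nat \<Rightarrow> 'v \<Rightarrow> 'v) \<Rightarrow> nat \<Rightarrow> 'v set" where
  "cycles C d i = (case i of 0 \<Rightarrow> carrier (C 0)
     | Suc j \<Rightarrow> {x \<in> carrier (C i). d j x = \<zero>\<^bsub>C j\<^esub>})"

definition boundaries ::
  "nat \<Rightarrow> (nat \<Rightarrow> ('f::field, 'v) module) \<Rightarrow> (nat \<Rightarrow> 'v \<Rightarrow> 'v) \<Rightarrow> nat \<Rightarrow> 'v set" where
  "boundaries m C d i = (if i < m then d i ` carrier (C (Suc i)) else {\<zero>\<^bsub>C i\<^esub>})"

definition homology_module ::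
  "nat \<Rightarrow> (nat \<Rightarrow> ('f::field, 'v) module) \<Rightarrow> (nat \<Rightarrow> 'v \<Rightarrow> 'v) \<Rightarrow> nat \<Rightarrow> ('f, 'v set) module" where
  "homology_module m C d i =
     quot_module ((C i)\<lparr>carrier := cycles C d i\<rparr>) (boundaries m C d i)"

definition acyclic_complex ::
  "nat \<Rightarrow> (nat \<Rightarrow> ('f::field, 'v) module) \<Rightarrow> (nat \<Rightarrow> 'v \<Rightarrow> 'v) \<Rightarrow> bool" where
  "acyclic_complex m C d \<longleftrightarrow> (\<forall>i\<le>m. cycles C d i = boundaries m C d i)"

definition boundary_lifts ::
  "nat \<Rightarrow> (nat \<Rightarrow> ('f::field, 'v) module) \<Rightarrow> (nat \<Rightarrow> 'v \<Rightarrow> 'v) \<Rightarrow> (nat \<Rightarrow> 'v list) \<Rightarrow> bool" where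
  "boundary_lifts m C d b \<longleftrightarrow> b 0 = [] \<and> b (Suc m) = [] \<and>
     (\<forall>i<m. set (b (Suc i)) \<subseteq> carrier (C (Suc i)) \<and>
        ordered_basis ((C i)\<lparr>carrier := boundaries m C d i\<rparr>) (map (d i) (b (Suc i))))"

text \<open>\<open>c i\<close> is the ordered basis of \<open>C i\<close>, and \<open>w i\<close> the ordered basis of the homology in
  degree \<open>i\<close>, whose members are cosets of cycles.\<close>

definition torsion :: "nat \<Rightarrow> (nat \<Rightarrow> ('f::field, 'v) module) \<Rightarrow> (nat \<Rightarrow> 'v \<Rightarrow> 'v) \<Rightarrow>
    (nat \<Rightarrow> 'v list) \<Rightarrow> (nat \<Rightarrow> 'v set list) \<Rightarrow> 'f" where
  "torsion m C d c w =
     (let b = (SOME b. boundary_lifts m C d b);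
          h = (\<lambda>i. map (\<lambda>A. SOME x. x \<in> A) (w i));
          N = (\<Sum>i\<le>m. (\<Sum>r\<le>i. length (c r)) * (\<Sum>r\<le>i. length (w r)))
      in (-1) ^ N *
         (\<Prod>i\<le>m. basis_det (C i) (map (d i) (b (Suc i)) @ h i @ b i) (c i)
                    powi ((-1) ^ (i + 1))))"

section \<open>Orientations of the total homology\<close>

definition direct_sum_module :: "nat \<Rightarrow> (nat \<Rightarrow> ('f::field, 'v) module) \<Rightarrow> ('f, nat \<Rightarrow> 'v) module" where
  "direct_sum_module m H = \<lparr>carrier = (\<Pi>\<^sub>E n\<in>{..m}. carrier (H n)),
     mult = undefined, one = undefined,
     zero = (\<lambda>n\<in>{..m}. \<zero>\<^bsub>H n\<^esub>),
     add = (\<lambda>x y. \<lambda>n\<in>{..m}. x n \<oplus>\<^bsub>H n\<^esub> y n),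
     smult = (\<lambda>a x. \<lambda>n\<in>{..m}. a \<odot>\<^bsub>H n\<^esub> x n)\<rparr>"

definition ds_incl :: "nat \<Rightarrow> (nat \<Rightarrow> ('f::field, 'v) module) \<Rightarrow> nat \<Rightarrow> 'v \<Rightarrow> nat \<Rightarrow> 'v" where
  "ds_incl m H n x = (\<lambda>j\<in>{..m}. if j = n then x else \<zero>\<^bsub>H j\<^esub>)"

definition orientations :: "(real, 'v) module \<Rightarrow> 'v list set set" where
  "orientations V = {xs. ordered_basis V xs} //
     {(xs, ys). ordered_basis V xs \<and> ordered_basis V ys \<and> basis_det V xs ys > 0}"

definition realizes_orientation ::
  "nat \<Rightarrow> (nat \<Rightarrow> (real, 'v) module) \<Rightarrow> (nat \<Rightarrow> 'v) list set \<Rightarrow> (nat \<Rightarrow> 'v list) \<Rightarrow> bool" where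
  "realizes_orientation m H \<omega> w \<longleftrightarrow> (\<forall>n\<le>m. ordered_basis (H n) (w n)) \<and>
     concat (map (\<lambda>n. map (ds_incl m H n) (w n)) [0..<Suc m]) \<in> \<omega>"

section \<open>Extension of scalars\<close>

definition point_mass :: "'c \<Rightarrow> 'c \<Rightarrow> 'f::zero_neq_one" where
  "point_mass x = (\<lambda>y. if y = x then 1 else 0)"

definition free_module :: "'c set \<Rightarrow> ('f::field, 'c \<Rightarrow> 'f) module" where
  "free_module S = \<lparr>carrier = {u. finite {x. u x \<noteq> 0} \<and> {x. u x \<noteq> 0} \<subseteq> S},
     mult = undefined, one = undefined, zero = (\<lambda>_. 0),
     add = (\<lambda>u v x. u x + v x), smult = (\<lambda>a u x. a * u x)\<rparr>"

text \<open>For an abelian group \<open>C\<close> (written multiplicatively), a set \<open>G\<close> acting on it through \<open>\<rho>\<close>,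
  and \<open>\<xi> : G \<rightarrow> 'f\<close>, the following presents \<open>C \<otimes> 'f\<close> modulo \<open>\<rho> g c \<otimes> x = c \<otimes> \<xi> g x\<close>.
  If \<open>G\<close> is a group and \<open>\<xi>\<close> the restriction to \<open>G\<close> of a ring homomorphism from the group
  ring, this is \<open>C \<otimes> 'f\<close> over the group ring, as \<open>G\<close> generates the latter additively.
  For empty \<open>G\<close> it is the tensor product over the integers.\<close>

definition tensor_relations ::
  "('c, 'z) monoid_scheme \<Rightarrow> 'g set \<Rightarrow> ('g \<Rightarrow> 'c \<Rightarrow> 'c) \<Rightarrow> ('g \<Rightarrow> 'f::field) \<Rightarrow> ('c \<Rightarrow> 'f) set" where
  "tensor_relations C G \<rho> \<xi> = submodule_span (free_module (carrier C))
     ({(\<lambda>x. point_mass (c \<otimes>\<^bsub>C\<^esub> c') x - point_mass c x - point_mass c' x) | c c'.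
          c \<in> carrier C \<and> c' \<in> carrier C} \<union>
      {(\<lambda>x. point_mass (\<rho> g c) x - \<xi> g * point_mass c x) | g c. g \<in> G \<and> c \<in> carrier C})"

definition tensor_module :: "('c, 'z) monoid_scheme \<Rightarrow> 'g set \<Rightarrow> ('g \<Rightarrow> 'c \<Rightarrow> 'c) \<Rightarrow>
    ('g \<Rightarrow> 'f::field) \<Rightarrow> ('f, ('c \<Rightarrow> 'f) set) module" where
  "tensor_module C G \<rho> \<xi> =
     quot_module (free_module (carrier C)) (tensor_relations C G \<rho> \<xi>)"

text \<open>\<open>c \<otimes> 1\<close>\<close>

definition tensor_elt :: "('c, 'z) monoid_scheme \<Rightarrow> 'g set \<Rightarrow> ('g \<Rightarrow> 'c \<Rightarrow> 'c) \<Rightarrow>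
    ('g \<Rightarrow> 'f::field) \<Rightarrow> 'c \<Rightarrow> ('c \<Rightarrow> 'f) set" where
  "tensor_elt C G \<rho> \<xi> c =
     tensor_relations C G \<rho> \<xi> +>\<^bsub>free_module (carrier C)\<^esub> point_mass c"

definition push_forward :: "('c \<Rightarrow> 'e) \<Rightarrow> ('c \<Rightarrow> 'f::field) \<Rightarrow> 'e \<Rightarrow> 'f" where
  "push_forward f u = (\<lambda>y. \<Sum>x | u x \<noteq> 0 \<and> f x = y. u x)"

text \<open>\<open>f \<otimes> id\<close>, with target \<open>C' \<otimes> 'f\<close>\<close>

definition tensor_map :: "('e, 'z) monoid_scheme \<Rightarrow> 'g set \<Rightarrow> ('g \<Rightarrow> 'e \<Rightarrow> 'e) \<Rightarrow>
    ('g \<Rightarrow> 'f::field) \<Rightarrow> ('c \<Rightarrow> 'e) \<Rightarrow> ('c \<Rightarrow> 'f) set \<Rightarrow> ('e \<Rightarrow> 'f) set" where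
  "tensor_map C' G \<rho>' \<xi> f A =
     (\<Union>u\<in>A. tensor_relations C' G \<rho>' \<xi> +>\<^bsub>free_module (carrier C')\<^esub> push_forward f u)"

section \<open>Group rings, total quotient rings, splittings into fields\<close>

definition group_ring :: "('h, 'z) monoid_scheme \<Rightarrow> ('h \<Rightarrow> int) ring" where
  "group_ring H = \<lparr>carrier = {u. finite {g. u g \<noteq> 0} \<and> {g. u g \<noteq> 0} \<subseteq> carrier H},
     mult = (\<lambda>u v x. \<Sum>(g, g') | u g \<noteq> 0 \<and> v g' \<noteq> 0 \<and> g \<otimes>\<^bsub>H\<^esub> g' = x. u g * v g'),
     one = point_mass \<one>\<^bsub>H\<^esub>, zero = (\<lambda>_. 0), add = (\<lambda>u v x. u x + v x)\<rparr>"

definition non_zero_divisors :: "('x, 'z) ring_scheme \<Rightarrow> 'x set" where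
  "non_zero_divisors R =
     {b \<in> carrier R. \<forall>a\<in>carrier R. a \<otimes>\<^bsub>R\<^esub> b = \<zero>\<^bsub>R\<^esub> \<longrightarrow> a = \<zero>\<^bsub>R\<^esub>}"

definition fraction_rel :: "('x, 'z) ring_scheme \<Rightarrow> (('x \<times> 'x) \<times> ('x \<times> 'x)) set" where
  "fraction_rel R = {((a, b), (c, d)). a \<in> carrier R \<and> c \<in> carrier R \<and>
     b \<in> non_zero_divisors R \<and> d \<in> non_zero_divisors R \<and> a \<otimes>\<^bsub>R\<^esub> d = c \<otimes>\<^bsub>R\<^esub> b}"

definition fraction :: "('x, 'z) ring_scheme \<Rightarrow> 'x \<Rightarrow> 'x \<Rightarrow> ('x \<times> 'x) set" where
  "fraction R a b = fraction_rel R `` {(a, b)}"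

definition total_quotient_ring :: "('x, 'z) ring_scheme \<Rightarrow> ('x \<times> 'x) set ring" where
  "total_quotient_ring R = \<lparr>
     carrier = (carrier R \<times> non_zero_divisors R) // fraction_rel R,
     mult = (\<lambda>A B. \<Union>(a, b)\<in>A. \<Union>(c, d)\<in>B. fraction R (a \<otimes>\<^bsub>R\<^esub> c) (b \<otimes>\<^bsub>R\<^esub> d)),
     one = fraction R \<one>\<^bsub>R\<^esub> \<one>\<^bsub>R\<^esub>,
     zero = fraction R \<zero>\<^bsub>R\<^esub> \<one>\<^bsub>R\<^esub>,
     add = (\<lambda>A B. \<Union>(a, b)\<in>A. \<Union>(c, d)\<in>B.
              fraction R (a \<otimes>\<^bsub>R\<^esub> d \<oplus>\<^bsub>R\<^esub> c \<otimes>\<^bsub>R\<^esub> b) (b \<otimes>\<^bsub>R\<^esub> d))\<rparr>"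

text \<open>\<open>Q\<close> is the direct sum of the fields \<open>F 0, \<dots>, F (r-1)\<close> with projections \<open>pr\<close>. The
  splitting of a ring as a finite direct sum of fields is unique up to order and isomorphism of
  the factors.\<close>

definition splits_into_fields :: "('q, 'z) ring_scheme \<Rightarrow> nat \<Rightarrow> (nat \<Rightarrow> 'e ring) \<Rightarrow>
    (nat \<Rightarrow> 'q \<Rightarrow> 'e) \<Rightarrow> bool" where
  "splits_into_fields Q r F pr \<longleftrightarrow>
     (\<forall>l<r. Ring.field (F l) \<and> pr l \<in> Ring.ring_hom Q (F l)) \<and>
     bij_betw (\<lambda>x. \<lambda>l\<in>{..<r}. pr l x) (carrier Q) (\<Pi>\<^sub>E l\<in>{..<r}. carrier (F l))"

section \<open>Oriented compact 3-manifolds\<close>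

definition half_space :: "(real \<times> real \<times> real) set" where
  "half_space = {x. 0 \<le> fst x}"

definition manifold3 :: "'a::t2_space set \<Rightarrow> bool" where
  "manifold3 M \<longleftrightarrow> (\<forall>y\<in>M. \<exists>U V. y \<in> U \<and> openin (top_of_set M) U \<and>
     openin (top_of_set half_space) V \<and> U homeomorphic V)"

definition manifold_boundary :: "'a::t2_space set \<Rightarrow> 'a set" where
  "manifold_boundary M = {y \<in> M. \<not> (\<exists>U V. y \<in> U \<and> openin (top_of_set M) U \<and>
     open (V :: (real \<times> real \<times> real) set) \<and> U homeomorphic V)}"

definition fundamental_class :: "'a::t2_space set \<Rightarrow> 'a chain set \<Rightarrow> bool" where
  "fundamental_class M z \<longleftrightarrow>
     z \<in> carrier (relative_homology_group 3 (top_of_set M) (manifold_boundary M)) \<and>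
     (\<forall>y \<in> M - manifold_boundary M.
        generate (relative_homology_group 3 (top_of_set M) (M - {y}))
          {hom_induced 3 (top_of_set M) (manifold_boundary M) (top_of_set M) (M - {y}) id z}
        = carrier (relative_homology_group 3 (top_of_set M) (M - {y})))"

section \<open>Orbifolds whose singular set is a link\<close>

text \<open>\<open>tube i\<close> parametrizes an open neighbourhood of the component \<open>L\<^sub>i\<close> by
  \<open>S\<^sup>1 \<times> {|z| < 2}\<close>; its part over \<open>|z| \<le> 1\<close> is \<open>|N\<^sub>i|\<close>, where the underlying space of the
  quotient of \<open>S\<^sup>1 \<times> D\<^sup>2\<close> by the rotations of order \<open>ord_at i\<close> is identified with
  \<open>S\<^sup>1 \<times> D\<^sup>2\<close> through \<open>(s, z) \<mapsto> (s, z ^ ord_at i)\<close>. Components are numbered from 0.\<close>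

record 'a link_orbifold =
  underlying :: "'a set"
  fund_class :: "'a chain set"
  ncomp :: nat
  tube :: "nat \<Rightarrow> complex \<times> complex \<Rightarrow> 'a"
  ord_at :: "nat \<Rightarrow> nat"

abbreviation circle :: "complex set" where
  "circle \<equiv> sphere 0 1"

definition singular_knot :: "'a link_orbifold \<Rightarrow> nat \<Rightarrow> 'a set" where
  "singular_knot Y i = tube Y i ` (circle \<times> {0})"

definition solid_torus :: "'a link_orbifold \<Rightarrow> nat \<Rightarrow> 'a set" where
  "solid_torus Y i = tube Y i ` (circle \<times> cball 0 1)"

definition exterior :: "'a link_orbifold \<Rightarrow> 'a set" where
  "exterior Y = underlying Y - (\<Union>i<ncomp Y. tube Y i ` (circle \<times> ball 0 1))"

text \<open>A small simplex around the point \<open>(1,0)\<close> of the core, positively oriented for the product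
  of the direction of \<open>L\<^sub>i\<close> and the complex orientation of the disc factor: in the coordinates
  \<open>(t, Re z, Im z)\<close> its vertices are \<open>(-1,-1,-1)\<close> and the three unit vectors.\<close>

definition tube_simplex :: "'a link_orbifold \<Rightarrow> nat \<Rightarrow> (nat \<Rightarrow> real) \<Rightarrow> 'a" where
  "tube_simplex Y i = (\<lambda>x\<in>standard_simplex 3.
     tube Y i (cis (x 1 - x 0), Complex (x 2 - x 0) (x 3 - x 0)))"

definition is_link_orbifold :: "'a::t2_space link_orbifold \<Rightarrow> bool" where
  "is_link_orbifold Y \<longleftrightarrow>
     compact (underlying Y) \<and> connected (underlying Y) \<and> underlying Y \<noteq> {} \<and> manifold3 (underlying Y) \<and>
     fundamental_class (underlying Y) (fund_class Y) \<and>
     (\<forall>T \<in> components (manifold_boundary (underlying Y)). T homeomorphic (circle \<times> circle)) \<and>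
     (\<forall>i<ncomp Y. 2 \<le> ord_at Y i \<and>
        (\<exists>g. homeomorphism (circle \<times> ball 0 2) (tube Y i ` (circle \<times> ball 0 2)) (tube Y i) g) \<and>
        openin (top_of_set (underlying Y)) (tube Y i ` (circle \<times> ball 0 2)) \<and>
        tube Y i ` (circle \<times> ball 0 2) \<inter> manifold_boundary (underlying Y) = {} \<and>
        homologous_rel_set 3 (top_of_set (underlying Y)) (underlying Y - {tube Y i (1, 0)})
            (frag_of (tube_simplex Y i))
          = hom_induced 3 (top_of_set (underlying Y)) (manifold_boundary (underlying Y))
              (top_of_set (underlying Y)) (underlying Y - {tube Y i (1, 0)}) id (fund_class Y)) \<and>
     (\<forall>i<ncomp Y. \<forall>j<ncomp Y. i \<noteq> j \<longrightarrow>
        tube Y i ` (circle \<times> ball 0 2) \<inter> tube Y j ` (circle \<times> ball 0 2) = {})"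

section \<open>The first orbifold homology group\<close>

definition path_simplex :: "(real \<Rightarrow> 'a) \<Rightarrow> (nat \<Rightarrow> real) \<Rightarrow> 'a" where
  "path_simplex \<gamma> = (\<lambda>x\<in>standard_simplex 1. \<gamma> (x 1))"

definition loop_class :: "'a::t2_space set \<Rightarrow> (real \<Rightarrow> 'a) \<Rightarrow> 'a chain set" where
  "loop_class X \<gamma> = homologous_rel_set 1 (top_of_set X) {} (frag_of (path_simplex \<gamma>))"

definition meridian :: "'a link_orbifold \<Rightarrow> nat \<Rightarrow> real \<Rightarrow> 'a" where
  "meridian Y i t = tube Y i (1, cis (2 * pi * t))"

definition meridian_powers :: "'a::t2_space link_orbifold \<Rightarrow> 'a chain set set" where
  "meridian_powers Y = generate (homology_group 1 (top_of_set (exterior Y)))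
     {loop_class (exterior Y) (meridian Y i) [^]\<^bsub>homology_group 1 (top_of_set (exterior Y))\<^esub> ord_at Y i
       | i. i < ncomp Y}"

definition H1orb :: "'a::t2_space link_orbifold \<Rightarrow> 'a chain set set monoid" where
  "H1orb Y = homology_group 1 (top_of_set (exterior Y)) Mod meridian_powers Y"

definition orb_class :: "'a::t2_space link_orbifold \<Rightarrow> (real \<Rightarrow> 'a) \<Rightarrow> 'a chain set set" where
  "orb_class Y \<gamma> = meridian_powers Y #>\<^bsub>homology_group 1 (top_of_set (exterior Y))\<^esub>
     loop_class (exterior Y) \<gamma>"

definition meridian_class :: "'a::t2_space link_orbifold \<Rightarrow> nat \<Rightarrow> 'a chain set set" where
  "meridian_class Y i = orb_class Y (meridian Y i)"

text \<open>The class \<open>h\<^sub>i\<close> of \<open>L\<^sub>i\<close>, pushed off into the exterior along the parametrization. Another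
  push-off changes it by a power of the meridian class, which acts trivially over \<open>L\<^sub>i\<close>.\<close>

definition knot_class :: "'a::t2_space link_orbifold \<Rightarrow> nat \<Rightarrow> 'a chain set set" where
  "knot_class Y i = orb_class Y (\<lambda>t. tube Y i (cis (2 * pi * t), 1))"

section \<open>The maximal abelian orbifold cover\<close>

record ('a, 'b) orb_cover =
  total :: "'b set"
  proj :: "'b \<Rightarrow> 'a"
  deck :: "'a chain set set \<Rightarrow> 'b \<Rightarrow> 'b"

text \<open>Over the exterior this is the regular cover with deck group \<open>H1orb Y\<close>, where the class of a
  loop acts as its monodromy. Over each solid torus it is extended canonically: locally along the
  core it is a disjoint union of copies of \<open>(s, z) \<mapsto> (s, z ^ m)\<close>, with \<open>m\<close> the order of
  the meridian class.\<close>

definition is_abelian_orb_cover ::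
  "'a::t2_space link_orbifold \<Rightarrow> ('a, 'b::t2_space) orb_cover \<Rightarrow> bool" where
  "is_abelian_orb_cover Y P \<longleftrightarrow>
     continuous_on (total P) (proj P) \<and> proj P ` total P = underlying Y \<and>
     (\<forall>g \<in> carrier (H1orb Y). continuous_on (total P) (deck P g) \<and>
        (\<forall>x \<in> total P. deck P g x \<in> total P \<and> proj P (deck P g x) = proj P x)) \<and>
     (\<forall>x \<in> total P. deck P \<one>\<^bsub>H1orb Y\<^esub> x = x) \<and>
     (\<forall>g \<in> carrier (H1orb Y). \<forall>h \<in> carrier (H1orb Y). \<forall>x \<in> total P.
        deck P (g \<otimes>\<^bsub>H1orb Y\<^esub> h) x = deck P g (deck P h x)) \<and>
     covering_space (total P \<inter> proj P -` exterior Y) (proj P) (exterior Y) \<and>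
     path_connected (total P \<inter> proj P -` exterior Y) \<and>
     (\<forall>g \<in> carrier (H1orb Y). \<forall>x \<in> total P \<inter> proj P -` exterior Y.
        deck P g x = x \<longrightarrow> g = \<one>\<^bsub>H1orb Y\<^esub>) \<and>
     (\<forall>\<gamma>. path \<gamma> \<and> path_image \<gamma> \<subseteq> total P \<inter> proj P -` exterior Y \<and>
        proj P (pathstart \<gamma>) = proj P (pathfinish \<gamma>) \<longrightarrow>
        pathfinish \<gamma> = deck P (orb_class Y (proj P \<circ> \<gamma>)) (pathstart \<gamma>)) \<and>
     (\<forall>i<ncomp Y. \<forall>s\<in>circle. \<exists>A. s \<in> A \<and> openin (top_of_set circle) A \<and>
        (\<exists>\<V>. \<Union>\<V> = total P \<inter> proj P -` (tube Y i ` (A \<times> cball 0 1)) \<and>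
           pairwise disjnt \<V> \<and>
           (\<forall>V\<in>\<V>. openin (top_of_set (total P \<inter> proj P -` solid_torus Y i)) V \<and>
              (\<exists>f g. homeomorphism (A \<times> cball 0 1) V f g \<and>
                 (\<forall>t\<in>A. \<forall>z\<in>cball 0 1. proj P (f (t, z)) =
                    tube Y i (t, z ^ group.ord (H1orb Y) (meridian_class Y i)))))))"

section \<open>Cell decompositions\<close>

text \<open>A cell is given by its dimension and characteristic map, where the standard simplex serves as
  the closed ball. The two orientations of a cell are thus plus or minus its characteristic map.\<close>

type_synonym 'a cell = "nat \<times> ((nat \<Rightarrow> real) \<Rightarrow> 'a)"

definition open_simplex :: "nat \<Rightarrow> (nat \<Rightarrow> real) set" where
  "open_simplex n = {x \<in> standard_simplex n. \<forall>i\<le>n. 0 < x i}"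

definition open_cell :: "'a cell \<Rightarrow> 'a set" where
  "open_cell c = snd c ` open_simplex (fst c)"

text \<open>\<open>skel D n\<close> is the \<open>(n-1)\<close>-skeleton, so that the case of the empty skeleton is covered.\<close>

definition skel :: "'a cell set \<Rightarrow> nat \<Rightarrow> 'a set" where
  "skel D n = (\<Union>c \<in> {c \<in> D. fst c < n}. open_cell c)"

definition tube_cells :: "(nat \<times> (complex \<times> complex) set) set" where
  "tube_cells = (let S = circle - {1}; I = complex_of_real ` {0<..<1};
       B = ball 0 1 - complex_of_real ` {0..<1} in
     {(0, {(1, 1)}), (1, S \<times> {1}), (1, {1} \<times> S), (2, S \<times> S),
      (0, {(1, 0)}), (1, {1} \<times> I), (1, S \<times> {0}), (2, S \<times> I), (2, {1} \<times> B), (3, S \<times> B)})"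

definition core0 :: "'a link_orbifold \<Rightarrow> nat \<Rightarrow> 'a cell" where
  "core0 Y i = (0, \<lambda>x\<in>standard_simplex 0. tube Y i (1, 0))"

text \<open>The characteristic map of the 1-cell in \<open>L\<^sub>i\<close> runs along \<open>L\<^sub>i\<close> in its direction.\<close>

definition core1 :: "'a link_orbifold \<Rightarrow> nat \<Rightarrow> 'a cell" where
  "core1 Y i = (1, path_simplex (\<lambda>t. tube Y i (cis (2 * pi * t), 0)))"

definition singular_cells :: "'a link_orbifold \<Rightarrow> 'a cell set" where
  "singular_cells Y = core0 Y ` {..<ncomp Y} \<union> core1 Y ` {..<ncomp Y}"

definition is_cell_decomposition :: "'a::t2_space link_orbifold \<Rightarrow> 'a cell set \<Rightarrow> bool" where
  "is_cell_decomposition Y D \<longleftrightarrow> finite D \<and>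
     (\<forall>c\<in>D. fst c \<le> 3 \<and> singular_simplex (fst c) (top_of_set (underlying Y)) (snd c) \<and>
        (\<exists>g. homeomorphism (open_simplex (fst c)) (open_cell c) (snd c) g) \<and>
        snd c ` (standard_simplex (fst c) - open_simplex (fst c)) \<subseteq> skel D (fst c)) \<and>
     (\<forall>c\<in>D. \<forall>c'\<in>D. c \<noteq> c' \<longrightarrow> open_cell c \<inter> open_cell c' = {}) \<and>
     (\<Union>c\<in>D. open_cell c) = underlying Y \<and>
     singular_cells Y \<subseteq> D \<and>
     (\<forall>i<ncomp Y. \<forall>(n, A) \<in> tube_cells. \<exists>c\<in>D. fst c = n \<and> open_cell c = tube Y i ` A)"

section \<open>Cellular chain complexes\<close>

text \<open>For a filtration \<open>S 0 = {} \<subseteq> S 1 \<subseteq> \<dots>\<close> whose member \<open>S (n+1)\<close> is the \<open>n\<close>-skeleton,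
  the cellular chain group in degree \<open>n\<close> is the relative homology group of
  \<open>(S (n+1), S n)\<close>, and the boundary is that of the triple.\<close>

definition cell_chains :: "(nat \<Rightarrow> 'a::t2_space set) \<Rightarrow> nat \<Rightarrow> 'a chain set monoid" where
  "cell_chains S n = relative_homology_group (int n) (top_of_set (S (Suc n))) (S n)"

definition cell_boundary :: "(nat \<Rightarrow> 'a::t2_space set) \<Rightarrow> nat \<Rightarrow> 'a chain set \<Rightarrow> 'a chain set" where
  "cell_boundary S n =
     hom_induced (int n) (top_of_set (S (Suc n))) {} (top_of_set (S (Suc n))) (S n) id \<circ>
     hom_boundary (int (Suc n)) (top_of_set (S (Suc (Suc n)))) (S (Suc n))"

definition cell_map :: "(nat \<Rightarrow> 'a::t2_space set) \<Rightarrow> nat \<Rightarrow> ('a \<Rightarrow> 'a) \<Rightarrow> 'a chain set \<Rightarrow> 'a chain set" where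
  "cell_map S n f = hom_induced (int n) (top_of_set (S (Suc n))) (S n) (top_of_set (S (Suc n))) (S n) f"

text \<open>the class of the cell with characteristic map \<open>f\<close> and orientation sign \<open>a\<close>\<close>

definition cell_class :: "(nat \<Rightarrow> 'a::t2_space set) \<Rightarrow> nat \<Rightarrow> int \<Rightarrow> ((nat \<Rightarrow> real) \<Rightarrow> 'a) \<Rightarrow> 'a chain set" where
  "cell_class S n a f =
     homologous_rel_set n (top_of_set (S (Suc n))) (S n) (frag_cmul a (frag_of f))"

definition cover_skel :: "('a, 'b) orb_cover \<Rightarrow> 'a cell set \<Rightarrow> nat \<Rightarrow> 'b set" where
  "cover_skel P D n = total P \<inter> proj P -` skel D n"

section \<open>Orbifold Euler structures\<close>

definition start_vertex :: "nat \<Rightarrow> real" where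
  "start_vertex = (\<lambda>j. if j = 0 then 1 else 0)"

text \<open>A lift \<open>e\<close> assigns to each cell the lifted characteristic map. As the 1-cell over \<open>L\<^sub>i\<close> is
  oriented along \<open>L\<^sub>i\<close>, the condition on its boundary says that it runs from the chosen 0-cell to
  the translate of the latter by \<open>h\<^sub>i\<close>. The chain-level equation does not determine the starting
  point if \<open>h\<^sub>i\<close> or its square fixes the 0-cell (the boundary is then 0, or the two signs cannot be
  told apart), so the starting point is prescribed as well.\<close>

definition euler_lifts :: "'a::t2_space link_orbifold \<Rightarrow> ('a, 'b::t2_space) orb_cover \<Rightarrow>
    'a cell set \<Rightarrow> ('a cell \<Rightarrow> (nat \<Rightarrow> real) \<Rightarrow> 'b) set" where
  "euler_lifts Y P D = {e \<in> extensional D.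
     (\<forall>c\<in>D. singular_simplex (fst c) (top_of_set (total P)) (e c) \<and>
        simplex_map (fst c) (proj P) (e c) = snd c) \<and>
     (\<forall>i<ncomp Y.
        (let S = cover_skel P D; C0 = cell_chains S 0;
             x = cell_class S 0 1 (e (core0 Y i));
             z = cell_map S 0 (deck P (knot_class Y i)) x \<otimes>\<^bsub>C0\<^esub> inv\<^bsub>C0\<^esub> x
         in cell_boundary S 0 (cell_class S 1 1 (e (core1 Y i))) \<in> {z, inv\<^bsub>C0\<^esub> z}) \<and>
        e (core1 Y i) start_vertex = e (core0 Y i) start_vertex)}"

text \<open>\<open>f / e\<close>, in \<open>H1orb Y\<close>\<close>

definition lift_ratio :: "'a::t2_space link_orbifold \<Rightarrow> ('a, 'b) orb_cover \<Rightarrow> 'a cell set \<Rightarrow>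
    ('a cell \<Rightarrow> (nat \<Rightarrow> real) \<Rightarrow> 'b) \<Rightarrow> ('a cell \<Rightarrow> (nat \<Rightarrow> real) \<Rightarrow> 'b) \<Rightarrow> 'a chain set set" where
  "lift_ratio Y P D f e = (\<Otimes>\<^bsub>H1orb Y\<^esub>c \<in> D - singular_cells Y.
     (THE g. g \<in> carrier (H1orb Y) \<and> simplex_map (fst c) (deck P g) (e c) = f c)
       [^]\<^bsub>H1orb Y\<^esub> ((-1) ^ fst c :: int))"

definition euler_structures :: "'a::t2_space link_orbifold \<Rightarrow> ('a, 'b::t2_space) orb_cover \<Rightarrow>
    'a cell set \<Rightarrow> ('a cell \<Rightarrow> (nat \<Rightarrow> real) \<Rightarrow> 'b) set set" where
  "euler_structures Y P D = euler_lifts Y P D //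
     {(e, f). e \<in> euler_lifts Y P D \<and> f \<in> euler_lifts Y P D \<and>
        lift_ratio Y P D f e = \<one>\<^bsub>H1orb Y\<^esub>}"

section \<open>The torsion element\<close>

definition cell_orientation :: "'a link_orbifold \<Rightarrow> 'a cell set \<Rightarrow> ('a cell \<Rightarrow> int) \<Rightarrow> bool" where
  "cell_orientation Y D \<epsilon> \<longleftrightarrow> (\<forall>c\<in>D. \<epsilon> c \<in> {1, -1}) \<and> (\<forall>c\<in>singular_cells Y. \<epsilon> c = 1)"

text \<open>\<open>ls n\<close> lists the cells of dimension \<open>n\<close>, those in the link following the order of its
  components.\<close>

definition cell_order :: "'a link_orbifold \<Rightarrow> 'a cell set \<Rightarrow> (nat \<Rightarrow> 'a cell list) \<Rightarrow> bool" where
  "cell_order Y D ls \<longleftrightarrow>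
     (\<forall>n. distinct (ls n) \<and> set (ls n) = {c \<in> D. fst c = n}) \<and>
     filter (\<lambda>c. c \<in> singular_cells Y) (ls 0) = map (core0 Y) [0..<ncomp Y] \<and>
     filter (\<lambda>c. c \<in> singular_cells Y) (ls 1) = map (core1 Y) [0..<ncomp Y]"

text \<open>The order on the cells in the link and an order on the cells away from it do not yet
  determine an order on all cells of a given dimension; one has to fix which positions the cells
  in the link occupy (for instance the first ones). Moving a cell past a cell in the link that
  contributes no basis vector to the twisted complex would change the sign of the torsion of the
  real complex only.\<close>

definition same_link_positions ::
  "'a link_orbifold \<Rightarrow> (nat \<Rightarrow> 'a cell list) \<Rightarrow> (nat \<Rightarrow> 'a cell list) \<Rightarrow> bool" where
  "same_link_positions Y ls ls' \<longleftrightarrow>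
     (\<forall>n. map (\<lambda>c. c \<in> singular_cells Y) (ls n) = map (\<lambda>c. c \<in> singular_cells Y) (ls' n))"

text \<open>\<open>C(|Y|, \<real>)\<close>, and \<open>H\<^sub>n(|Y|, \<real>)\<close> as its homology\<close>

definition real_chains :: "'a::t2_space cell set \<Rightarrow> nat \<Rightarrow> (real, ('a chain set \<Rightarrow> real) set) module" where
  "real_chains D n = tensor_module (cell_chains (skel D) n) ({} :: unit set) (\<lambda>_ x. x) (\<lambda>_. 1)"

definition real_boundary :: "'a::t2_space cell set \<Rightarrow> nat \<Rightarrow>
    ('a chain set \<Rightarrow> real) set \<Rightarrow> ('a chain set \<Rightarrow> real) set" where
  "real_boundary D n = tensor_map (cell_chains (skel D) n) ({} :: unit set) (\<lambda>_ x. x) (\<lambda>_. 1)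
     (cell_boundary (skel D) n)"

definition real_homology :: "'a::t2_space cell set \<Rightarrow> nat \<Rightarrow>
    (real, ('a chain set \<Rightarrow> real) set set) module" where
  "real_homology D = homology_module 3 (real_chains D) (real_boundary D)"

definition homology_orientations ::
  "'a::t2_space cell set \<Rightarrow> (nat \<Rightarrow> ('a chain set \<Rightarrow> real) set set) list set set" where
  "homology_orientations D = orientations (direct_sum_module 3 (real_homology D))"

definition real_basis :: "'a::t2_space cell set \<Rightarrow> (nat \<Rightarrow> 'a cell list) \<Rightarrow> ('a cell \<Rightarrow> int) \<Rightarrow>
    nat \<Rightarrow> ('a chain set \<Rightarrow> real) set list" where
  "real_basis D ls \<epsilon> n =
     map (\<lambda>c. tensor_elt (cell_chains (skel D) n) ({} :: unit set) (\<lambda>_ x. x) (\<lambda>_. 1)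
                (cell_class (skel D) n (\<epsilon> c) (snd c))) (ls n)"

definition torsion_sign :: "'a::t2_space cell set \<Rightarrow> (nat \<Rightarrow> 'a cell list) \<Rightarrow> ('a cell \<Rightarrow> int) \<Rightarrow>
    (nat \<Rightarrow> ('a chain set \<Rightarrow> real) set set list) \<Rightarrow> real" where
  "torsion_sign D ls \<epsilon> w =
     sgn (torsion 3 (real_chains D) (real_boundary D) (real_basis D ls \<epsilon>) w)"

text \<open>In the following \<open>\<phi>\<close> is a homomorphism from the group ring of \<open>H1orb Y\<close>.\<close>

definition twisted_chains :: "'a::t2_space link_orbifold \<Rightarrow> ('a, 'b::t2_space) orb_cover \<Rightarrow>
    'a cell set \<Rightarrow> (('a chain set set \<Rightarrow> int) \<Rightarrow> 'f::field) \<Rightarrow> nat \<Rightarrow>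
    ('f, ('b chain set \<Rightarrow> 'f) set) module" where
  "twisted_chains Y P D \<phi> n = tensor_module (cell_chains (cover_skel P D) n) (carrier (H1orb Y))
     (\<lambda>g. cell_map (cover_skel P D) n (deck P g)) (\<lambda>g. \<phi> (point_mass g))"

definition twisted_boundary :: "'a::t2_space link_orbifold \<Rightarrow> ('a, 'b::t2_space) orb_cover \<Rightarrow>
    'a cell set \<Rightarrow> (('a chain set set \<Rightarrow> int) \<Rightarrow> 'f::field) \<Rightarrow> nat \<Rightarrow>
    ('b chain set \<Rightarrow> 'f) set \<Rightarrow> ('b chain set \<Rightarrow> 'f) set" where
  "twisted_boundary Y P D \<phi> n = tensor_map (cell_chains (cover_skel P D) n) (carrier (H1orb Y))
     (\<lambda>g. cell_map (cover_skel P D) n (deck P g)) (\<lambda>g. \<phi> (point_mass g))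
     (cell_boundary (cover_skel P D) n)"

definition omitted_cells :: "'a::t2_space link_orbifold \<Rightarrow>
    (('a chain set set \<Rightarrow> int) \<Rightarrow> 'f::field) \<Rightarrow> 'a cell set" where
  "omitted_cells Y \<phi> = (\<Union>i \<in> {i. i < ncomp Y \<and> \<phi> (point_mass (meridian_class Y i)) \<noteq> 1}.
     {core0 Y i, core1 Y i})"

definition twisted_basis :: "'a::t2_space link_orbifold \<Rightarrow> ('a, 'b::t2_space) orb_cover \<Rightarrow>
    'a cell set \<Rightarrow> (('a chain set set \<Rightarrow> int) \<Rightarrow> 'f::field) \<Rightarrow>
    ('a cell \<Rightarrow> (nat \<Rightarrow> real) \<Rightarrow> 'b) \<Rightarrow> (nat \<Rightarrow> 'a cell list) \<Rightarrow> ('a cell \<Rightarrow> int) \<Rightarrow>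
    nat \<Rightarrow> ('b chain set \<Rightarrow> 'f) set list" where
  "twisted_basis Y P D \<phi> e ls \<epsilon> n =
     map (\<lambda>c. tensor_elt (cell_chains (cover_skel P D) n) (carrier (H1orb Y))
                (\<lambda>g. cell_map (cover_skel P D) n (deck P g)) (\<lambda>g. \<phi> (point_mass g))
                (cell_class (cover_skel P D) n (\<epsilon> c) (e c)))
       (filter (\<lambda>c. c \<notin> omitted_cells Y \<phi>) (ls n))"

definition orb_torsion :: "'a::t2_space link_orbifold \<Rightarrow> ('a, 'b::t2_space) orb_cover \<Rightarrow>
    'a cell set \<Rightarrow> (('a chain set set \<Rightarrow> int) \<Rightarrow> 'f::field) \<Rightarrow>
    ('a cell \<Rightarrow> (nat \<Rightarrow> real) \<Rightarrow> 'b) \<Rightarrow> (nat \<Rightarrow> 'a cell list) \<Rightarrow> ('a cell \<Rightarrow> int) \<Rightarrow>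
    (nat \<Rightarrow> ('a chain set \<Rightarrow> real) set set list) \<Rightarrow> 'f" where
  "orb_torsion Y P D \<phi> e ls \<epsilon> w =
     (if acyclic_complex 3 (twisted_chains Y P D \<phi>) (twisted_boundary Y P D \<phi>)
      then of_int \<lfloor>torsion_sign D ls \<epsilon> w\<rfloor> *
        torsion 3 (twisted_chains Y P D \<phi>) (twisted_boundary Y P D \<phi>)
          (twisted_basis Y P D \<phi> e ls \<epsilon>) (\<lambda>_. [])
      else 0)"

end

theory Submission
  imports Defs
begin

text \<open>Lifts, orientations and orders of cells, and homology bases enter the torsion through the
  determinants \<open>[a/c]\<close>, so it suffices to follow what they do to each of these. A determinant \<open>[a/c]\<close> is zero unless both families are bases. With
  this convention every comparison below holds for arbitrary families, so that the cellular chain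
  groups, which need not be free over the group ring, are only used through the classes of the
  cells.

  Two lifts in the same Euler structure differ by deck transformations, one for each cell
  (\<open>nonsingular_cell_translate\<close>, \<open>core_cells_translate\<close>). A translation by \<open>g\<close> multiplies the basis
  vector of a cell by \<open>\<phi> g\<close>, hence the torsion by \<open>\<phi> g\<close> or its inverse according to the parity of the
  dimension. For the cells off the link the product of these factors is \<open>\<phi>\<close> of the ratio of the lifts,
  which is 1. On a component of the link, the 1-cell and the 0-cell at which it starts are translated by
  the same element, as lifts of paths are unique, and since their dimensions are adjacent their factors
  cancel; the two cells are either both present in the basis or both omitted
  (\<open>translating_elements\<close>).

  Reversing orientations and permuting the cells off the link multiplies the torsion by a sign in each
  degree. The twisted basis lacks some cells of the real one, but these lie in the link, where nothing
  is reversed or moved. Hence the real and the twisted torsion change by the same sign, and the product of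
  \<open>\<tau>\<^sub>0\<close> with the twisted torsion does not change (\<open>orb_torsion_change_of_cells\<close>).

  Exchanging the homology bases multiplies the real torsion by the determinants of the exchange or their
  inverses (\<open>torsion_change_of_homology_bases\<close>). The product of these determinants is the
  determinant in the direct sum, which is positive if both families realize the same orientation
  (\<open>realizes_orientation_det_pos\<close>), so \<open>\<tau>\<^sub>0\<close> does not change.

  The topological input is that the deck group acts transitively on all fibres, and freely off the
  link. Over the exterior this is part of the notion of a regular cover. Over a solid torus, the radii of
  the disc factor lift to the cover and connect any point to a point over the boundary torus; uniqueness
  of lifts along them carries both properties inwards, transitivity up to the core and freeness to
  all points off the core (\<open>deck_transitive_torus\<close>, \<open>deck_free_torus\<close>).\<close>

section \<open>Determinants of changes of basis\<close>

lemma field_ring_simps [simp]: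
  "carrier field_ring = UNIV" "a \<otimes>\<^bsub>field_ring\<^esub> b = a * b" "\<one>\<^bsub>field_ring\<^esub> = 1"
  "\<zero>\<^bsub>field_ring\<^esub> = 0" "a \<oplus>\<^bsub>field_ring\<^esub> b = a + b"
  by (auto simp: field_ring_def)

lemma cring_field_ring: "cring (field_ring :: 'f::field ring)"
proof (rule cringI)
  show "abelian_group (field_ring :: 'f ring)"
    by (rule abelian_groupI) (auto simp: add.assoc add.commute intro: exI[of _ "- _"] left_minus)
  show "Group.comm_monoid (field_ring :: 'f ring)"
    by (rule Group.comm_monoidI) (auto simp: mult.assoc mult.commute)
qed (auto simp: distrib_right)

locale vector_module =
  fixes M :: "('f::field, 'v) module" (structure)
  assumes module_axiom: "Module.module field_ring M"
begin

sublocale V: Module.module field_ring M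
  by (rule module_axiom)

lemma smult_closed' [simp, intro]: "x \<in> carrier M \<Longrightarrow> a \<odot> x \<in> carrier M"
  using V.smult_closed by simp

lemma smult_l_distr': "x \<in> carrier M \<Longrightarrow> (a + b) \<odot> x = a \<odot> x \<oplus> b \<odot> x"
  using V.smult_l_distr[of a b x] by simp

lemma smult_r_distr': "x \<in> carrier M \<Longrightarrow> y \<in> carrier M \<Longrightarrow> a \<odot> (x \<oplus> y) = a \<odot> x \<oplus> a \<odot> y"
  using V.smult_r_distr[of a x y] by simp

lemma smult_assoc': "x \<in> carrier M \<Longrightarrow> a \<odot> (b \<odot> x) = (a * b) \<odot> x"
  using V.smult_assoc1[of a b x] by simp

lemma smult_one' [simp]: "x \<in> carrier M \<Longrightarrow> 1 \<odot> x = x"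
  using V.smult_one[of x] by simp

lemma smult_zero' [simp]: "x \<in> carrier M \<Longrightarrow> 0 \<odot> x = \<zero>"
  using V.smult_l_null[of x] by simp

lemma smult_r_zero' [simp]: "a \<odot> \<zero> = \<zero>"
  using V.smult_r_null[of a] by simp

lemma smult_minus_one: "x \<in> carrier M \<Longrightarrow> (-1) \<odot> x = \<ominus> x"
  using smult_l_distr'[of x "-1" 1] by (intro V.M.minus_equality[symmetric]) auto

lemma lin_comb_closed [simp, intro]:
  assumes "set xs \<subseteq> carrier M" shows "lin_comb M a xs \<in> carrier M"
  unfolding lin_comb_def using assms by (intro V.M.finsum_closed) (auto simp: subset_eq)

lemma lin_comb_cong:
  assumes "set xs \<subseteq> carrier M" "\<And>i. i < length xs \<Longrightarrow> a i = b i"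
  shows "lin_comb M a xs = lin_comb M b xs"
  unfolding lin_comb_def using assms by (intro V.M.finsum_cong') (auto simp: subset_eq)

lemma lin_comb_add:
  assumes "set xs \<subseteq> carrier M"
  shows "lin_comb M (\<lambda>i. a i + b i) xs = lin_comb M a xs \<oplus> lin_comb M b xs"
proof -
  have "lin_comb M (\<lambda>i. a i + b i) xs = (\<Oplus>i\<in>{..<length xs}. a i \<odot> (xs ! i) \<oplus> b i \<odot> (xs ! i))"
    unfolding lin_comb_def using assms
    by (intro V.M.finsum_cong') (auto simp: subset_eq smult_l_distr')
  also have "\<dots> = lin_comb M a xs \<oplus> lin_comb M b xs"
    unfolding lin_comb_def using assms by (intro V.M.finsum_addf) (auto simp: subset_eq)
  finally show ?thesis .
qed

lemma lin_comb_smult: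
  assumes "set xs \<subseteq> carrier M"
  shows "lin_comb M (\<lambda>i. s * a i) xs = s \<odot> lin_comb M a xs"
proof -
  have "s \<odot> lin_comb M a xs = (\<Oplus>i\<in>{..<length xs}. s \<odot> (a i \<odot> (xs ! i)))"
    unfolding lin_comb_def using assms
    by (intro V.finsum_smult_ldistr) (auto simp: subset_eq)
  also have "\<dots> = lin_comb M (\<lambda>i. s * a i) xs"
    unfolding lin_comb_def using assms
    by (intro V.M.finsum_cong') (auto simp: subset_eq smult_assoc')
  finally show ?thesis by simp
qed

lemma lin_comb_Nil [simp]: "lin_comb M a [] = \<zero>"
  by (simp add: lin_comb_def)

lemma lin_comb_snoc:
  assumes "set xs \<subseteq> carrier M" "x \<in> carrier M"
  shows "lin_comb M a (xs @ [x]) = lin_comb M a xs \<oplus> a (length xs) \<odot> x"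
proof -
  have "lin_comb M a (xs @ [x]) =
      (\<Oplus>i\<in>insert (length xs) {..<length xs}. a i \<odot> ((xs @ [x]) ! i))"
    unfolding lin_comb_def by (simp add: lessThan_Suc)
  also have "\<dots> = a (length xs) \<odot> x \<oplus> (\<Oplus>i\<in>{..<length xs}. a i \<odot> ((xs @ [x]) ! i))"
    using assms by (subst V.M.finsum_insert) (auto simp: subset_eq nth_append)
  also have "(\<Oplus>i\<in>{..<length xs}. a i \<odot> ((xs @ [x]) ! i)) = lin_comb M a xs"
    unfolding lin_comb_def using assms
    by (intro V.M.finsum_cong') (auto simp: subset_eq nth_append)
  finally show ?thesis using assms by (simp add: V.M.a_comm)
qed

lemma lin_comb_append:
  assumes "set xs \<subseteq> carrier M" "set ys \<subseteq> carrier M"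
  shows "lin_comb M a (xs @ ys) = lin_comb M a xs \<oplus> lin_comb M (\<lambda>i. a (i + length xs)) ys"
  using assms(2)
proof (induction ys rule: rev_induct)
  case Nil then show ?case using assms by simp
next
  case (snoc y ys)
  have "lin_comb M a (xs @ ys @ [y]) = lin_comb M a (xs @ ys) \<oplus> a (length xs + length ys) \<odot> y"
    using lin_comb_snoc[of "xs @ ys" y a] snoc assms by simp
  then show ?case
    using snoc assms by (simp add: lin_comb_snoc V.M.a_assoc add.commute)
qed

lemma lin_comb_0:
  assumes "set xs \<subseteq> carrier M" shows "lin_comb M (\<lambda>i. 0) xs = \<zero>"
  using lin_comb_smult[OF assms, of 0 "\<lambda>_. 0"] assms by simp

lemma lin_comb_zero:
  assumes "set xs \<subseteq> carrier M" "\<And>i. i < length xs \<Longrightarrow> a i = 0"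
  shows "lin_comb M a xs = \<zero>"
  using lin_comb_cong[OF assms(1), of a "\<lambda>_. 0"] lin_comb_0 assms by simp

lemma lin_comb_unit:
  assumes "set xs \<subseteq> carrier M" "i < length xs"
  shows "lin_comb M (\<lambda>j. if j = i then 1 else 0) xs = xs ! i"
proof -
  have "lin_comb M (\<lambda>j. if j = i then 1 else 0) xs =
      (\<Oplus>j\<in>{..<length xs}. if i = j then xs ! j else \<zero>)"
    unfolding lin_comb_def using assms by (intro V.M.finsum_cong') (auto simp: subset_eq)
  also have "\<dots> = xs ! i"
    using assms by (intro V.M.finsum_singleton) (auto simp: subset_eq)
  finally show ?thesis .
qed

lemma lin_comb_lin_comb:
  assumes "set c \<subseteq> carrier M" "\<And>k. k < length a \<Longrightarrow> a ! k = lin_comb M (A k) c"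
  shows "lin_comb M x a = lin_comb M (\<lambda>j. \<Sum>k<length a. x k * A k j) c"
  using assms(2)
proof (induction a rule: rev_induct)
  case Nil then show ?case using assms by (simp add: lin_comb_0)
next
  case (snoc y a)
  have 1: "a ! k = lin_comb M (A k) c" if "k < length a" for k
    using snoc.prems[of k] that by (simp add: nth_append)
  have y: "y = lin_comb M (A (length a)) c" using snoc.prems[of "length a"] by simp
  have "set a \<subseteq> carrier M" using 1 assms(1) by (auto simp: in_set_conv_nth)
  then have "lin_comb M x (a @ [y]) = lin_comb M x a \<oplus> x (length a) \<odot> y"
    using y assms(1) by (intro lin_comb_snoc) auto
  also have "\<dots> = lin_comb M (\<lambda>j. \<Sum>k<length a. x k * A k j) c
      \<oplus> lin_comb M (\<lambda>j. x (length a) * A (length a) j) c"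
    using snoc.IH 1 y assms(1) by (simp add: lin_comb_smult)
  also have "\<dots> = lin_comb M (\<lambda>j. (\<Sum>k<length a. x k * A k j) + x (length a) * A (length a) j) c"
    by (rule lin_comb_add[symmetric]) (rule assms)
  finally show ?case by simp
qed

lemma ordered_basisI:
  assumes "set xs \<subseteq> carrier M"
    and span: "\<And>v. v \<in> carrier M \<Longrightarrow> \<exists>a. v = lin_comb M a xs"
    and indep: "\<And>a i. lin_comb M a xs = \<zero> \<Longrightarrow> i < length xs \<Longrightarrow> a i = 0"
  shows "ordered_basis M xs"
  unfolding ordered_basis_def
proof (intro conjI ballI ex_ex1I)
  fix v assume "v \<in> carrier M"
  then obtain a where a: "v = lin_comb M a xs" using span by blast
  show "\<exists>a. a \<in> {..<length xs} \<rightarrow>\<^sub>E UNIV \<and> v = lin_comb M a xs"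
    using a lin_comb_cong[OF assms(1), of a "restrict a {..<length xs}"]
    by (intro exI[of _ "restrict a {..<length xs}"]) auto
next
  fix v a b assume a: "a \<in> {..<length xs} \<rightarrow>\<^sub>E UNIV \<and> v = lin_comb M a xs"
    and b: "b \<in> {..<length xs} \<rightarrow>\<^sub>E UNIV \<and> v = lin_comb M b xs"
  have "lin_comb M (\<lambda>i. a i + (-1) * b i) xs = lin_comb M a xs \<oplus> (-1) \<odot> lin_comb M b xs"
    unfolding lin_comb_add[OF assms(1)] lin_comb_smult[OF assms(1)] by (rule refl)
  also have "\<dots> = \<zero>"
    using a b assms(1) by (metis lin_comb_closed smult_minus_one V.M.r_neg)
  finally have "a i = b i" if "i < length xs" for i using indep[OF _ that] by fastforce
  then show "a = b" using a b by (intro ext) (metis PiE_arb lessThan_iff)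
qed (use assms in auto)

lemma ordered_basis_subset: "ordered_basis M xs \<Longrightarrow> set xs \<subseteq> carrier M"
  by (simp add: ordered_basis_def)

lemma coords_props:
  assumes "ordered_basis M xs" "v \<in> carrier M"
  shows "coords M xs v \<in> {..<length xs} \<rightarrow>\<^sub>E UNIV" "lin_comb M (coords M xs v) xs = v"
proof -
  have "\<exists>!a. a \<in> {..<length xs} \<rightarrow>\<^sub>E UNIV \<and> v = lin_comb M a xs"
    using assms by (simp add: ordered_basis_def)
  from theI'[OF this] show "coords M xs v \<in> {..<length xs} \<rightarrow>\<^sub>E UNIV" "lin_comb M (coords M xs v) xs = v"
    unfolding coords_def by auto
qed

lemma lin_comb_inj:
  assumes "ordered_basis M xs" "lin_comb M a xs = lin_comb M b xs" "i < length xs"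
  shows "a i = b i"
proof -
  have sub: "set xs \<subseteq> carrier M" using assms by (simp add: ordered_basis_def)
  have r: "lin_comb M a xs = lin_comb M (restrict a {..<length xs}) xs"
    by (rule lin_comb_cong[OF sub]) simp
  have r': "lin_comb M b xs = lin_comb M (restrict b {..<length xs}) xs"
    by (rule lin_comb_cong[OF sub]) simp
  have "\<exists>!a'. a' \<in> {..<length xs} \<rightarrow>\<^sub>E UNIV \<and> lin_comb M a xs = lin_comb M a' xs"
    using assms(1) lin_comb_closed[OF sub] unfolding ordered_basis_def by blast
  then obtain z where z: "\<And>y. y \<in> {..<length xs} \<rightarrow>\<^sub>E UNIV \<Longrightarrow> lin_comb M a xs = lin_comb M y xs \<Longrightarrow> y = z"
    by (elim ex1E) metis
  have "restrict a {..<length xs} = z" by (rule z[OF _ r]) simp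
  moreover have "restrict b {..<length xs} = z" by (rule z[OF _ trans[OF assms(2) r']]) simp
  ultimately have "restrict a {..<length xs} = restrict b {..<length xs}" by simp
  from fun_cong[OF this, of i] show ?thesis using assms(3) by simp
qed

lemma coords_lin_comb:
  assumes "ordered_basis M xs" "i < length xs"
  shows "coords M xs (lin_comb M a xs) i = a i"
  by (rule lin_comb_inj[OF assms(1) _ assms(2)])
    (rule coords_props(2)[OF assms(1) lin_comb_closed[OF ordered_basis_subset[OF assms(1)]]])

lemma coords_nth:
  assumes "ordered_basis M xs" "i < length xs" "j < length xs"
  shows "coords M xs (xs ! i) j = (if j = i then 1 else 0)"
  using coords_lin_comb[OF assms(1,3), of "\<lambda>j. if j = i then 1 else 0"]
    lin_comb_unit[OF ordered_basis_subset[OF assms(1)] assms(2)] by simp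

lemma coords_trans:
  assumes "ordered_basis M a" "ordered_basis M c" "v \<in> carrier M" "j < length c"
  shows "coords M c v j = (\<Sum>k<length a. coords M a v k * coords M c (a ! k) j)"
proof -
  have "a ! k = lin_comb M (coords M c (a ! k)) c" if "k < length a" for k
    using that coords_props(2)[OF assms(2), of "a ! k"] ordered_basis_subset[OF assms(1)]
    by (auto simp: subset_eq)
  then have "lin_comb M (coords M a v) a =
      lin_comb M (\<lambda>j. \<Sum>k<length a. coords M a v k * coords M c (a ! k) j) c"
    by (intro lin_comb_lin_comb ordered_basis_subset assms)
  then have "v = lin_comb M (\<lambda>j. \<Sum>k<length a. coords M a v k * coords M c (a ! k) j) c"
    using coords_props(2)[OF assms(1,3)] by simp
  then show ?thesis using coords_lin_comb[OF assms(2,4)] by metis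
qed

end

text \<open>Zero rows make the matrix of the system square, with determinant zero.\<close>

lemma wide_system_has_nonzero_solution:
  fixes A :: "nat \<Rightarrow> nat \<Rightarrow> 'f::field"
  assumes "m < n"
  shows "\<exists>x. (\<exists>k<n. x k \<noteq> 0) \<and> (\<forall>j<m. (\<Sum>k<n. x k * A k j) = 0)"
proof -
  define B where "B = Matrix.mat n n (\<lambda>(j, k). if j < m then A k j else 0)"
  have B: "B \<in> carrier_mat n n" by (simp add: B_def)
  have "transpose_mat B *\<^sub>v unit_vec n m = 0\<^sub>v n"
  proof (rule eq_vecI)
    fix i assume "i < dim_vec (0\<^sub>v n :: 'f vec)"
    then have i: "i < n" by simp
    have "row (transpose_mat B) i = col B i" using B i by simp
    then show "vec_index (transpose_mat B *\<^sub>v unit_vec n m) i = vec_index (0\<^sub>v n) i"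
      using i B assms by (simp add: B_def)
  qed (use B in auto)
  moreover have "unit_vec n m \<noteq> (0\<^sub>v n :: 'f vec)"
    using assms by (metis index_unit_vec(1) index_zero_vec(1) zero_neq_one)
  ultimately have "Determinant.det (transpose_mat B) = 0"
    using B by (subst det_0_iff_vec_prod_zero[of _ n]) (auto intro!: exI[of _ "unit_vec n m"])
  then have "Determinant.det B = 0" using det_transpose[OF B] by simp
  then obtain v where v: "v \<in> carrier_vec n" "v \<noteq> 0\<^sub>v n" "B *\<^sub>v v = 0\<^sub>v n"
    using det_0_iff_vec_prod_zero[OF B] by auto
  have "\<exists>k<n. vec_index v k \<noteq> 0" using v(1,2) by (metis carrier_vecD eq_vecI index_zero_vec)
  moreover have "(\<Sum>k<n. vec_index v k * A k j) = 0" if j: "j < m" for j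
  proof -
    have "vec_index (B *\<^sub>v v) j = 0" using v(3) j assms by simp
    then show ?thesis
      using j assms v(1) by (simp add: B_def scalar_prod_def lessThan_atLeast0 mult.commute)
  qed
  ultimately show ?thesis by (intro exI[of _ "\<lambda>k. vec_index v k"]) auto
qed

context vector_module
begin

lemma ordered_basis_length_le:
  assumes a: "ordered_basis M a" and c: "ordered_basis M c"
  shows "length a \<le> length c"
proof (rule ccontr)
  assume "\<not> length a \<le> length c"
  then obtain x k where x: "k < length a" "x k \<noteq> 0"
    "\<forall>j<length c. (\<Sum>k<length a. x k * coords M c (a ! k) j) = 0"
    using wide_system_has_nonzero_solution[of "length c" "length a"] by (metis not_le)
  have "lin_comb M x a = lin_comb M (\<lambda>j. \<Sum>k<length a. x k * coords M c (a ! k) j) c"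
    using coords_props(2)[OF c] ordered_basis_subset[OF a]
    by (intro lin_comb_lin_comb ordered_basis_subset c) (metis nth_mem subsetD)
  also have "\<dots> = \<zero>" using x(3) by (intro lin_comb_zero ordered_basis_subset c) auto
  also have "\<zero> = lin_comb M (\<lambda>_. 0) a" by (simp add: lin_comb_0 ordered_basis_subset a)
  finally show False using lin_comb_inj[OF a _ x(1)] x(2) by blast
qed

lemma ordered_basis_length:
  "ordered_basis M a \<Longrightarrow> ordered_basis M c \<Longrightarrow> length a = length c"
  by (intro antisym ordered_basis_length_le)

lemma basis_det_eq:
  assumes "ordered_basis M a" "ordered_basis M c"
  shows "basis_det M a c =
    Determinant.det (Matrix.mat (length c) (length c) (\<lambda>(i, j). coords M c (a ! i) j))"
  using assms by (simp add: basis_det_def)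

lemma basis_det_mult:
  assumes "ordered_basis M a" "ordered_basis M b" "ordered_basis M c"
  shows "basis_det M a c = basis_det M a b * basis_det M b c"
proof -
  let ?n = "length c"
  have len: "length a = ?n" "length b = ?n" using ordered_basis_length assms by metis+
  let ?AB = "Matrix.mat ?n ?n (\<lambda>(i, j). coords M b (a ! i) j)"
  let ?BC = "Matrix.mat ?n ?n (\<lambda>(i, j). coords M c (b ! i) j)"
  have "Matrix.mat ?n ?n (\<lambda>(i, j). coords M c (a ! i) j) = ?AB * ?BC"
    using ordered_basis_subset[OF assms(1)] len coords_trans[OF assms(2,3)]
    by (intro eq_matI) (auto simp: scalar_prod_def lessThan_atLeast0 subset_eq)
  then show ?thesis
    using assms len by (simp add: basis_det_eq det_mult[of _ ?n])
qed

lemma basis_det_refl: "ordered_basis M a \<Longrightarrow> basis_det M a a = 1"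
proof -
  assume a: "ordered_basis M a"
  have "Matrix.mat (length a) (length a) (\<lambda>(i, j). coords M a (a ! i) j) = 1\<^sub>m (length a)"
    by (intro eq_matI) (auto simp: coords_nth[OF a])
  then show ?thesis by (simp add: basis_det_eq[OF a a])
qed

lemma basis_det_nonzero:
  "ordered_basis M a \<Longrightarrow> ordered_basis M c \<Longrightarrow> basis_det M a c \<noteq> 0"
  using basis_det_mult[of a c a] basis_det_refl[of a] by auto

text \<open>All bases below are obtained from given ones by an invertible matrix. Its inverse expresses the
  given basis through the new family, which therefore spans; the new family is independent since the
  transposed matrix has no kernel.\<close>

lemma ordered_basis_of_invertible:
  assumes c: "ordered_basis M c" and len: "length a = length c"
    and a: "\<And>k. k < length c \<Longrightarrow> a ! k = lin_comb M (A k) c"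
    and d: "Determinant.det (Matrix.mat (length c) (length c) (\<lambda>(i, j). A i j)) \<noteq> 0"
  shows "ordered_basis M a"
    "basis_det M a c = Determinant.det (Matrix.mat (length c) (length c) (\<lambda>(i, j). A i j))"
proof -
  let ?n = "length c"
  define B where "B = Matrix.mat ?n ?n (\<lambda>(i, j). A i j)"
  have B: "B \<in> carrier_mat ?n ?n" by (simp add: B_def)
  have cM: "set c \<subseteq> carrier M" using c by (rule ordered_basis_subset)
  have aM: "set a \<subseteq> carrier M"
    using a len cM by (auto simp: in_set_conv_nth)
  have lc: "lin_comb M x a = lin_comb M (\<lambda>j. \<Sum>k<?n. x k * A k j) c" for x
    using lin_comb_lin_comb[OF cM, of a A x] a len by simp
  obtain I where I: "I \<in> carrier_mat ?n ?n" "I * B = 1\<^sub>m ?n"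
    using det_non_zero_imp_unit[OF B, of "()"] d
    unfolding B_def[symmetric] Units_def ring_mat_def by auto
  have IB: "(\<Sum>k<?n. I $$ (i, k) * A k j) = (if i = j then 1 else 0)" if "i < ?n" "j < ?n" for i j
  proof -
    have "(I * B) $$ (i, j) = (\<Sum>k<?n. I $$ (i, k) * A k j)"
      using that I(1) by (simp add: B_def scalar_prod_def lessThan_atLeast0)
    then show ?thesis using I(2) that by simp
  qed
  show ob: "ordered_basis M a"
  proof (rule ordered_basisI[OF aM])
    fix v assume v: "v \<in> carrier M"
    define y where "y = coords M c v"
    have "lin_comb M (\<lambda>k. \<Sum>i<?n. y i * I $$ (i, k)) a
        = lin_comb M (\<lambda>j. \<Sum>k<?n. (\<Sum>i<?n. y i * I $$ (i, k)) * A k j) c" by (rule lc)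
    also have "\<dots> = lin_comb M y c"
    proof (rule lin_comb_cong[OF cM])
      fix j assume j: "j < ?n"
      have "(\<Sum>k<?n. (\<Sum>i<?n. y i * I $$ (i, k)) * A k j)
          = (\<Sum>i<?n. y i * (\<Sum>k<?n. I $$ (i, k) * A k j))"
        by (simp add: sum_distrib_left sum_distrib_right mult.assoc) (rule sum.swap)
      also have "\<dots> = (\<Sum>i<?n. if i = j then y i else 0)" using j by (intro sum.cong) (auto simp: IB)
      also have "\<dots> = y j" using j by simp
      finally show "(\<Sum>k<?n. (\<Sum>i<?n. y i * I $$ (i, k)) * A k j) = y j" .
    qed
    also have "\<dots> = v" unfolding y_def by (rule coords_props[OF c v])
    finally show "\<exists>a'. v = lin_comb M a' a" by metis
  next
    fix x i assume x: "lin_comb M x a = \<zero>" and i: "i < length a"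
    have z: "(\<Sum>k<?n. x k * A k j) = 0" if "j < ?n" for j
      using lin_comb_inj[OF c _ that, of "\<lambda>j. \<Sum>k<?n. x k * A k j" "\<lambda>_. 0"] x lc lin_comb_0[OF cM]
      by simp
    have "transpose_mat B *\<^sub>v Matrix.vec ?n x = 0\<^sub>v ?n"
      using z by (intro eq_vecI)
        (auto simp: B_def scalar_prod_def lessThan_atLeast0 mult.commute)
    then have "Matrix.vec ?n x = 0\<^sub>v ?n"
      using det_0_iff_vec_prod_zero[of "transpose_mat B" ?n] det_transpose[OF B] d B
      by (metis B_def transpose_carrier_mat vec_carrier)
    then show "x i = 0" using i len by (metis index_vec index_zero_vec(1))
  qed
  have "Matrix.mat ?n ?n (\<lambda>(i, j). coords M c (a ! i) j) = B"
    unfolding B_def using a coords_lin_comb[OF c] by (intro eq_matI) auto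
  then show "basis_det M a c = Determinant.det (Matrix.mat ?n ?n (\<lambda>(i, j). A i j))"
    using basis_det_eq[OF ob c] by (simp add: B_def)
qed

text \<open>If a block of a basis is replaced modulo the span of the vectors preceding it, the matrix of
  the change of basis is block triangular, so only the square block in the middle counts.\<close>

lemma basis_det_replace_block:
  assumes base: "ordered_basis M (X @ h @ Y)" and len: "length h' = length h"
    and h': "\<And>j. j < length h \<Longrightarrow> h' ! j = lin_comb M (B j) X \<oplus> lin_comb M (A j) h"
    and d: "Determinant.det (Matrix.mat (length h) (length h) (\<lambda>(j, k). A j k)) \<noteq> 0"
  shows "ordered_basis M (X @ h' @ Y)"
    "basis_det M (X @ h' @ Y) (X @ h @ Y) =
      Determinant.det (Matrix.mat (length h) (length h) (\<lambda>(j, k). A j k))"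
proof -
  let ?p = "length X" and ?q = "length h" and ?r = "length Y"
  let ?c = "X @ h @ Y" and ?a = "X @ h' @ Y"
  have sub: "set X \<subseteq> carrier M" "set h \<subseteq> carrier M" "set Y \<subseteq> carrier M"
    using ordered_basis_subset[OF base] by auto
  define C where "C = (\<lambda>i j. if i < ?p \<or> ?p + ?q \<le> i then (if i = j then 1 else 0)
    else if j < ?p then B (i - ?p) j else if j < ?p + ?q then A (i - ?p) (j - ?p) else (0::'f))"
  have C: "?a ! i = lin_comb M (C i) ?c" if i: "i < length ?c" for i
  proof (cases "i < ?p \<or> ?p + ?q \<le> i")
    case True
    then have "?a ! i = ?c ! i" using len by (auto simp: nth_append)
    moreover have "lin_comb M (C i) ?c = lin_comb M (\<lambda>j. if j = i then 1 else 0) ?c"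
      using True sub by (intro lin_comb_cong) (auto simp: C_def)
    ultimately show ?thesis using lin_comb_unit[OF ordered_basis_subset[OF base] i] by simp
  next
    case False
    then have "?a ! i = h' ! (i - ?p)" using len by (auto simp: nth_append)
    also have "\<dots> = lin_comb M (B (i - ?p)) X \<oplus> lin_comb M (A (i - ?p)) h"
      using False by (intro h') auto
    also have "\<dots> = lin_comb M (C i) X \<oplus> lin_comb M (\<lambda>k. C i (k + ?p)) h
        \<oplus> lin_comb M (\<lambda>k. C i (k + (?p + ?q))) Y"
    proof -
      have "lin_comb M (B (i - ?p)) X = lin_comb M (C i) X"
        using False sub by (intro lin_comb_cong) (auto simp: C_def)
      moreover have "lin_comb M (A (i - ?p)) h = lin_comb M (\<lambda>k. C i (k + ?p)) h"
        using False sub by (intro lin_comb_cong) (auto simp: C_def)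
      moreover have "lin_comb M (\<lambda>k. C i (k + (?p + ?q))) Y = \<zero>"
        using False sub by (intro lin_comb_zero) (auto simp: C_def)
      ultimately show ?thesis using sub by simp
    qed
    also have "\<dots> = lin_comb M (C i) ?c"
      using sub by (simp add: lin_comb_append V.M.a_assoc add_ac)
    finally show ?thesis .
  qed
  let ?A = "Matrix.mat ?q ?q (\<lambda>(j, k). A j k)"
  let ?B = "Matrix.mat ?q ?p (\<lambda>(j, k). B j k)"
  let ?U = "four_block_mat (1\<^sub>m ?p) (0\<^sub>m ?p ?q) ?B ?A"
  have "Matrix.mat (length ?c) (length ?c) (\<lambda>(i, j). C i j) =
      four_block_mat ?U (0\<^sub>m (?p + ?q) ?r) (0\<^sub>m ?r (?p + ?q)) (1\<^sub>m ?r)"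
    by (intro eq_matI) (auto simp: C_def)
  also have "Determinant.det \<dots> = Determinant.det ?U * Determinant.det (1\<^sub>m ?r)"
    by (intro det_four_block_mat_upper_right_zero[of _ "?p + ?q" _ ?r]) auto
  also have "Determinant.det ?U = Determinant.det (1\<^sub>m ?p) * Determinant.det ?A"
    by (intro det_four_block_mat_upper_right_zero[of _ ?p _ ?q]) auto
  finally have det: "Determinant.det (Matrix.mat (length ?c) (length ?c) (\<lambda>(i, j). C i j))
    = Determinant.det ?A" by simp
  show "ordered_basis M ?a" "basis_det M ?a ?c = Determinant.det ?A"
    using ordered_basis_of_invertible[OF base _ C] det d len by auto
qed

lemma scale_basis:
  assumes dist: "distinct xs" and base: "ordered_basis M (map v xs)"
    and v': "\<And>x. x \<in> set xs \<Longrightarrow> v' x = s x \<odot> v x" and s: "\<And>x. x \<in> set xs \<Longrightarrow> s x \<noteq> 0"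
  shows "ordered_basis M (map v' xs)"
    "basis_det M (map v' xs) (map v xs) = (\<Prod>x\<in>set xs. s x)"
proof -
  let ?n = "length (map v xs)"
  define A where "A = (\<lambda>i j. if i = j then s (xs ! i) else (0::'f))"
  have A: "map v' xs ! k = lin_comb M (A k) (map v xs)" if k: "k < ?n" for k
  proof -
    have "lin_comb M (A k) (map v xs)
        = lin_comb M (\<lambda>j. s (xs ! k) * (if j = k then 1 else 0)) (map v xs)"
      by (intro lin_comb_cong ordered_basis_subset base) (auto simp: A_def)
    also have "\<dots> = s (xs ! k) \<odot> map v xs ! k"
      unfolding lin_comb_smult[OF ordered_basis_subset[OF base]]
        lin_comb_unit[OF ordered_basis_subset[OF base] k] by (rule refl)
    finally show ?thesis using k v' by simp
  qed
  have "Determinant.det (Matrix.mat ?n ?n (\<lambda>(i, j). A i j))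
      = prod_list (diag_mat (Matrix.mat ?n ?n (\<lambda>(i, j). A i j)))"
    by (rule det_lower_triangular[of ?n]) (auto simp: A_def)
  also have "\<dots> = (\<Prod>i<length xs. s (xs ! i))"
    by (simp add: prod_list_diag_prod A_def lessThan_atLeast0)
  also have "\<dots> = (\<Prod>x\<in>set xs. s x)"
    by (rule prod.reindex_bij_betw[OF bij_betw_nth[OF dist refl refl]])
  finally have det: "Determinant.det (Matrix.mat ?n ?n (\<lambda>(i, j). A i j)) = (\<Prod>x\<in>set xs. s x)" .
  show "ordered_basis M (map v' xs)"
    "basis_det M (map v' xs) (map v xs) = (\<Prod>x\<in>set xs. s x)"
    using ordered_basis_of_invertible[OF base _ A] det s by auto
qed

text \<open>A permutation is built up from transpositions, for which the matrix of the change is an identity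
  matrix with two rows swapped.\<close>

lemma transpose_basis:
  assumes dist: "distinct xs" and base: "ordered_basis M (map v xs)"
    and ab: "a \<in> set xs" "b \<in> set xs" "a \<noteq> b"
  shows "ordered_basis M (map (v \<circ> Transposition.transpose a b) xs)"
    "basis_det M (map (v \<circ> Transposition.transpose a b) xs) (map v xs) = -1"
proof -
  let ?n = "length (map v xs)"
  obtain i k where ik: "i < length xs" "k < length xs" "xs ! i = a" "xs ! k = b"
    using ab by (metis in_set_conv_nth)
  have "i \<noteq> k" using ik ab by auto
  let ?t = "\<lambda>j. if j = i then k else if j = k then i else j"
  define A where "A = (\<lambda>j l. if l = ?t j then 1 else (0::'f))"
  have A: "map (v \<circ> Transposition.transpose a b) xs ! j = lin_comb M (A j) (map v xs)"
    if j: "j < ?n" for j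
  proof -
    have t: "?t j < length xs" using j ik by simp
    have "Transposition.transpose a b (xs ! j) = xs ! ?t j"
      using ik j dist by (auto simp: nth_eq_iff_index_eq Transposition.transpose_def)
    then have "map (v \<circ> Transposition.transpose a b) xs ! j = map v xs ! ?t j"
      using j t by simp
    also have "\<dots> = lin_comb M (\<lambda>l. if l = ?t j then 1 else 0) (map v xs)"
      using t by (intro lin_comb_unit[OF ordered_basis_subset[OF base], symmetric]) simp
    finally show ?thesis by (simp add: A_def)
  qed
  have "Matrix.mat ?n ?n (\<lambda>(i, j). A i j) = swaprows i k (1\<^sub>m ?n)"
    using ik by (intro eq_matI) (auto simp: A_def)
  then have "Determinant.det (Matrix.mat ?n ?n (\<lambda>(i, j). A i j)) = Determinant.det (swaprows i k (1\<^sub>m ?n))"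
    by (rule arg_cong)
  also have "\<dots> = - Determinant.det (1\<^sub>m ?n)"
    using ik \<open>i \<noteq> k\<close> by (intro det_swaprows) auto
  finally have det: "Determinant.det (Matrix.mat ?n ?n (\<lambda>(i, j). A i j)) = -1"
    by (simp only: det_one)
  show "ordered_basis M (map (v \<circ> Transposition.transpose a b) xs)"
    "basis_det M (map (v \<circ> Transposition.transpose a b) xs) (map v xs) = -1"
    using ordered_basis_of_invertible[OF base _ A] det by auto
qed

lemma permute_basis:
  assumes dist: "distinct xs" and \<sigma>: "\<sigma> permutes set xs" and "ordered_basis M (map v xs)"
  shows "ordered_basis M (map (v \<circ> \<sigma>) xs)
    \<and> basis_det M (map (v \<circ> \<sigma>) xs) (map v xs) = of_int (sign \<sigma>)"
  using \<sigma> finite_set assms(3)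
proof (induction arbitrary: v rule: permutes_induct)
  case id
  then show ?case by (simp add: basis_det_refl)
next
  case (swap a b p)
  let ?t = "Transposition.transpose a b"
  note t = transpose_basis[OF dist swap.prems swap.hyps(1-3)]
  note p = swap.IH[OF t(1)]
  have "permutation p" using swap.hyps by (metis finite_set permutation_permutes)
  then have "sign (?t \<circ> p) = - sign p"
    using swap.hyps(3) by (simp add: sign_compose permutation_swap_id sign_swap_id)
  moreover have "basis_det M (map (v \<circ> ?t \<circ> p) xs) (map v xs) = of_int (sign p) * -1"
    using basis_det_mult[OF conjunct1[OF p] t(1) swap.prems] unfolding conjunct2[OF p] t(2) .
  ultimately show ?case using conjunct1[OF p] unfolding comp_assoc by (simp only: of_int_minus mult_minus_right mult_1_right simp_thms)
qed

text \<open>If the family of the \<open>v x\<close> is not a basis, neither is the changed one, and both sides vanish.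
  Otherwise the change of the reference basis is monomial.\<close>

lemma basis_det_monomial_change:
  assumes dist: "distinct xs" and \<sigma>: "\<sigma> permutes set xs"
    and v: "\<And>x. x \<in> set xs \<Longrightarrow> v x \<in> carrier M"
    and v': "\<And>x. x \<in> set xs \<Longrightarrow> v' x = s x \<odot> v x" and s: "\<And>x. x \<in> set xs \<Longrightarrow> s x \<noteq> 0"
  shows "basis_det M a (map v xs) =
    (\<Prod>x\<in>set xs. s x) * of_int (sign \<sigma>) * basis_det M a (map v' (map \<sigma> xs))"
proof -
  have unscale: "v x = inverse (s x) \<odot> v' x" if "x \<in> set xs" for x
    using v' s v that by (simp add: smult_assoc')
  let ?\<tau> = "inv_into UNIV \<sigma>"
  have \<tau>: "?\<tau> permutes set xs" using \<sigma> by (rule permutes_inv)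
  have "ordered_basis M (map v xs)" if "ordered_basis M (map (v' \<circ> \<sigma>) xs)"
  proof -
    have "map (v' \<circ> \<sigma> \<circ> ?\<tau>) xs = map v' xs" using \<sigma> by (simp add: comp_assoc permutes_inv_o)
    then have "ordered_basis M (map v' xs)"
      using conjunct1[OF permute_basis[OF dist \<tau> that]] by (simp only:)
    from scale_basis(1)[OF dist this unscale] s show ?thesis by simp
  qed
  moreover have "ordered_basis M (map (v' \<circ> \<sigma>) xs) \<and>
      basis_det M a (map v xs) =
        (\<Prod>x\<in>set xs. s x) * of_int (sign \<sigma>) * basis_det M a (map (v' \<circ> \<sigma>) xs)"
    if b: "ordered_basis M (map v xs)"
  proof -
    have sc: "ordered_basis M (map v' xs)" "basis_det M (map v' xs) (map v xs) = (\<Prod>x\<in>set xs. s x)"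
      by (rule scale_basis[OF dist b v' s]; assumption)+
    note pe = permute_basis[OF dist \<sigma> sc(1)]
    have "basis_det M a (map v xs) = basis_det M a (map (v' \<circ> \<sigma>) xs) *
        (basis_det M (map (v' \<circ> \<sigma>) xs) (map v' xs) * basis_det M (map v' xs) (map v xs))"
    proof (cases "ordered_basis M a")
      case True
      then show ?thesis
        using basis_det_mult[OF True conjunct1[OF pe] b] basis_det_mult[OF conjunct1[OF pe] sc(1) b]
        by simp
    qed (simp add: basis_det_def)
    then show ?thesis using conjunct1[OF pe] unfolding conjunct2[OF pe] sc(2) by (simp only: mult_ac simp_thms)
  qed
  ultimately show ?thesis
    by (cases "ordered_basis M (map v xs)") (auto simp: basis_det_def[of M a "map v xs"]
      basis_det_def[of M a "map (v' \<circ> \<sigma>) xs"])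
qed

end

section \<open>Linear maps, quotients and submodules\<close>

definition linear_map :: "('f::field, 'v) module \<Rightarrow> ('f, 'w) module \<Rightarrow> ('v \<Rightarrow> 'w) \<Rightarrow> bool" where
  "linear_map M M' T \<longleftrightarrow> (\<forall>x\<in>carrier M. T x \<in> carrier M') \<and>
     (\<forall>x\<in>carrier M. \<forall>y\<in>carrier M. T (x \<oplus>\<^bsub>M\<^esub> y) = T x \<oplus>\<^bsub>M'\<^esub> T y) \<and>
     (\<forall>a. \<forall>x\<in>carrier M. T (a \<odot>\<^bsub>M\<^esub> x) = a \<odot>\<^bsub>M'\<^esub> T x)"

lemma linear_mapD:
  assumes "linear_map M M' T"
  shows "x \<in> carrier M \<Longrightarrow> T x \<in> carrier M'"
    "x \<in> carrier M \<Longrightarrow> y \<in> carrier M \<Longrightarrow> T (x \<oplus>\<^bsub>M\<^esub> y) = T x \<oplus>\<^bsub>M'\<^esub> T y"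
    "x \<in> carrier M \<Longrightarrow> T (a \<odot>\<^bsub>M\<^esub> x) = a \<odot>\<^bsub>M'\<^esub> T x"
  using assms by (auto simp: linear_map_def)

lemma linear_map_zero:
  assumes "vector_module M" "vector_module M'" "linear_map M M' T"
  shows "T \<zero>\<^bsub>M\<^esub> = \<zero>\<^bsub>M'\<^esub>"
proof -
  interpret M: vector_module M by fact
  interpret M': vector_module M' by fact
  have "T (0 \<odot>\<^bsub>M\<^esub> \<zero>\<^bsub>M\<^esub>) = 0 \<odot>\<^bsub>M'\<^esub> T \<zero>\<^bsub>M\<^esub>"
    by (intro linear_mapD(3)[OF assms(3)]) simp
  then show ?thesis using linear_mapD(1)[OF assms(3), of "\<zero>\<^bsub>M\<^esub>"] by simp
qed

lemma linear_map_lin_comb: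
  assumes "vector_module M" "vector_module M'" "linear_map M M' T" "set xs \<subseteq> carrier M"
  shows "T (lin_comb M a xs) = lin_comb M' a (map T xs)"
  using assms(4)
proof (induction xs rule: rev_induct)
  case Nil
  then show ?case
    by (simp add: linear_map_zero[OF assms(1-3)] vector_module.lin_comb_Nil assms(1,2))
next
  case (snoc x xs)
  have xs: "set xs \<subseteq> carrier M" "x \<in> carrier M" using snoc.prems by auto
  then have im: "set (map T xs) \<subseteq> carrier M'" "T x \<in> carrier M'"
    using linear_mapD(1)[OF assms(3)] by auto
  have "T (lin_comb M a (xs @ [x])) = T (lin_comb M a xs) \<oplus>\<^bsub>M'\<^esub> T (a (length xs) \<odot>\<^bsub>M\<^esub> x)"
    using xs vector_module.lin_comb_snoc[OF assms(1) xs]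
    by (simp add: linear_mapD(2)[OF assms(3)] vector_module.lin_comb_closed[OF assms(1)]
        vector_module.smult_closed'[OF assms(1)])
  then show ?case
    using snoc.IH[OF xs(1)] vector_module.lin_comb_snoc[OF assms(2) im]
    by (simp add: linear_mapD(3)[OF assms(3) xs(2)])
qed

lemma vector_moduleI:
  fixes M :: "('f::field, 'v) module" (structure)
  assumes "\<And>x y. x \<in> carrier M \<Longrightarrow> y \<in> carrier M \<Longrightarrow> x \<oplus> y \<in> carrier M"
    and "\<zero> \<in> carrier M"
    and "\<And>x y z. x \<in> carrier M \<Longrightarrow> y \<in> carrier M \<Longrightarrow> z \<in> carrier M \<Longrightarrow> (x \<oplus> y) \<oplus> z = x \<oplus> (y \<oplus> z)"
    and "\<And>x y. x \<in> carrier M \<Longrightarrow> y \<in> carrier M \<Longrightarrow> x \<oplus> y = y \<oplus> x"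
    and z: "\<And>x. x \<in> carrier M \<Longrightarrow> \<zero> \<oplus> x = x"
    and c: "\<And>a x. x \<in> carrier M \<Longrightarrow> a \<odot> x \<in> carrier M"
    and d: "\<And>a b x. x \<in> carrier M \<Longrightarrow> (a + b) \<odot> x = a \<odot> x \<oplus> b \<odot> x"
    and "\<And>a x y. x \<in> carrier M \<Longrightarrow> y \<in> carrier M \<Longrightarrow> a \<odot> (x \<oplus> y) = a \<odot> x \<oplus> a \<odot> y"
    and "\<And>a b x. x \<in> carrier M \<Longrightarrow> (a * b) \<odot> x = a \<odot> (b \<odot> x)"
    and o: "\<And>x. x \<in> carrier M \<Longrightarrow> 1 \<odot> x = x"
    and n: "\<And>x. x \<in> carrier M \<Longrightarrow> 0 \<odot> x = \<zero>"
  shows "vector_module M"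
proof (rule vector_module.intro, rule moduleI)
  show "abelian_group M"
  proof (rule abelian_groupI)
    fix x assume x: "x \<in> carrier M"
    have "(-1) \<odot> x \<oplus> x = (-1 + 1) \<odot> x" using d[OF x, of "-1" 1] o[OF x] by simp
    then show "\<exists>y\<in>carrier M. y \<oplus> x = \<zero>" using n[OF x] c[OF x, of "-1"] by auto
  qed (use assms in auto)
qed (use assms cring_field_ring in auto)

lemma vector_module_surjection:
  assumes "vector_module M" and im: "carrier M' = q ` carrier M" and "linear_map M M' q"
    and z: "q \<zero>\<^bsub>M\<^esub> = \<zero>\<^bsub>M'\<^esub>"
  shows "vector_module M'"
proof -
  interpret M: vector_module M by fact
  note q = linear_mapD(2,3)[OF assms(3), symmetric]
  show ?thesis
  proof (rule vector_moduleI)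
    show "\<zero>\<^bsub>M'\<^esub> \<in> carrier M'" using z im by (metis M.V.M.zero_closed imageI)
  qed (auto simp: im q z[symmetric] M.V.M.a_assoc M.smult_l_distr' M.smult_r_distr' M.smult_assoc'
      intro: M.V.M.a_comm[THEN arg_cong])
qed

context vector_module
begin

lemma submoduleI':
  assumes "N \<subseteq> carrier M" "\<zero> \<in> N" "\<And>x y. x \<in> N \<Longrightarrow> y \<in> N \<Longrightarrow> x \<oplus> y \<in> N"
    "\<And>a x. x \<in> N \<Longrightarrow> a \<odot> x \<in> N"
  shows "submodule N field_ring M"
proof (rule V.submoduleI)
  fix a assume "a \<in> N"
  then show "\<ominus> a \<in> N" using assms(1) assms(4)[of a "-1"] smult_minus_one[of a] by auto
qed (use assms in auto)

lemma submoduleD: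
  assumes "submodule N field_ring M"
  shows "N \<subseteq> carrier M" "\<zero> \<in> N" "\<And>x y. x \<in> N \<Longrightarrow> y \<in> N \<Longrightarrow> x \<oplus> y \<in> N"
    "\<And>a x. x \<in> N \<Longrightarrow> a \<odot> x \<in> N" "\<And>x. x \<in> N \<Longrightarrow> \<ominus> x \<in> N"
  using V.submoduleE[OF assms] submodule.axioms(1)[OF assms] subgroup.one_closed by fastforce+

lemma vector_module_submodule:
  assumes "submodule N field_ring M" shows "vector_module (M\<lparr>carrier := N\<rparr>)"
  by (rule vector_module.intro) (rule submodule.submodule_is_module[OF assms module_axiom])

lemma lin_comb_submodule:
  assumes N: "submodule N field_ring M" and xs: "set xs \<subseteq> N"
  shows "lin_comb (M\<lparr>carrier := N\<rparr>) a xs = lin_comb M a xs" "lin_comb M a xs \<in> N"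
proof -
  interpret N: vector_module "M\<lparr>carrier := N\<rparr>" by (rule vector_module_submodule[OF N])
  have "linear_map (M\<lparr>carrier := N\<rparr>) M (\<lambda>x. x)"
    using submoduleD(1)[OF N] by (auto simp: linear_map_def)
  from linear_map_lin_comb[OF N.vector_module_axioms vector_module_axioms this, of xs a]
  show "lin_comb (M\<lparr>carrier := N\<rparr>) a xs = lin_comb M a xs" using xs by simp
  then show "lin_comb M a xs \<in> N" using N.lin_comb_closed[of xs a] xs by simp
qed

lemma coset_eq: "N +> x = {n \<oplus> x | n. n \<in> N}"
  by (auto simp: a_r_coset_def')

lemma coset_add:
  assumes N: "submodule N field_ring M" and x: "x \<in> carrier M" "y \<in> carrier M"
  shows "set_add M (N +> x) (N +> y) = N +> (x \<oplus> y)"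
proof -
  note N' = submoduleD[OF N]
  have inN: "n \<in> N \<Longrightarrow> n \<in> carrier M" for n using N'(1) by auto
  have 1: "(n \<oplus> x) \<oplus> (n' \<oplus> y) = (n \<oplus> n') \<oplus> (x \<oplus> y)" if "n \<in> N" "n' \<in> N" for n n'
    using that x inN by (simp add: V.M.a_ac)
  have 2: "n \<oplus> (x \<oplus> y) = (n \<oplus> x) \<oplus> (\<zero> \<oplus> y)" if "n \<in> N" for n
    using that x inN by (simp add: V.M.a_ac)
  show ?thesis
  proof (intro equalityI subsetI)
    fix z assume "z \<in> set_add M (N +> x) (N +> y)"
    then obtain n n' where n: "n \<in> N" "n' \<in> N" "z = (n \<oplus> x) \<oplus> (n' \<oplus> y)"
      unfolding coset_eq set_add_def' by blast
    show "z \<in> N +> (x \<oplus> y)"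
      unfolding n(3) 1[OF n(1,2)] coset_eq using N'(3)[OF n(1,2)] by blast
  next
    fix z assume "z \<in> N +> (x \<oplus> y)"
    then obtain n where n: "n \<in> N" "z = n \<oplus> (x \<oplus> y)" unfolding coset_eq by blast
    show "z \<in> set_add M (N +> x) (N +> y)"
      unfolding n(2) 2[OF n(1)] coset_eq set_add_def' using N'(2) n(1) by blast
  qed
qed

lemma coset_smult:
  assumes N: "submodule N field_ring M" and x: "x \<in> carrier M"
  shows "set_add M N ((\<lambda>z. a \<odot> z) ` (N +> x)) = N +> (a \<odot> x)"
proof -
  note N' = submoduleD[OF N]
  have inN: "n \<in> N \<Longrightarrow> n \<in> carrier M" for n using N'(1) by auto
  have 1: "n \<oplus> (a \<odot> (n' \<oplus> x)) = (n \<oplus> a \<odot> n') \<oplus> a \<odot> x" if "n \<in> N" "n' \<in> N" for n n'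
    using that x inN by (simp add: V.M.a_ac smult_r_distr')
  have 2: "n \<oplus> a \<odot> x = n \<oplus> (a \<odot> (\<zero> \<oplus> x))" if "n \<in> N" for n
    using that x inN by simp
  show ?thesis
  proof (intro equalityI subsetI)
    fix z assume "z \<in> set_add M N ((\<lambda>z. a \<odot> z) ` (N +> x))"
    then obtain n n' where n: "n \<in> N" "n' \<in> N" "z = n \<oplus> (a \<odot> (n' \<oplus> x))"
      unfolding coset_eq set_add_def' by blast
    show "z \<in> N +> (a \<odot> x)"
      unfolding n(3) 1[OF n(1,2)] coset_eq using N'(3)[OF n(1) N'(4)[OF n(2)]] by blast
  next
    fix z assume "z \<in> N +> (a \<odot> x)"
    then obtain n where n: "n \<in> N" "z = n \<oplus> a \<odot> x" unfolding coset_eq by blast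
    show "z \<in> set_add M N ((\<lambda>z. a \<odot> z) ` (N +> x))"
      unfolding n(2) 2[OF n(1)] coset_eq set_add_def' using N'(2) n(1) by blast
  qed
qed

lemma coset_zero:
  assumes N: "submodule N field_ring M" shows "N +> \<zero> = N"
proof -
  have "n \<in> N \<Longrightarrow> n \<oplus> \<zero> = n" for n using submoduleD(1)[OF N] by auto
  then show ?thesis unfolding coset_eq by force
qed

lemma coset_eq_iff:
  assumes N: "submodule N field_ring M" and x: "x \<in> carrier M" "y \<in> carrier M"
  shows "N +> x = N +> y \<longleftrightarrow> (\<exists>n\<in>N. x = n \<oplus> y)"
proof
  assume "N +> x = N +> y"
  moreover have "x \<in> N +> x"
    unfolding coset_eq using submoduleD(2)[OF N] x by (auto intro!: exI[of _ "\<zero>"])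
  ultimately show "\<exists>n\<in>N. x = n \<oplus> y" unfolding coset_eq by auto
next
  note N' = submoduleD[OF N]
  have inN: "n \<in> N \<Longrightarrow> n \<in> carrier M" for n using N'(1) by auto
  assume "\<exists>n\<in>N. x = n \<oplus> y"
  then obtain n where n: "n \<in> N" "x = n \<oplus> y" by auto
  have "m \<oplus> x = (m \<oplus> n) \<oplus> y" "m \<oplus> y = (m \<oplus> \<ominus> n) \<oplus> x" if "m \<in> N" for m
    using that n x inN V.M.r_neg1 V.M.r_neg2 N'(5) by (simp_all add: V.M.a_ac)
  then show "N +> x = N +> y" unfolding coset_eq using N'(3,5) n(1) by blast
qed

lemma quotient_linear:
  assumes N: "submodule N field_ring M"
  shows "carrier (quot_module M N) = (\<lambda>x. N +> x) ` carrier M"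
    "linear_map M (quot_module M N) (\<lambda>x. N +> x)" "vector_module (quot_module M N)"
proof -
  show c: "carrier (quot_module M N) = (\<lambda>x. N +> x) ` carrier M"
    by (auto simp: quot_module_def A_RCOSETS_def')
  show l: "linear_map M (quot_module M N) (\<lambda>x. N +> x)"
    unfolding linear_map_def c
    using coset_add[OF N] coset_smult[OF N] by (auto simp: quot_module_def)
  show "vector_module (quot_module M N)"
    by (rule vector_module_surjection[OF vector_module_axioms c l])
      (simp add: coset_zero[OF N] quot_module_def)
qed

lemma quot_module_subcarrier:
  "quot_module (M\<lparr>carrier := Z\<rparr>) N = (quot_module M N)\<lparr>carrier := (\<lambda>x. N +> x) ` Z\<rparr>"
proof -
  have "A_RCOSETS (M\<lparr>carrier := Z\<rparr>) N = (\<lambda>x. N +> x) ` Z"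
    by (auto simp: A_RCOSETS_def' a_r_coset_def')
  moreover have "set_add (M\<lparr>carrier := Z\<rparr>) = set_add M"
    by (intro ext) (auto simp: set_add_defs)
  ultimately show ?thesis by (simp add: quot_module_def)
qed

lemma coset_image_submodule:
  assumes N: "submodule N field_ring M" and Z: "submodule Z field_ring M"
  shows "submodule ((\<lambda>x. N +> x) ` Z) field_ring (quot_module M N)"
proof -
  interpret Q: vector_module "quot_module M N" by (rule quotient_linear(3)[OF N])
  note q = linear_mapD[OF quotient_linear(2)[OF N]]
  note Z' = submoduleD[OF Z]
  have inZ: "x \<in> Z \<Longrightarrow> x \<in> carrier M" for x using Z'(1) by auto
  show ?thesis
  proof (rule Q.submoduleI')
    show "\<zero>\<^bsub>quot_module M N\<^esub> \<in> (\<lambda>x. N +> x) ` Z"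
      using Z'(2) linear_map_zero[OF vector_module_axioms Q.vector_module_axioms quotient_linear(2)[OF N]]
      by (metis imageI)
  qed (use q Z' inZ in \<open>auto simp flip: q(2,3)\<close>)
qed

lemma lin_comb_Cons:
  assumes "x \<in> carrier M" "set ys \<subseteq> carrier M"
  shows "lin_comb M a (x # ys) = a 0 \<odot> x \<oplus> lin_comb M (\<lambda>i. a (Suc i)) ys"
  using lin_comb_append[of "[x]" ys a] lin_comb_snoc[of "[]" x a] assms by simp

text \<open>A sublist that spans and has minimal length is a basis, since a vanishing combination with a nonzero
  coefficient would express one of its vectors through the others.\<close>

lemma ordered_basis_of_spanning:
  assumes "set xs \<subseteq> carrier M" "\<And>v. v \<in> carrier M \<Longrightarrow> \<exists>a. v = lin_comb M a xs"
  shows "\<exists>ys. set ys \<subseteq> set xs \<and> ordered_basis M ys"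
proof -
  define P where "P ys \<longleftrightarrow> set ys \<subseteq> set xs \<and> (\<forall>v\<in>carrier M. \<exists>a. v = lin_comb M a ys)" for ys
  have "P xs" using assms by (auto simp: P_def)
  then obtain ys where ys: "P ys" "\<And>zs. P zs \<Longrightarrow> length ys \<le> length zs"
    using ex_has_least_nat[of P xs length] by blast
  have sub: "set ys \<subseteq> carrier M" using ys(1) assms(1) by (auto simp: P_def)
  have "ordered_basis M ys"
  proof (rule ordered_basisI[OF sub])
    fix v assume "v \<in> carrier M" then show "\<exists>a. v = lin_comb M a ys" using ys(1) by (auto simp: P_def)
  next
    fix a i assume a: "lin_comb M a ys = \<zero>" and i: "i < length ys"
    let ?zs = "take i ys @ drop (Suc i) ys"
    have split: "ys = take i ys @ [ys ! i] @ drop (Suc i) ys" using i by (simp add: id_take_nth_drop)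
    have s: "set (take i ys) \<subseteq> carrier M" "ys ! i \<in> carrier M" "set (drop (Suc i) ys) \<subseteq> carrier M"
      using sub i by (auto dest: in_set_takeD in_set_dropD)
    show "a i = 0"
    proof (rule ccontr)
      assume ai: "a i \<noteq> 0"
      have "\<exists>z. v = lin_comb M z ?zs" if v: "v \<in> carrier M" for v
      proof -
        obtain x where x: "v = lin_comb M x ys" using ys(1) v by (auto simp: P_def)
        define z where "z = (\<lambda>j. x j + (- x i / a i) * a j)"
        have "lin_comb M z ys = lin_comb M x ys \<oplus> (- x i / a i) \<odot> lin_comb M a ys"
          unfolding z_def lin_comb_add[OF sub] lin_comb_smult[OF sub] by (rule refl)
        then have "v = lin_comb M z ys" using a x sub by simp
        also have "\<dots> = lin_comb M z (take i ys @ [ys ! i] @ drop (Suc i) ys)"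
          using split by simp
        also have "\<dots> = lin_comb M z (take i ys) \<oplus> (z i \<odot> (ys ! i)
            \<oplus> lin_comb M (\<lambda>j. z (j + 1 + i)) (drop (Suc i) ys))"
          using s i by (simp add: lin_comb_append lin_comb_Cons add_ac)
        also have "z i = 0" using ai by (simp add: z_def)
        also have "lin_comb M z (take i ys) \<oplus> (0 \<odot> (ys ! i)
            \<oplus> lin_comb M (\<lambda>j. z (j + 1 + i)) (drop (Suc i) ys)) =
            lin_comb M (\<lambda>j. if j < i then z j else z (j + 1)) ?zs"
        proof -
          have "lin_comb M z (take i ys)
              = lin_comb M (\<lambda>j. if j < i then z j else z (j + 1)) (take i ys)"
            by (rule lin_comb_cong[OF s(1)]) simp
          then show ?thesis using s i by (simp add: lin_comb_append add_ac)
        qed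
        finally show ?thesis by blast
      qed
      moreover have "set ?zs \<subseteq> set xs"
        using ys(1) by (auto simp: P_def dest: in_set_takeD in_set_dropD)
      ultimately have "P ?zs" by (auto simp: P_def)
      from ys(2)[OF this] show False using i by simp
    qed
  qed
  then show ?thesis using ys(1) by (auto simp: P_def)
qed

end

lemma linear_image_submodule:
  assumes "vector_module M" "vector_module M'" "linear_map M M' T"
  shows "submodule (T ` carrier M) field_ring M'"
proof -
  interpret M: vector_module M by fact
  interpret M': vector_module M' by fact
  note T = linear_mapD[OF assms(3)]
  show ?thesis
  proof (rule M'.submoduleI')
    show "\<zero>\<^bsub>M'\<^esub> \<in> T ` carrier M" using linear_map_zero[OF assms] by (metis imageI M.V.M.zero_closed)
  qed (use T(1) in \<open>auto simp flip: T(2,3)\<close>)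
qed

lemma linear_kernel_submodule:
  assumes "vector_module M" "vector_module M'" "linear_map M M' T"
  shows "submodule {x \<in> carrier M. T x = \<zero>\<^bsub>M'\<^esub>} field_ring M"
proof -
  interpret M: vector_module M by fact
  interpret M': vector_module M' by fact
  note T = linear_mapD[OF assms(3)]
  show ?thesis
    by (rule M.submoduleI') (auto simp: T linear_map_zero[OF assms])
qed

section \<open>Torsion under a change of the bases\<close>

lemma powi_alternating:
  "x powi ((-1) ^ k :: int) = (if even k then x else inverse (x :: 'f::field))"
  by (cases "even k") (auto simp: power_int_minus)

text \<open>The vectors \<open>b\<close> and the representatives of the homology bases do not depend on the chain bases, and
  the sign \<open>|C|\<close> depends only on their lengths. So a factor common to all determinants \<open>[a/c]\<close> in one
  degree, for all families \<open>a\<close> alike, is all that changes in that degree.\<close>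

lemma torsion_change_of_chain_bases:
  fixes C :: "nat \<Rightarrow> ('f::field, 'v) module"
  assumes "\<And>i a. i \<le> m \<Longrightarrow> basis_det (C i) a (c i) = \<kappa> i * basis_det (C i) a (c' i)"
    and "\<And>i. i \<le> m \<Longrightarrow> length (c i) = length (c' i)"
  shows "torsion m C d c w = (\<Prod>i\<le>m. \<kappa> i powi ((-1) ^ (i + 1))) * torsion m C d c' w"
proof -
  have "(\<Sum>i\<le>m. (\<Sum>r\<le>i. length (c r)) * (\<Sum>r\<le>i. length (w r))) =
      (\<Sum>i\<le>m. (\<Sum>r\<le>i. length (c' r)) * (\<Sum>r\<le>i. length (w r)))"
    using assms(2) by (intro sum.cong arg_cong2[of _ _ _ _ "(*)"]) auto
  moreover have "(\<Prod>i\<le>m. basis_det (C i) (a i) (c i) powi ((-1) ^ (i + 1))) =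
      (\<Prod>i\<le>m. \<kappa> i powi ((-1) ^ (i + 1))) *
      (\<Prod>i\<le>m. basis_det (C i) (a i) (c' i) powi ((-1) ^ (i + 1)))" for a
    unfolding prod.distrib[symmetric] power_int_mult_distrib[symmetric]
    using assms(1) by (intro prod.cong) auto
  ultimately show ?thesis
    unfolding torsion_def Let_def by (simp only: mult_ac)
qed

locale finite_complex =
  fixes m :: nat and C :: "nat \<Rightarrow> ('f::field, 'v) module" and d :: "nat \<Rightarrow> 'v \<Rightarrow> 'v"
  assumes spaces: "i \<le> m \<Longrightarrow> vector_module (C i)"
    and differentials: "i < m \<Longrightarrow> linear_map (C (Suc i)) (C i) (d i)"
begin

lemma boundaries_submodule:
  assumes "i \<le> m" shows "submodule (boundaries m C d i) field_ring (C i)"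
proof -
  interpret vector_module "C i" by (rule spaces[OF assms])
  show ?thesis
  proof (cases "i < m")
    case True
    then show ?thesis
      using linear_image_submodule[OF spaces spaces differentials, of i]
      by (simp add: boundaries_def)
  next
    case False
    then show ?thesis by (intro submoduleI') (auto simp: boundaries_def)
  qed
qed

lemma cycles_submodule:
  assumes "i \<le> m" shows "submodule (cycles C d i) field_ring (C i)"
proof (cases i)
  case 0
  then show ?thesis
    using vector_module.module_axiom[OF spaces[OF assms]]
    by (simp add: cycles_def module.carrier_is_submodule)
next
  case (Suc j)
  then show ?thesis
    using linear_kernel_submodule[OF spaces spaces differentials, of j] assms
    by (simp add: cycles_def)
qed

lemma homology_module_eq:
  "i \<le> m \<Longrightarrow> homology_module m C d i = (quot_module (C i) (boundaries m C d i))
    \<lparr>carrier := (\<lambda>x. boundaries m C d i +>\<^bsub>C i\<^esub> x) ` cycles C d i\<rparr>"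
  unfolding homology_module_def by (rule vector_module.quot_module_subcarrier[OF spaces])

lemma homology_vector_module: "i \<le> m \<Longrightarrow> vector_module (homology_module m C d i)"
  unfolding homology_module_eq
  by (intro vector_module.vector_module_submodule vector_module.quotient_linear(3)
      vector_module.coset_image_submodule spaces boundaries_submodule cycles_submodule)

text \<open>The differential of a basis spans the boundaries. A basis of the boundaries chosen among these
  images is lifted by taking preimages in the given basis.\<close>

lemma boundary_lifts_exist:
  assumes c: "\<And>i. i \<le> m \<Longrightarrow> ordered_basis (C i) (c i)"
  shows "\<exists>b. boundary_lifts m C d b"
proof -
  have "\<exists>b. set b \<subseteq> carrier (C (Suc i)) \<and>
      ordered_basis ((C i)\<lparr>carrier := boundaries m C d i\<rparr>) (map (d i) b)" if i: "i < m" for i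
  proof -
    interpret V: vector_module "C (Suc i)" by (rule spaces) (use i in simp)
    interpret W: vector_module "C i" by (rule spaces) (use i in simp)
    note N = boundaries_submodule[OF less_imp_le[OF i]]
    interpret N: vector_module "(C i)\<lparr>carrier := boundaries m C d i\<rparr>"
      by (rule W.vector_module_submodule[OF N])
    have cS: "ordered_basis (C (Suc i)) (c (Suc i))" using i c by simp
    note cM = V.ordered_basis_subset[OF cS]
    have img: "d i ` carrier (C (Suc i)) = boundaries m C d i" using i by (simp add: boundaries_def)
    then have sub: "set (map (d i) (c (Suc i))) \<subseteq> boundaries m C d i" using cM by auto
    have "\<exists>ys. set ys \<subseteq> set (map (d i) (c (Suc i))) \<and>
        ordered_basis ((C i)\<lparr>carrier := boundaries m C d i\<rparr>) ys"
    proof (rule N.ordered_basis_of_spanning)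
      fix v assume "v \<in> carrier ((C i)\<lparr>carrier := boundaries m C d i\<rparr>)"
      then obtain u where u: "u \<in> carrier (C (Suc i))" "v = d i u" using img by auto
      have "v = lin_comb (C i) (coords (C (Suc i)) (c (Suc i)) u) (map (d i) (c (Suc i)))"
        using linear_map_lin_comb[OF V.vector_module_axioms W.vector_module_axioms
            differentials[OF i] cM] V.coords_props(2)[OF cS u(1)] u(2) by metis
      then show "\<exists>a. v = lin_comb ((C i)\<lparr>carrier := boundaries m C d i\<rparr>) a (map (d i) (c (Suc i)))"
        using W.lin_comb_submodule(1)[OF N sub] by metis
    qed (use sub in simp)
    then obtain ys where ys: "set ys \<subseteq> d i ` set (c (Suc i))"
      "ordered_basis ((C i)\<lparr>carrier := boundaries m C d i\<rparr>) ys" by auto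
    have "map (d i) (map (inv_into (set (c (Suc i))) (d i)) ys) = ys"
      using ys(1) by (auto simp: comp_def f_inv_into_f intro!: map_idI)
    moreover have "set (map (inv_into (set (c (Suc i))) (d i)) ys) \<subseteq> carrier (C (Suc i))"
      using ys(1) cM by (auto intro: inv_into_into)
    ultimately show ?thesis using ys(2) by metis
  qed
  then obtain b where b: "\<And>i. i < m \<Longrightarrow> set (b i) \<subseteq> carrier (C (Suc i)) \<and>
      ordered_basis ((C i)\<lparr>carrier := boundaries m C d i\<rparr>) (map (d i) (b i))" by metis
  show ?thesis
    by (rule exI[of _ "\<lambda>k. case k of 0 \<Rightarrow> [] | Suc i \<Rightarrow> if i < m then b i else []"])
      (use b in \<open>auto simp: boundary_lifts_def\<close>)
qed

text \<open>Modulo boundaries, the representatives of \<open>w'\<close> are the combinations of the representatives of \<open>w\<close>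
  that express \<open>w'\<close> through \<open>w\<close> in homology, and the boundaries are spanned by the block on the left.\<close>

lemma basis_det_homology_block:
  assumes i: "i \<le> m" and b: "boundary_lifts m C d b"
    and w: "ordered_basis (homology_module m C d i) w" "ordered_basis (homology_module m C d i) w'"
    and base: "ordered_basis (C i) (map (d i) (b (Suc i)) @ map (\<lambda>A. SOME x. x \<in> A) w @ Y)"
  shows "ordered_basis (C i) (map (d i) (b (Suc i)) @ map (\<lambda>A. SOME x. x \<in> A) w' @ Y)"
    "basis_det (C i) (map (d i) (b (Suc i)) @ map (\<lambda>A. SOME x. x \<in> A) w' @ Y)
      (map (d i) (b (Suc i)) @ map (\<lambda>A. SOME x. x \<in> A) w @ Y) =
      basis_det (homology_module m C d i) w' w"
proof -
  let ?N = "boundaries m C d i" and ?H = "homology_module m C d i" and ?X = "map (d i) (b (Suc i))"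
  let ?Q = "quot_module (C i) ?N"
  let ?q = "\<lambda>x. ?N +>\<^bsub>C i\<^esub> x" and ?rep = "\<lambda>A. SOME x. x \<in> A"
  interpret M: vector_module "C i" by (rule spaces[OF i])
  interpret H: vector_module ?H by (rule homology_vector_module[OF i])
  note N = boundaries_submodule[OF i] and Z = cycles_submodule[OF i]
  note N' = M.submoduleD[OF N] and Z' = M.submoduleD[OF Z]
  interpret Q: vector_module ?Q by (rule M.quotient_linear(3)[OF N])
  note img = M.coset_image_submodule[OF N Z]
  have carH: "carrier ?H = ?q ` cycles C d i" by (simp add: homology_module_eq[OF i])
  have rep: "?rep A \<in> carrier (C i)" "?q (?rep A) = A" if AH: "A \<in> carrier ?H" for A
  proof -
    obtain z where z: "z \<in> carrier (C i)" "A = ?q z" using AH Z'(1) by (auto simp: carH)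
    have "z \<in> A"
      using z N'(2) unfolding z(2) M.coset_eq by (auto intro!: exI[of _ "\<zero>\<^bsub>C i\<^esub>"])
    then have "?rep A \<in> A" by (rule someI)
    then obtain n where n: "n \<in> ?N" "?rep A = n \<oplus>\<^bsub>C i\<^esub> z"
      using z(2) unfolding M.coset_eq by auto
    then show r: "?rep A \<in> carrier (C i)" using N'(1) z(1) by auto
    show "?q (?rep A) = A"
      unfolding z(2) using M.coset_eq_iff[OF N, of "?rep A" z] r z n by auto
  qed
  have wH: "set w \<subseteq> carrier ?H" "set w' \<subseteq> carrier ?H"
    using H.ordered_basis_subset w by blast+
  have hM: "set (map ?rep w) \<subseteq> carrier (C i)" using rep(1) wH by auto
  have span: "\<exists>B. n = lin_comb (C i) B ?X" if "n \<in> ?N" for n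
  proof (cases "i < m")
    case True
    interpret NN: vector_module "(C i)\<lparr>carrier := ?N\<rparr>" by (rule M.vector_module_submodule[OF N])
    have X: "ordered_basis ((C i)\<lparr>carrier := ?N\<rparr>) ?X" using b True by (simp add: boundary_lifts_def)
    have "n = lin_comb ((C i)\<lparr>carrier := ?N\<rparr>) (coords ((C i)\<lparr>carrier := ?N\<rparr>) ?X n) ?X"
      using NN.coords_props(2)[OF X] that by simp
    moreover have "set ?X \<subseteq> ?N" using NN.ordered_basis_subset[OF X] by simp
    ultimately show ?thesis using M.lin_comb_submodule(1)[OF N] by metis
  next
    case False
    then have "b (Suc i) = []" "n = \<zero>\<^bsub>C i\<^esub>" using b i that by (auto simp: boundary_lifts_def boundaries_def)
    then show ?thesis by simp
  qed
  define A where "A = (\<lambda>j. coords ?H w (w' ! j))"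
  have len: "length w' = length w" using H.ordered_basis_length w by metis
  have "\<exists>B. map ?rep w' ! j = lin_comb (C i) B ?X \<oplus>\<^bsub>C i\<^esub> lin_comb (C i) (A j) (map ?rep w)"
    if j: "j < length (map ?rep w)" for j
  proof -
    have jw: "w' ! j \<in> carrier ?H" using wH j len by auto
    have wq: "map ?q (map ?rep w) = w" using rep(2) wH(1) by (auto intro!: map_idI)
    have "?q (?rep (w' ! j)) = w' ! j" by (rule rep(2)[OF jw])
    also have "\<dots> = lin_comb ?H (A j) w" using H.coords_props(2)[OF w(1) jw] by (simp add: A_def)
    also have "\<dots> = lin_comb ?Q (A j) w"
      using Q.lin_comb_submodule(1)[OF img, of w] wH(1) carH by (simp add: homology_module_eq[OF i])
    also have "\<dots> = ?q (lin_comb (C i) (A j) (map ?rep w))"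
      using linear_map_lin_comb[OF M.vector_module_axioms Q.vector_module_axioms
          M.quotient_linear(2)[OF N] hM, of "A j"] wq by simp
    finally have "\<exists>n\<in>?N. ?rep (w' ! j) = n \<oplus>\<^bsub>C i\<^esub> lin_comb (C i) (A j) (map ?rep w)"
      using M.coset_eq_iff[OF N rep(1)[OF jw] M.lin_comb_closed[OF hM]] by simp
    then show ?thesis using span j len by (metis length_map nth_map)
  qed
  then obtain B where B: "\<And>j. j < length (map ?rep w) \<Longrightarrow>
      map ?rep w' ! j = lin_comb (C i) (B j) ?X \<oplus>\<^bsub>C i\<^esub> lin_comb (C i) (A j) (map ?rep w)"
    by metis
  have det: "Determinant.det (Matrix.mat (length (map ?rep w)) (length (map ?rep w)) (\<lambda>(j, k). A j k))
      = basis_det ?H w' w"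
    using H.basis_det_eq[OF w(2,1)] by (simp add: A_def)
  have "length (map ?rep w') = length (map ?rep w)" using len by simp
  from M.basis_det_replace_block[OF base this B] det H.basis_det_nonzero[OF w(2,1)]
  show "ordered_basis (C i) (?X @ map ?rep w' @ Y)"
    "basis_det (C i) (?X @ map ?rep w' @ Y) (?X @ map ?rep w @ Y) = basis_det ?H w' w"
    by simp_all
qed

text \<open>If one of the chain bases fails to be a basis, both torsions are zero by convention. Otherwise
  the boundaries have bases that lift, and in each degree the two homology bases enter through
  blocks that differ by the change of basis in homology modulo boundaries.\<close>

lemma torsion_change_of_homology_bases:
  assumes w: "\<And>i. i \<le> m \<Longrightarrow> ordered_basis (homology_module m C d i) (w i)"
    and w': "\<And>i. i \<le> m \<Longrightarrow> ordered_basis (homology_module m C d i) (w' i)"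
  shows "torsion m C d c w' =
    (\<Prod>i\<le>m. basis_det (homology_module m C d i) (w' i) (w i) powi ((-1) ^ (i + 1))) *
    torsion m C d c w"
proof (cases "\<forall>i\<le>m. ordered_basis (C i) (c i)")
  case False
  then obtain i where i: "i \<le> m" "\<not> ordered_basis (C i) (c i)" by auto
  have "torsion m C d c v = 0" for v
    using i by (auto simp: torsion_def Let_def basis_det_def powi_alternating intro!: bexI[of _ i])
  then show ?thesis by simp
next
  case True
  define b where "b = (SOME b. boundary_lifts m C d b)"
  have b: "boundary_lifts m C d b"
    unfolding b_def using boundary_lifts_exist True by (metis someI_ex)
  let ?rep = "\<lambda>A. SOME x. x \<in> A"
  let ?a = "\<lambda>v i. map (d i) (b (Suc i)) @ map ?rep (v i) @ b i"
  have len: "length (w' i) = length (w i)" if "i \<le> m" for i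
    using vector_module.ordered_basis_length[OF homology_vector_module[OF that]] w w' that by metis
  have "basis_det (C i) (?a w' i) (c i) =
      basis_det (homology_module m C d i) (w' i) (w i) * basis_det (C i) (?a w i) (c i)"
    if i: "i \<le> m" for i
  proof (cases "ordered_basis (C i) (?a w i)")
    case base: True
    note bl = basis_det_homology_block[OF i b w[OF i] w'[OF i] base]
    show ?thesis
      using vector_module.basis_det_mult[OF spaces[OF i] bl(1) base] True i bl(2) by simp
  next
    case False
    then have "\<not> ordered_basis (C i) (?a w' i)"
      using basis_det_homology_block(1)[OF i b w'[OF i] w[OF i]] by blast
    then show ?thesis using False by (simp add: basis_det_def)
  qed
  then have "(\<Prod>i\<le>m. basis_det (C i) (?a w' i) (c i) powi ((-1) ^ (i + 1))) =
      (\<Prod>i\<le>m. basis_det (homology_module m C d i) (w' i) (w i) powi ((-1) ^ (i + 1))) *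
      (\<Prod>i\<le>m. basis_det (C i) (?a w i) (c i) powi ((-1) ^ (i + 1)))"
    unfolding prod.distrib[symmetric] power_int_mult_distrib[symmetric]
    by (intro prod.cong) auto
  moreover have "(\<Sum>i\<le>m. (\<Sum>r\<le>i. length (c r)) * (\<Sum>r\<le>i. length (w' r))) =
      (\<Sum>i\<le>m. (\<Sum>r\<le>i. length (c r)) * (\<Sum>r\<le>i. length (w r)))"
    using len by (intro sum.cong arg_cong2[of _ _ _ _ "(*)"]) auto
  ultimately show ?thesis
    unfolding torsion_def Let_def b_def[symmetric] by (simp only: mult_ac)
qed

end

section \<open>Orientations of a direct sum\<close>

lemma direct_sum_vector_module:
  assumes "\<And>n. n \<le> m \<Longrightarrow> vector_module (H n)"
  shows "vector_module (direct_sum_module m H)"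
proof -
  note ab = vector_module.module_axiom[OF assms, THEN module.axioms(2)]
  show ?thesis
  proof (rule vector_moduleI)
  qed (auto simp: direct_sum_module_def PiE_iff fun_eq_iff restrict_def extensional_def
      vector_module.smult_l_distr'[OF assms] vector_module.smult_r_distr'[OF assms]
      vector_module.smult_assoc'[OF assms] vector_module.smult_closed'[OF assms]
      vector_module.smult_one'[OF assms] vector_module.smult_zero'[OF assms]
      abelian_groupE(1-3,5)[OF ab]
      intro: abelian_groupE(4)[OF ab])
qed

lemma ds_incl_linear:
  assumes H: "\<And>n. n \<le> m \<Longrightarrow> vector_module (H n)" and n: "n \<le> m"
  shows "linear_map (H n) (direct_sum_module m H) (ds_incl m H n)"
proof -
  note ab = vector_module.module_axiom[OF H, THEN module.axioms(2)]
  show ?thesis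
    using n by (auto simp: linear_map_def direct_sum_module_def ds_incl_def fun_eq_iff
        abelian_groupE[OF ab] vector_module.smult_r_zero'[OF H])
qed

text \<open>The bases are exchanged one degree at a time, which replaces a single block.\<close>

lemma direct_sum_basis_det:
  assumes H: "\<And>n. n \<le> m \<Longrightarrow> vector_module (H n)"
    and w: "\<And>n. n \<le> m \<Longrightarrow> ordered_basis (H n) (w n)" "\<And>n. n \<le> m \<Longrightarrow> ordered_basis (H n) (w' n)"
    and base: "ordered_basis (direct_sum_module m H) (concat (map (\<lambda>n. map (ds_incl m H n) (w n)) [0..<Suc m]))"
  shows "basis_det (direct_sum_module m H) (concat (map (\<lambda>n. map (ds_incl m H n) (w' n)) [0..<Suc m]))
      (concat (map (\<lambda>n. map (ds_incl m H n) (w n)) [0..<Suc m])) =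
      (\<Prod>n\<le>m. basis_det (H n) (w' n) (w n))"
proof -
  let ?S = "direct_sum_module m H"
  interpret S: vector_module ?S by (rule direct_sum_vector_module[OF H])
  define W where "W k = concat (map (\<lambda>n. map (ds_incl m H n) (if n < k then w' n else w n)) [0..<Suc m])"
    for k
  have W0: "W 0 = concat (map (\<lambda>n. map (ds_incl m H n) (w n)) [0..<Suc m])" by (simp add: W_def)
  have "ordered_basis ?S (W k) \<and> basis_det ?S (W k) (W 0) = (\<Prod>n<k. basis_det (H n) (w' n) (w n))"
    if "k \<le> Suc m" for k
    using that
  proof (induction k)
    case 0 then show ?case using base S.basis_det_refl by (simp add: W0 del: upt_Suc)
  next
    case (Suc k)
    then have k: "k \<le> m" and IH: "ordered_basis ?S (W k)"
      "basis_det ?S (W k) (W 0) = (\<Prod>n<k. basis_det (H n) (w' n) (w n))" by auto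
    interpret Hk: vector_module "H k" by (rule H[OF k])
    let ?i = "ds_incl m H k"
    define X where "X = concat (map (\<lambda>n. map (ds_incl m H n) (w' n)) [0..<k])"
    define Y where "Y = concat (map (\<lambda>n. map (ds_incl m H n) (w n)) [Suc k..<Suc m])"
    have split: "[0..<Suc m] = [0..<k] @ k # [Suc k..<Suc m]"
      using upt_add_eq_append[of 0 k "Suc m - k"] upt_conv_Cons[of k "Suc m"] k by (simp del: upt_Suc)
    have Wk: "W k = X @ map ?i (w k) @ Y" "W (Suc k) = X @ map ?i (w' k) @ Y"
    proof -
      have low: "map (\<lambda>n. map (ds_incl m H n) (if n < j then w' n else w n)) [0..<k] =
          map (\<lambda>n. map (ds_incl m H n) (w' n)) [0..<k]" if "k \<le> j" for j
        using that by (intro map_cong) auto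
      have high: "map (\<lambda>n. map (ds_incl m H n) (if n < j then w' n else w n)) [Suc k..<Suc m] =
          map (\<lambda>n. map (ds_incl m H n) (w n)) [Suc k..<Suc m]" if "j \<le> Suc k" for j
        using that by (intro map_cong) auto
      show "W k = X @ map ?i (w k) @ Y" "W (Suc k) = X @ map ?i (w' k) @ Y"
        unfolding W_def X_def Y_def split map_append list.map concat_append concat.simps
        by (simp_all del: upt_Suc add: low high)
    qed
    note sub = Hk.ordered_basis_subset[OF w(1)[OF k]]
    have X: "set X \<subseteq> carrier ?S" and wk: "set (map ?i (w k)) \<subseteq> carrier ?S"
      using S.ordered_basis_subset[OF IH(1)] by (auto simp: Wk)
    define A where "A = (\<lambda>j. coords (H k) (w k) (w' k ! j))"
    have len: "length (map ?i (w' k)) = length (map ?i (w k))"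
      using Hk.ordered_basis_length w k by simp
    have A: "map ?i (w' k) ! j = lin_comb ?S (\<lambda>_. 0) X \<oplus>\<^bsub>?S\<^esub> lin_comb ?S (A j) (map ?i (w k))"
      if j: "j < length (map ?i (w k))" for j
    proof -
      have "w' k ! j \<in> carrier (H k)"
        using j len Hk.ordered_basis_subset[OF w(2)[OF k]] by auto
      then have "?i (w' k ! j) = ?i (lin_comb (H k) (A j) (w k))"
        using Hk.coords_props(2)[OF w(1)[OF k]] by (simp add: A_def)
      also have "\<dots> = lin_comb ?S (A j) (map ?i (w k))"
        by (rule linear_map_lin_comb[OF Hk.vector_module_axioms S.vector_module_axioms
              ds_incl_linear[OF H k] sub])
      finally show ?thesis using j len X wk by (simp add: S.lin_comb_0 S.lin_comb_closed)
    qed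
    have det: "Determinant.det (Matrix.mat (length (map ?i (w k))) (length (map ?i (w k))) (\<lambda>(j, l). A j l))
        = basis_det (H k) (w' k) (w k)"
      using Hk.basis_det_eq[OF w(2)[OF k] w(1)[OF k]] by (simp add: A_def)
    have bl: "ordered_basis ?S (W (Suc k))" "basis_det ?S (W (Suc k)) (W k) = basis_det (H k) (w' k) (w k)"
      using S.basis_det_replace_block[OF IH(1)[unfolded Wk(1)] len A] det
        Hk.basis_det_nonzero[OF w(2)[OF k] w(1)[OF k]]
      unfolding Wk by simp_all
    moreover have "ordered_basis ?S (W 0)" using base by (simp only: W0)
    ultimately show ?case
      using S.basis_det_mult[OF bl(1) IH(1), of "W 0"] IH(2) by (simp add: mult.commute)
  qed
  from this[of "Suc m"] have "basis_det ?S (W (Suc m)) (W 0) = (\<Prod>n<Suc m. basis_det (H n) (w' n) (w n))"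
    by simp
  moreover have "W (Suc m) = concat (map (\<lambda>n. map (ds_incl m H n) (w' n)) [0..<Suc m])"
    unfolding W_def by (intro arg_cong[where f = concat] map_cong) auto
  ultimately show ?thesis by (simp only: W0 lessThan_Suc_atMost)
qed

text \<open>Both families have positive determinant relative to any basis that represents \<open>\<omega>\<close>.\<close>

lemma realizes_orientation_det_pos:
  fixes H :: "nat \<Rightarrow> (real, 'v) module"
  assumes H: "\<And>n. n \<le> m \<Longrightarrow> vector_module (H n)"
    and \<omega>: "\<omega> \<in> orientations (direct_sum_module m H)"
    and w: "realizes_orientation m H \<omega> w" "realizes_orientation m H \<omega> w'"
  shows "(\<Prod>n\<le>m. basis_det (H n) (w' n) (w n)) > 0"
proof -
  let ?S = "direct_sum_module m H"
  interpret S: vector_module ?S by (rule direct_sum_vector_module[OF H])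
  let ?W = "\<lambda>w. concat (map (\<lambda>n. map (ds_incl m H n) (w n)) [0..<Suc m])"
  obtain x where x: "ordered_basis ?S x"
    "\<And>y. y \<in> \<omega> \<Longrightarrow> ordered_basis ?S y \<and> basis_det ?S x y > 0"
    using \<omega> unfolding orientations_def quotient_def by auto
  have W: "ordered_basis ?S (?W w)" "basis_det ?S x (?W w) > 0"
    "ordered_basis ?S (?W w')" "basis_det ?S x (?W w') > 0"
    using w x(2) unfolding realizes_orientation_def by blast+
  have "basis_det ?S x (?W w) = basis_det ?S x (?W w') * basis_det ?S (?W w') (?W w)"
    by (rule S.basis_det_mult[OF x(1) W(3,1)])
  then have "0 < basis_det ?S x (?W w') * basis_det ?S (?W w') (?W w)" using W(2) by (simp only:)
  then have "basis_det ?S (?W w') (?W w) > 0" by (rule zero_less_mult_pos) (rule W(4))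
  then show ?thesis
    using direct_sum_basis_det[of m H w w'] H W(1) w unfolding realizes_orientation_def by simp
qed

section \<open>Extension of scalars\<close>

lemma free_module_simps:
  "u \<in> carrier (free_module S) \<longleftrightarrow> finite {x. u x \<noteq> 0} \<and> {x. u x \<noteq> 0} \<subseteq> S"
  "\<zero>\<^bsub>free_module S\<^esub> = (\<lambda>_. 0)"
  "u \<oplus>\<^bsub>free_module S\<^esub> v = (\<lambda>x. u x + v x)"
  "a \<odot>\<^bsub>free_module S\<^esub> u = (\<lambda>x. a * u x)"
  by (simp_all add: free_module_def)

lemma free_module_closed:
  assumes "u \<in> carrier (free_module S)" "v \<in> carrier (free_module S)"
  shows "(\<lambda>x. u x + v x) \<in> carrier (free_module S)" "(\<lambda>x. u x - v x) \<in> carrier (free_module S)"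
    "(\<lambda>x. a * u x) \<in> carrier (free_module S)"
proof -
  have "{x. u x + v x \<noteq> 0} \<subseteq> {x. u x \<noteq> 0} \<union> {x. v x \<noteq> 0}"
    "{x. u x - v x \<noteq> 0} \<subseteq> {x. u x \<noteq> 0} \<union> {x. v x \<noteq> 0}"
    "{x. a * u x \<noteq> 0} \<subseteq> {x. u x \<noteq> 0}" by auto
  then show "(\<lambda>x. u x + v x) \<in> carrier (free_module S)" "(\<lambda>x. u x - v x) \<in> carrier (free_module S)"
    "(\<lambda>x. a * u x) \<in> carrier (free_module S)"
    using assms finite_subset unfolding free_module_simps by (blast intro: finite_subset)+
qed

lemma vector_module_free_module: "vector_module (free_module S)"
proof (rule vector_moduleI)
  show "\<zero>\<^bsub>free_module S\<^esub> \<in> carrier (free_module S)" by (simp add: free_module_simps)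
qed (auto simp: free_module_simps(2-4) algebra_simps intro: free_module_closed)

lemma point_mass_carrier: "c \<in> S \<Longrightarrow> point_mass c \<in> carrier (free_module S)"
  by (auto simp: free_module_simps point_mass_def)

context vector_module
begin

lemma submodule_span_submodule:
  assumes "A \<subseteq> carrier M" shows "submodule (submodule_span M A) field_ring M"
proof (rule submoduleI')
  show "submodule_span M A \<subseteq> carrier M"
    unfolding submodule_span_def using V.carrier_is_submodule assms by auto
qed (auto simp: submodule_span_def dest: submoduleD(2-4))

lemma submodule_span_superset: "A \<subseteq> submodule_span M A"
  by (auto simp: submodule_span_def)

lemma submodule_span_least: "submodule N field_ring M \<Longrightarrow> A \<subseteq> N \<Longrightarrow> submodule_span M A \<subseteq> N"
  by (auto simp: submodule_span_def)

end

text \<open>The tensor product with the field that identifies \<open>\<rho> g\<close> with the scalar \<open>\<xi> g\<close>, as a quotient of the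
  vector space on the elements of \<open>C\<close>, a group written multiplicatively.\<close>

locale tensor_data =
  fixes C :: "('c, 'z) monoid_scheme" and G :: "'g set" and \<rho> :: "'g \<Rightarrow> 'c \<Rightarrow> 'c"
    and \<xi> :: "'g \<Rightarrow> 'f::field"
  assumes group_C: "Group.group C"
    and action: "g \<in> G \<Longrightarrow> c \<in> carrier C \<Longrightarrow> \<rho> g c \<in> carrier C"
begin

abbreviation "F \<equiv> free_module (carrier C) :: ('f, 'c \<Rightarrow> 'f) module"
abbreviation "Rel \<equiv> tensor_relations C G \<rho> \<xi>"
abbreviation "T \<equiv> tensor_module C G \<rho> \<xi>"
abbreviation "elt \<equiv> tensor_elt C G \<rho> \<xi>"

definition relators :: "('c \<Rightarrow> 'f) set" where
  "relators = {(\<lambda>x. point_mass (c \<otimes>\<^bsub>C\<^esub> c') x - point_mass c x - point_mass c' x) | c c'.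
          c \<in> carrier C \<and> c' \<in> carrier C} \<union>
      {(\<lambda>x. point_mass (\<rho> g c) x - \<xi> g * point_mass c x) | g c. g \<in> G \<and> c \<in> carrier C}"

lemma Rel_eq: "Rel = submodule_span F relators"
  by (simp add: tensor_relations_def relators_def)

sublocale C: Group.group C by (rule group_C)
sublocale F: vector_module F by (rule vector_module_free_module)

lemma relators_carrier: "relators \<subseteq> carrier F"
  using action by (auto simp: relators_def intro!: free_module_closed point_mass_carrier)

lemma Rel_submodule: "submodule Rel field_ring F"
  unfolding Rel_eq by (rule F.submodule_span_submodule[OF relators_carrier])

lemma T_eq: "T = quot_module F Rel"
  by (simp add: tensor_module_def)

lemma T_vector_module: "vector_module T"
  unfolding T_eq by (rule F.quotient_linear(3)[OF Rel_submodule])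

lemma coset_linear: "linear_map F T (\<lambda>u. Rel +>\<^bsub>F\<^esub> u)"
  unfolding T_eq by (rule F.quotient_linear(2)[OF Rel_submodule])

lemma T_carrier: "carrier T = (\<lambda>u. Rel +>\<^bsub>F\<^esub> u) ` carrier F"
  unfolding T_eq by (rule F.quotient_linear(1)[OF Rel_submodule])

sublocale T: vector_module T by (rule T_vector_module)

lemma elt_carrier: "c \<in> carrier C \<Longrightarrow> elt c \<in> carrier T"
  by (auto simp: T_carrier tensor_elt_def intro: point_mass_carrier)

lemma elt_mult:
  assumes "c \<in> carrier C" "c' \<in> carrier C"
  shows "elt (c \<otimes>\<^bsub>C\<^esub> c') = elt c \<oplus>\<^bsub>T\<^esub> elt c'"
proof -
  have pm: "point_mass c \<in> carrier F" "point_mass c' \<in> carrier F" "point_mass (c \<otimes>\<^bsub>C\<^esub> c') \<in> carrier F"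
    using assms by (auto intro: point_mass_carrier)
  let ?s = "point_mass c \<oplus>\<^bsub>F\<^esub> point_mass c'"
  let ?n = "\<lambda>x. point_mass (c \<otimes>\<^bsub>C\<^esub> c') x - point_mass c x - (point_mass c' x :: 'f)"
  have "?n \<in> Rel"
    unfolding Rel_eq using assms
    by (intro subsetD[OF F.submodule_span_superset]) (auto simp: relators_def)
  moreover have "point_mass (c \<otimes>\<^bsub>C\<^esub> c') = ?n \<oplus>\<^bsub>F\<^esub> ?s"
    by (simp add: free_module_simps)
  ultimately have "Rel +>\<^bsub>F\<^esub> point_mass (c \<otimes>\<^bsub>C\<^esub> c') = Rel +>\<^bsub>F\<^esub> ?s"
    using pm by (subst F.coset_eq_iff[OF Rel_submodule]) auto
  then show ?thesis
    using linear_mapD(2)[OF coset_linear] pm by (simp add: tensor_elt_def)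
qed

lemma elt_action:
  assumes "g \<in> G" "c \<in> carrier C"
  shows "elt (\<rho> g c) = \<xi> g \<odot>\<^bsub>T\<^esub> elt c"
proof -
  have pm: "point_mass c \<in> carrier F" "point_mass (\<rho> g c) \<in> carrier F"
    using assms action by (auto intro: point_mass_carrier)
  let ?s = "\<xi> g \<odot>\<^bsub>F\<^esub> point_mass c"
  let ?n = "\<lambda>x. point_mass (\<rho> g c) x - \<xi> g * point_mass c x"
  have "?n \<in> Rel"
    unfolding Rel_eq using assms
    by (intro subsetD[OF F.submodule_span_superset]) (auto simp: relators_def)
  moreover have "point_mass (\<rho> g c) = ?n \<oplus>\<^bsub>F\<^esub> ?s"
    by (simp add: free_module_simps)
  ultimately have "Rel +>\<^bsub>F\<^esub> point_mass (\<rho> g c) = Rel +>\<^bsub>F\<^esub> ?s"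
    using pm by (subst F.coset_eq_iff[OF Rel_submodule]) auto
  then show ?thesis
    using linear_mapD(3)[OF coset_linear] pm by (simp add: tensor_elt_def)
qed

text \<open>This turns a change of orientation, which inverts a class in the chain group, into a sign.\<close>

lemma elt_inv:
  assumes c: "c \<in> carrier C" shows "elt (inv\<^bsub>C\<^esub> c) = (-1) \<odot>\<^bsub>T\<^esub> elt c"
proof -
  have "elt \<one>\<^bsub>C\<^esub> = elt \<one>\<^bsub>C\<^esub> \<oplus>\<^bsub>T\<^esub> elt \<one>\<^bsub>C\<^esub>" using elt_mult[of "\<one>\<^bsub>C\<^esub>" "\<one>\<^bsub>C\<^esub>"] by simp
  then have "elt \<one>\<^bsub>C\<^esub> = \<zero>\<^bsub>T\<^esub>" using elt_carrier[of "\<one>\<^bsub>C\<^esub>"] by simp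
  then have "elt (inv\<^bsub>C\<^esub> c) \<oplus>\<^bsub>T\<^esub> elt c = \<zero>\<^bsub>T\<^esub>" using elt_mult[of "inv\<^bsub>C\<^esub> c" c] c by simp
  then have "\<ominus>\<^bsub>T\<^esub> elt c = elt (inv\<^bsub>C\<^esub> c)"
    using elt_carrier c by (intro T.V.M.minus_equality) auto
  then show ?thesis using T.smult_minus_one elt_carrier c by simp
qed

end

text \<open>The sum in the definition runs over the support of \<open>u\<close>; a common finite set in its place allows two
  functions to be added.\<close>

lemma push_forward_eq:
  assumes "finite A" "{x. u x \<noteq> 0} \<subseteq> A"
  shows "push_forward f u y = (\<Sum>x\<in>A. if f x = y then u x else 0)"
proof -
  have "(\<Sum>x\<in>A. if f x = y then u x else 0) = (\<Sum>x\<in>{x\<in>A. f x = y}. u x)"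
    using assms(1) by (simp add: sum.inter_filter)
  also have "\<dots> = push_forward f u y"
    unfolding push_forward_def using assms by (intro sum.mono_neutral_right) auto
  finally show ?thesis by simp
qed

lemma push_forward_linear:
  assumes f: "f \<in> S \<rightarrow> S'"
  shows "linear_map (free_module S) (free_module S') (push_forward f :: ('c \<Rightarrow> 'f::field) \<Rightarrow> 'e \<Rightarrow> 'f)"
  unfolding linear_map_def
proof (intro conjI ballI allI)
  fix u v :: "'c \<Rightarrow> 'f" and a assume u: "u \<in> carrier (free_module S)"
  then have fin: "finite {x. u x \<noteq> 0}" and sub: "{x. u x \<noteq> 0} \<subseteq> S" by (auto simp: free_module_simps)
  have supp: "{y. push_forward f u y \<noteq> 0} \<subseteq> f ` {x. u x \<noteq> 0}"
  proof
    fix y assume "y \<in> {y. push_forward f u y \<noteq> 0}"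
    then have "{x. u x \<noteq> 0 \<and> f x = y} \<noteq> {}"
      unfolding push_forward_def by (metis (mono_tags, lifting) mem_Collect_eq sum.empty)
    then show "y \<in> f ` {x. u x \<noteq> 0}" by auto
  qed
  moreover have "f ` {x. u x \<noteq> 0} \<subseteq> S'" using sub f by auto
  ultimately show "push_forward f u \<in> carrier (free_module S')"
    unfolding free_module_simps using fin finite_subset[OF supp] by auto
  show "push_forward f (a \<odot>\<^bsub>free_module S\<^esub> u) = a \<odot>\<^bsub>free_module S'\<^esub> push_forward f u"
    unfolding free_module_simps
  proof
    fix y
    have "push_forward f (\<lambda>x. a * u x) y = (\<Sum>x\<in>{x. u x \<noteq> 0}. if f x = y then a * u x else 0)"
      using fin by (intro push_forward_eq) auto
    also have "\<dots> = (\<Sum>x\<in>{x. u x \<noteq> 0}. a * (if f x = y then u x else 0))"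
      by (intro sum.cong) auto
    also have "\<dots> = a * push_forward f u y"
      using push_forward_eq[OF fin, of u f y] by (simp add: sum_distrib_left)
    finally show "push_forward f (\<lambda>x. a * u x) y = a * push_forward f u y" .
  qed
  assume "v \<in> carrier (free_module S)"
  then have fin': "finite {x. v x \<noteq> 0}" by (auto simp: free_module_simps)
  let ?A = "{x. u x \<noteq> 0} \<union> {x. v x \<noteq> 0}"
  have A: "finite ?A" using fin fin' by simp
  show "push_forward f (u \<oplus>\<^bsub>free_module S\<^esub> v) =
      push_forward f u \<oplus>\<^bsub>free_module S'\<^esub> push_forward f v"
    unfolding free_module_simps
  proof
    fix y
    have "push_forward f (\<lambda>x. u x + v x) y = (\<Sum>x\<in>?A. if f x = y then u x + v x else 0)"
      by (rule push_forward_eq[OF A]) auto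
    also have "\<dots> = (\<Sum>x\<in>?A. (if f x = y then u x else 0) + (if f x = y then v x else 0))"
      by (intro sum.cong) auto
    also have "\<dots> = push_forward f u y + push_forward f v y"
      using push_forward_eq[OF A, of u f y] push_forward_eq[OF A, of v f y] by (simp add: sum.distrib)
    finally show "push_forward f (\<lambda>x. u x + v x) y = push_forward f u y + push_forward f v y" .
  qed
qed

lemma push_forward_point_mass: "push_forward f (point_mass c) = (point_mass (f c) :: 'e \<Rightarrow> 'f::field)"
proof
  fix y
  show "push_forward f (point_mass c) y = (point_mass (f c) y :: 'f)"
    by (subst push_forward_eq[of "{c}"]) (auto simp: point_mass_def)
qed

text \<open>Without an action, the relations only express additivity, which a group homomorphism
  respects.\<close>

lemma tensor_map_linear:
  assumes C: "Group.group C" and C': "Group.group C'" and f: "f \<in> Group.hom C C'"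
  shows "linear_map (tensor_module C ({} :: 'g set) \<rho> (\<xi> :: 'g \<Rightarrow> 'f::field))
    (tensor_module C' ({} :: 'g set) \<rho>' \<xi>) (tensor_map C' ({} :: 'g set) \<rho>' \<xi> f)"
proof -
  interpret S: tensor_data C "{} :: 'g set" \<rho> \<xi> by (rule tensor_data.intro) (use C in auto)
  interpret S': tensor_data C' "{} :: 'g set" \<rho>' \<xi> by (rule tensor_data.intro) (use C' in auto)
  let ?p = "push_forward f :: ('a \<Rightarrow> 'f) \<Rightarrow> _"
  have pl: "linear_map S.F S'.F ?p"
    using f by (intro push_forward_linear) (auto simp: hom_def)
  note p = linear_mapD[OF pl]
  have "S.Rel \<subseteq> {u \<in> carrier S.F. ?p u \<in> S'.Rel}"
    unfolding S.Rel_eq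
  proof (rule S.F.submodule_span_least)
    show "submodule {u \<in> carrier S.F. ?p u \<in> S'.Rel} field_ring S.F"
    proof (rule S.F.submoduleI')
      show "\<zero>\<^bsub>S.F\<^esub> \<in> {u \<in> carrier S.F. ?p u \<in> S'.Rel}"
        using linear_map_zero[OF S.F.vector_module_axioms S'.F.vector_module_axioms pl]
          S'.F.submoduleD(2)[OF S'.Rel_submodule] by simp
    qed (auto simp: p S'.F.submoduleD(3,4)[OF S'.Rel_submodule])
    show "S.relators \<subseteq> {u \<in> carrier S.F. ?p u \<in> S'.Rel}"
    proof
      fix u assume uR: "u \<in> S.relators"
      then obtain c c' where c: "c \<in> carrier C" "c' \<in> carrier C"
        and u: "u = (\<lambda>x. point_mass (c \<otimes>\<^bsub>C\<^esub> c') x - point_mass c x - point_mass c' x)"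
        by (auto simp: S.relators_def)
      have pm: "point_mass c \<in> carrier S.F" "point_mass c' \<in> carrier S.F"
        "point_mass (c \<otimes>\<^bsub>C\<^esub> c') \<in> carrier S.F"
        using c by (auto intro: point_mass_carrier)
      have "u = point_mass (c \<otimes>\<^bsub>C\<^esub> c') \<oplus>\<^bsub>S.F\<^esub> ((-1) \<odot>\<^bsub>S.F\<^esub> point_mass c \<oplus>\<^bsub>S.F\<^esub> (-1) \<odot>\<^bsub>S.F\<^esub> point_mass c')"
        by (simp add: u free_module_simps fun_eq_iff algebra_simps)
      then have "?p u = point_mass (f (c \<otimes>\<^bsub>C\<^esub> c')) \<oplus>\<^bsub>S'.F\<^esub>
          ((-1) \<odot>\<^bsub>S'.F\<^esub> point_mass (f c) \<oplus>\<^bsub>S'.F\<^esub> (-1) \<odot>\<^bsub>S'.F\<^esub> point_mass (f c'))"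
        using pm by (simp only: p push_forward_point_mass S.F.smult_closed' S.F.V.M.a_closed)
      also have "\<dots> = (\<lambda>x. point_mass (f c \<otimes>\<^bsub>C'\<^esub> f c') x - point_mass (f c) x - point_mass (f c') x)"
        using c f by (simp add: free_module_simps hom_def fun_eq_iff algebra_simps)
      also have "\<dots> \<in> S'.Rel"
        unfolding S'.Rel_eq using c f
        by (intro subsetD[OF S'.F.submodule_span_superset]) (auto simp: S'.relators_def hom_def)
      finally show "u \<in> {u \<in> carrier S.F. ?p u \<in> S'.Rel}" using uR S.relators_carrier by auto
    qed
  qed
  then have rel: "\<And>n. n \<in> S.Rel \<Longrightarrow> ?p n \<in> S'.Rel" by auto
  have eq: "tensor_map C' ({} :: 'g set) \<rho>' \<xi> f (S.Rel +>\<^bsub>S.F\<^esub> u) = S'.Rel +>\<^bsub>S'.F\<^esub> ?p u"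
    if u: "u \<in> carrier S.F" for u
  proof -
    note R = S.F.submoduleD(1,2)[OF S.Rel_submodule]
    have "S'.Rel +>\<^bsub>S'.F\<^esub> ?p v = S'.Rel +>\<^bsub>S'.F\<^esub> ?p u" if vu: "v \<in> S.Rel +>\<^bsub>S.F\<^esub> u" for v
    proof -
      obtain n where n: "n \<in> S.Rel" "v = n \<oplus>\<^bsub>S.F\<^esub> u" using vu unfolding S.F.coset_eq by auto
      then have "n \<in> carrier S.F" using R(1) by auto
      then have "?p v = ?p n \<oplus>\<^bsub>S'.F\<^esub> ?p u" and "v \<in> carrier S.F" using n u by (auto simp: p)
      then show ?thesis
        using S'.F.coset_eq_iff[OF S'.Rel_submodule p(1)[OF \<open>v \<in> carrier S.F\<close>] p(1)[OF u]] rel[OF n(1)]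
        by blast
    qed
    moreover have "u \<in> S.Rel +>\<^bsub>S.F\<^esub> u"
      unfolding S.F.coset_eq using R(2) u by (auto intro!: exI[of _ "\<zero>\<^bsub>S.F\<^esub>"])
    ultimately show ?thesis unfolding tensor_map_def by blast
  qed
  note q = linear_mapD[OF S.coset_linear] and q' = linear_mapD[OF S'.coset_linear]
  show ?thesis
    unfolding linear_map_def S.T_carrier
    by (auto simp: eq p q' simp flip: q(2,3))
qed

section \<open>The homomorphism on the group ring\<close>

text \<open>As for \<open>push_forward_eq\<close>, sums over supersets of the supports can be added and interchanged.\<close>

lemma group_ring_mult_eq:
  assumes "finite A" "{g. u g \<noteq> 0} \<subseteq> A" "finite B" "{g. v g \<noteq> 0} \<subseteq> B"
  shows "(u \<otimes>\<^bsub>group_ring H\<^esub> v) x = (\<Sum>g\<in>A. \<Sum>h\<in>B. if g \<otimes>\<^bsub>H\<^esub> h = x then u g * v h else 0)"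
proof -
  have "(\<Sum>g\<in>A. \<Sum>h\<in>B. if g \<otimes>\<^bsub>H\<^esub> h = x then u g * v h else 0)
      = (\<Sum>p\<in>A \<times> B. if fst p \<otimes>\<^bsub>H\<^esub> snd p = x then u (fst p) * v (snd p) else 0)"
    by (simp add: sum.cartesian_product case_prod_beta)
  also have "\<dots> = (\<Sum>p\<in>{p \<in> A \<times> B. fst p \<otimes>\<^bsub>H\<^esub> snd p = x}. u (fst p) * v (snd p))"
    using assms by (intro sum.inter_filter[symmetric]) auto
  also have "\<dots> = (\<Sum>p\<in>{(g, h). u g \<noteq> 0 \<and> v h \<noteq> 0 \<and> g \<otimes>\<^bsub>H\<^esub> h = x}. u (fst p) * v (snd p))"
    using assms by (intro sum.mono_neutral_right) (auto intro: finite_subset)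
  finally show ?thesis by (simp add: group_ring_def case_prod_beta)
qed

lemma group_ring_simps:
  "u \<in> carrier (group_ring H) \<longleftrightarrow> finite {g. u g \<noteq> 0} \<and> {g. u g \<noteq> 0} \<subseteq> carrier H"
  "\<one>\<^bsub>group_ring H\<^esub> = point_mass \<one>\<^bsub>H\<^esub>" "\<zero>\<^bsub>group_ring H\<^esub> = (\<lambda>_. 0)"
  "u \<oplus>\<^bsub>group_ring H\<^esub> v = (\<lambda>x. u x + v x)"
  by (simp_all add: group_ring_def)

lemma supp_point_mass: "{x. point_mass g x \<noteq> (0::int)} = {g}"
  by (auto simp: point_mass_def)

lemma point_mass_group_ring: "g \<in> carrier H \<Longrightarrow> point_mass g \<in> carrier (group_ring H)"
  by (simp add: group_ring_simps supp_point_mass)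

lemma point_mass_mult:
  "point_mass g \<otimes>\<^bsub>group_ring H\<^esub> point_mass h = point_mass (g \<otimes>\<^bsub>H\<^esub> h)"
proof
  fix x
  show "(point_mass g \<otimes>\<^bsub>group_ring H\<^esub> point_mass h) x = point_mass (g \<otimes>\<^bsub>H\<^esub> h) x"
    by (subst group_ring_mult_eq[of "{g}" _ "{h}"]) (auto simp: point_mass_def)
qed

lemma group_ring_mult_closed:
  assumes "Group.group H" "u \<in> carrier (group_ring H)" "v \<in> carrier (group_ring H)"
  shows "u \<otimes>\<^bsub>group_ring H\<^esub> v \<in> carrier (group_ring H)"
    "{x. (u \<otimes>\<^bsub>group_ring H\<^esub> v) x \<noteq> 0} \<subseteq> (\<lambda>(g, h). g \<otimes>\<^bsub>H\<^esub> h) ` ({g. u g \<noteq> 0} \<times> {g. v g \<noteq> 0})"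
proof -
  interpret H: Group.group H by fact
  let ?A = "{g. u g \<noteq> 0}" and ?B = "{g. v g \<noteq> 0}"
  have fin: "finite ?A" "finite ?B" and sub: "?A \<subseteq> carrier H" "?B \<subseteq> carrier H"
    using assms by (auto simp: group_ring_simps)
  show *: "{x. (u \<otimes>\<^bsub>group_ring H\<^esub> v) x \<noteq> 0} \<subseteq> (\<lambda>(g, h). g \<otimes>\<^bsub>H\<^esub> h) ` (?A \<times> ?B)"
  proof
    fix x assume "x \<in> {x. (u \<otimes>\<^bsub>group_ring H\<^esub> v) x \<noteq> 0}"
    then have "(\<Sum>g\<in>?A. \<Sum>h\<in>?B. if g \<otimes>\<^bsub>H\<^esub> h = x then u g * v h else 0) \<noteq> 0"
      using group_ring_mult_eq[of ?A u ?B v H x] fin by simp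
    then obtain g where g: "g \<in> ?A" "(\<Sum>h\<in>?B. if g \<otimes>\<^bsub>H\<^esub> h = x then u g * v h else 0) \<noteq> 0"
      by (rule sum.not_neutral_contains_not_neutral)
    from g(2) obtain h where "h \<in> ?B" "(if g \<otimes>\<^bsub>H\<^esub> h = x then u g * v h else 0) \<noteq> 0"
      by (rule sum.not_neutral_contains_not_neutral)
    then have "h \<in> ?B" "g \<otimes>\<^bsub>H\<^esub> h = x" by (auto split: if_splits)
    with g(1) show "x \<in> (\<lambda>(g, h). g \<otimes>\<^bsub>H\<^esub> h) ` (?A \<times> ?B)" by force
  qed
  have "(\<lambda>(g, h). g \<otimes>\<^bsub>H\<^esub> h) ` (?A \<times> ?B) \<subseteq> carrier H" using sub by auto
  then show "u \<otimes>\<^bsub>group_ring H\<^esub> v \<in> carrier (group_ring H)"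
    unfolding group_ring_simps using finite_subset[OF *] subset_trans[OF *] fin by simp
qed

lemma group_ring_assoc:
  assumes H: "Group.group H" and u: "u \<in> carrier (group_ring H)" and v: "v \<in> carrier (group_ring H)"
    and w: "w \<in> carrier (group_ring H)"
  shows "(u \<otimes>\<^bsub>group_ring H\<^esub> v) \<otimes>\<^bsub>group_ring H\<^esub> w = u \<otimes>\<^bsub>group_ring H\<^esub> (v \<otimes>\<^bsub>group_ring H\<^esub> w)"
proof
  interpret H: Group.group H by fact
  fix x
  let ?A = "{g. u g \<noteq> 0}" and ?B = "{g. v g \<noteq> 0}" and ?C = "{g. w g \<noteq> 0}"
  let ?P = "(\<lambda>(g, h). g \<otimes>\<^bsub>H\<^esub> h) ` (?A \<times> ?B)" and ?Q = "(\<lambda>(g, h). g \<otimes>\<^bsub>H\<^esub> h) ` (?B \<times> ?C)"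
  have fin: "finite ?A" "finite ?B" "finite ?C"
    and sub: "?A \<subseteq> carrier H" "?B \<subseteq> carrier H" "?C \<subseteq> carrier H"
    using u v w by (auto simp: group_ring_simps)
  have "((u \<otimes>\<^bsub>group_ring H\<^esub> v) \<otimes>\<^bsub>group_ring H\<^esub> w) x
      = (\<Sum>p\<in>?P. \<Sum>k\<in>?C. if p \<otimes>\<^bsub>H\<^esub> k = x then (u \<otimes>\<^bsub>group_ring H\<^esub> v) p * w k else 0)"
    using fin group_ring_mult_closed(2)[OF H u v] by (intro group_ring_mult_eq) auto
  also have "\<dots> = (\<Sum>p\<in>?P. \<Sum>k\<in>?C. \<Sum>g\<in>?A. \<Sum>h\<in>?B.
      if g \<otimes>\<^bsub>H\<^esub> h = p then (if p \<otimes>\<^bsub>H\<^esub> k = x then u g * v h * w k else 0) else 0)"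
  proof (intro sum.cong refl)
    fix p k
    show "(if p \<otimes>\<^bsub>H\<^esub> k = x then (u \<otimes>\<^bsub>group_ring H\<^esub> v) p * w k else 0) = (\<Sum>g\<in>?A. \<Sum>h\<in>?B.
      if g \<otimes>\<^bsub>H\<^esub> h = p then (if p \<otimes>\<^bsub>H\<^esub> k = x then u g * v h * w k else 0) else 0)"
    proof (cases "p \<otimes>\<^bsub>H\<^esub> k = x")
      case True
      then show ?thesis
        unfolding group_ring_mult_eq[OF fin(1) subset_refl fin(2) subset_refl, of H p] sum_distrib_right
        by (intro trans[OF if_P] sum.cong) auto
    qed (simp cong: if_cong)
  qed
  also have "\<dots> = (\<Sum>k\<in>?C. \<Sum>g\<in>?A. \<Sum>h\<in>?B. \<Sum>p\<in>?P.
      if g \<otimes>\<^bsub>H\<^esub> h = p then (if p \<otimes>\<^bsub>H\<^esub> k = x then u g * v h * w k else 0) else 0)"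
    by (rule trans[OF sum.swap sum.cong[OF refl trans[OF sum.swap sum.cong[OF refl sum.swap]]]])
  also have "\<dots> = (\<Sum>k\<in>?C. \<Sum>g\<in>?A. \<Sum>h\<in>?B.
      if (g \<otimes>\<^bsub>H\<^esub> h) \<otimes>\<^bsub>H\<^esub> k = x then u g * v h * w k else 0)"
    using fin by (intro sum.cong refl) (subst sum.delta', auto)
  also have "\<dots> = (\<Sum>g\<in>?A. \<Sum>h\<in>?B. \<Sum>k\<in>?C.
      if g \<otimes>\<^bsub>H\<^esub> (h \<otimes>\<^bsub>H\<^esub> k) = x then u g * v h * w k else 0)"
    using sub by (intro trans[OF sum.swap sum.cong[OF refl trans[OF sum.swap sum.cong[OF refl sum.cong[OF refl]]]]])
      (auto simp: H.m_assoc subset_eq)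
  also have "\<dots> = (\<Sum>g\<in>?A. \<Sum>h\<in>?B. \<Sum>k\<in>?C. \<Sum>p\<in>?Q.
      if h \<otimes>\<^bsub>H\<^esub> k = p then (if g \<otimes>\<^bsub>H\<^esub> p = x then u g * v h * w k else 0) else 0)"
    using fin by (intro sum.cong refl) (subst sum.delta', auto)
  also have "\<dots> = (\<Sum>g\<in>?A. \<Sum>p\<in>?Q. \<Sum>h\<in>?B. \<Sum>k\<in>?C.
      if h \<otimes>\<^bsub>H\<^esub> k = p then (if g \<otimes>\<^bsub>H\<^esub> p = x then u g * v h * w k else 0) else 0)"
    by (rule sum.cong[OF refl trans[OF sum.cong[OF refl sum.swap] sum.swap]])
  also have "\<dots> = (\<Sum>g\<in>?A. \<Sum>p\<in>?Q. if g \<otimes>\<^bsub>H\<^esub> p = x then u g * (v \<otimes>\<^bsub>group_ring H\<^esub> w) p else 0)"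
  proof (intro sum.cong refl)
    fix g p
    show "(\<Sum>h\<in>?B. \<Sum>k\<in>?C. if h \<otimes>\<^bsub>H\<^esub> k = p then (if g \<otimes>\<^bsub>H\<^esub> p = x then u g * v h * w k else 0) else 0)
      = (if g \<otimes>\<^bsub>H\<^esub> p = x then u g * (v \<otimes>\<^bsub>group_ring H\<^esub> w) p else 0)"
    proof (cases "g \<otimes>\<^bsub>H\<^esub> p = x")
      case True
      then show ?thesis
        unfolding group_ring_mult_eq[OF fin(2) subset_refl fin(3) subset_refl, of H p] sum_distrib_left
        by (intro trans[OF _ if_P[symmetric]] sum.cong) auto
    qed (simp cong: if_cong)
  qed
  also have "\<dots> = (u \<otimes>\<^bsub>group_ring H\<^esub> (v \<otimes>\<^bsub>group_ring H\<^esub> w)) x"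
    using fin group_ring_mult_closed(2)[OF H v w] by (intro group_ring_mult_eq[symmetric]) auto
  finally show "((u \<otimes>\<^bsub>group_ring H\<^esub> v) \<otimes>\<^bsub>group_ring H\<^esub> w) x = (u \<otimes>\<^bsub>group_ring H\<^esub> (v \<otimes>\<^bsub>group_ring H\<^esub> w)) x" .
qed

lemma cring_group_ring:
  assumes "Group.comm_group H" shows "cring (group_ring H)"
proof (rule cringI)
  interpret H: Group.comm_group H by fact
  note gr = H.group_axioms
  let ?R = "group_ring H"
  have add: "(\<lambda>x. u x + v x) \<in> carrier ?R" if "u \<in> carrier ?R" "v \<in> carrier ?R" for u v
  proof -
    have "{x. u x + v x \<noteq> 0} \<subseteq> {x. u x \<noteq> 0} \<union> {x. v x \<noteq> 0}" by auto
    then show ?thesis using that unfolding group_ring_simps by (blast intro: finite_subset)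
  qed
  have comm: "u \<otimes>\<^bsub>?R\<^esub> v = v \<otimes>\<^bsub>?R\<^esub> u" if "u \<in> carrier ?R" "v \<in> carrier ?R" for u v
  proof
    fix x
    let ?A = "{g. u g \<noteq> 0}" and ?B = "{g. v g \<noteq> 0}"
    have AB: "finite ?A" "finite ?B" "?A \<subseteq> carrier H" "?B \<subseteq> carrier H"
      using that by (auto simp: group_ring_simps)
    have "(\<Sum>g\<in>?A. \<Sum>h\<in>?B. if g \<otimes>\<^bsub>H\<^esub> h = x then u g * v h else 0) =
        (\<Sum>h\<in>?B. \<Sum>g\<in>?A. if h \<otimes>\<^bsub>H\<^esub> g = x then v h * u g else 0)"
      using AB by (intro trans[OF sum.swap sum.cong[OF refl sum.cong[OF refl]]]) (auto simp: H.m_comm subset_eq mult.commute)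
    then show "(u \<otimes>\<^bsub>?R\<^esub> v) x = (v \<otimes>\<^bsub>?R\<^esub> u) x"
      using AB by (simp add: group_ring_mult_eq[of ?A u ?B v] group_ring_mult_eq[of ?B v ?A u])
  qed
  show "abelian_group ?R"
  proof (rule abelian_groupI)
    fix u assume "u \<in> carrier ?R"
    then show "\<exists>v\<in>carrier ?R. v \<oplus>\<^bsub>?R\<^esub> u = \<zero>\<^bsub>?R\<^esub>"
      by (intro bexI[of _ "\<lambda>x. - u x"]) (auto simp: group_ring_simps)
  qed (auto simp: group_ring_simps(2-4) add intro!: ext, auto simp: group_ring_simps)
  show "Group.comm_monoid ?R"
  proof (rule Group.comm_monoidI)
    fix u assume u: "u \<in> carrier ?R"
    show "\<one>\<^bsub>?R\<^esub> \<otimes>\<^bsub>?R\<^esub> u = u"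
    proof
      fix x
      let ?A = "{g. u g \<noteq> 0}"
      have A: "finite ?A" "?A \<subseteq> carrier H" using u by (auto simp: group_ring_simps)
      have "(\<one>\<^bsub>?R\<^esub> \<otimes>\<^bsub>?R\<^esub> u) x = (\<Sum>g\<in>{\<one>\<^bsub>H\<^esub>}. \<Sum>h\<in>?A. if g \<otimes>\<^bsub>H\<^esub> h = x then point_mass \<one>\<^bsub>H\<^esub> g * u h else 0)"
        unfolding group_ring_simps using A by (intro group_ring_mult_eq) (auto simp: supp_point_mass)
      also have "\<dots> = (\<Sum>h\<in>?A. if h = x then u h else 0)"
        using A by (auto simp: point_mass_def subset_eq intro!: sum.cong)
      also have "\<dots> = u x" using A by simp
      finally show "(\<one>\<^bsub>?R\<^esub> \<otimes>\<^bsub>?R\<^esub> u) x = u x" .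
    qed
  qed (auto simp: group_ring_mult_closed[OF gr] group_ring_assoc[OF gr]
      group_ring_simps(2) point_mass_group_ring intro: comm)
  fix u v w assume uvw: "u \<in> carrier ?R" "v \<in> carrier ?R" "w \<in> carrier ?R"
  show "(u \<oplus>\<^bsub>?R\<^esub> v) \<otimes>\<^bsub>?R\<^esub> w = u \<otimes>\<^bsub>?R\<^esub> w \<oplus>\<^bsub>?R\<^esub> v \<otimes>\<^bsub>?R\<^esub> w"
  proof
    fix x
    let ?A = "{g. u g \<noteq> 0} \<union> {g. v g \<noteq> 0}" and ?B = "{g. w g \<noteq> 0}"
    have AB: "finite ?A" "finite ?B" using uvw by (auto simp: group_ring_simps)
    have "((\<lambda>x. u x + v x) \<otimes>\<^bsub>?R\<^esub> w) x = (\<Sum>g\<in>?A. \<Sum>h\<in>?B. if g \<otimes>\<^bsub>H\<^esub> h = x then (u g + v g) * w h else 0)"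
      by (rule group_ring_mult_eq[OF AB(1) _ AB(2) subset_refl]) auto
    also have "\<dots> = (\<Sum>g\<in>?A. \<Sum>h\<in>?B. (if g \<otimes>\<^bsub>H\<^esub> h = x then u g * w h else 0) +
        (if g \<otimes>\<^bsub>H\<^esub> h = x then v g * w h else 0))"
      by (intro sum.cong refl) (auto simp: distrib_right)
    also have "\<dots> = (u \<otimes>\<^bsub>?R\<^esub> w) x + (v \<otimes>\<^bsub>?R\<^esub> w) x"
      using AB by (simp add: sum.distrib group_ring_mult_eq[of ?A u ?B w] group_ring_mult_eq[of ?A v ?B w])
    finally show "((u \<oplus>\<^bsub>?R\<^esub> v) \<otimes>\<^bsub>?R\<^esub> w) x = (u \<otimes>\<^bsub>?R\<^esub> w \<oplus>\<^bsub>?R\<^esub> v \<otimes>\<^bsub>?R\<^esub> w) x"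
      by (simp add: group_ring_simps)
  qed
qed

context cring
begin

text \<open>The class of \<open>a / 1\<close> consists of the pairs \<open>(a d, d)\<close>, and \<open>d\<close> can be cancelled.\<close>

lemma fraction_one_mult:
  assumes a: "a \<in> carrier R" and b: "b \<in> carrier R"
  shows "fraction R a \<one> \<in> carrier (total_quotient_ring R)"
    "fraction R a \<one> \<otimes>\<^bsub>total_quotient_ring R\<^esub> fraction R b \<one> = fraction R (a \<otimes> b) \<one>"
proof -
  let ?D = "non_zero_divisors R"
  have one: "\<one> \<in> ?D" by (auto simp: non_zero_divisors_def)
  have D: "d \<in> carrier R" if "d \<in> ?D" for d using that by (auto simp: non_zero_divisors_def)
  have nzd: "c = \<zero>" if "d \<in> ?D" "c \<in> carrier R" "c \<otimes> d = \<zero>" for c d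
    using that unfolding non_zero_divisors_def by blast
  have DD: "d \<otimes> e \<in> ?D" if de: "d \<in> ?D" "e \<in> ?D" for d e
  proof -
    note dC = D[OF de(1)] D[OF de(2)]
    have "c = \<zero>" if c: "c \<in> carrier R" "c \<otimes> (d \<otimes> e) = \<zero>" for c
    proof -
      have "(c \<otimes> d) \<otimes> e = \<zero>" using m_assoc[OF c(1) dC] c(2) by (rule trans)
      from nzd[OF de(2) m_closed[OF c(1) dC(1)] this] show ?thesis by (rule nzd[OF de(1) c(1)])
    qed
    then show ?thesis using m_closed[OF dC] unfolding non_zero_divisors_def by blast
  qed
  have fr1: "fraction R c \<one> = {(x, y). x \<in> carrier R \<and> y \<in> ?D \<and> x = c \<otimes> y}" if "c \<in> carrier R" for c
    using that one D by (auto simp: fraction_def fraction_rel_def)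
  show "fraction R a \<one> \<in> carrier (total_quotient_ring R)"
    using a one by (auto simp: total_quotient_ring_def fraction_def intro: quotientI)
  have "fraction R ((a \<otimes> d) \<otimes> (b \<otimes> e)) (d \<otimes> e) = fraction R (a \<otimes> b) \<one>"
    if de: "d \<in> ?D" "e \<in> ?D" for d e
  proof -
    have cancel: "(a \<otimes> d) \<otimes> (b \<otimes> e) \<otimes> y = x \<otimes> (d \<otimes> e) \<longleftrightarrow> x = a \<otimes> b \<otimes> y"
      if xy: "x \<in> carrier R" "y \<in> ?D" for x y
    proof -
      have c: "d \<in> carrier R" "e \<in> carrier R" "y \<in> carrier R" using de xy D by auto
      let ?z = "a \<otimes> b \<otimes> y"
      have eq: "(a \<otimes> d) \<otimes> (b \<otimes> e) \<otimes> y = ?z \<otimes> (d \<otimes> e)"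
        using c a b by (simp add: m_ac)
      have "x = ?z" if "?z \<otimes> (d \<otimes> e) = x \<otimes> (d \<otimes> e)"
      proof -
        have "(?z \<ominus> x) \<otimes> (d \<otimes> e) = \<zero>"
          using that c a b xy by (simp add: a_minus_def l_distr l_minus r_neg)
        then have "?z \<ominus> x = \<zero>"
          by (rule nzd[OF DD[OF de], rotated]) (use c a b xy in simp)
        then show ?thesis using c a b xy by simp
      qed
      then show ?thesis unfolding eq by auto
    qed
    have c: "d \<in> carrier R" "e \<in> carrier R" using de D by auto
    have "fraction R ((a \<otimes> d) \<otimes> (b \<otimes> e)) (d \<otimes> e) =
        {(x, y). x \<in> carrier R \<and> y \<in> ?D \<and> (a \<otimes> d) \<otimes> (b \<otimes> e) \<otimes> y = x \<otimes> (d \<otimes> e)}"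
      using DD[OF de] c a b by (auto simp: fraction_def fraction_rel_def)
    then show ?thesis unfolding fr1[OF m_closed[OF a b]] using cancel by blast
  qed
  note main = this
  have fr1': "fraction R c \<one> = (\<lambda>y. (c \<otimes> y, y)) ` ?D" if "c \<in> carrier R" for c
    unfolding fr1[OF that] using m_closed[OF that D] by blast
  have "(\<Union>(x, y)\<in>fraction R a \<one>. \<Union>(x', y')\<in>fraction R b \<one>. fraction R (x \<otimes> x') (y \<otimes> y'))
      = (\<Union>d\<in>?D. \<Union>e\<in>?D. fraction R (a \<otimes> b) \<one>)"
    unfolding fr1'[OF a] fr1'[OF b] UN_simps(10) prod.case by (intro SUP_cong refl main)
  also have "\<dots> = fraction R (a \<otimes> b) \<one>" using one by auto
  finally show "fraction R a \<one> \<otimes>\<^bsub>total_quotient_ring R\<^esub> fraction R b \<one> = fraction R (a \<otimes> b) \<one>"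
    by (simp add: total_quotient_ring_def)
qed

end

text \<open>The maps that compose to \<open>\<phi>\<close> are multiplicative; for the passage to the total quotient ring this is
  \<open>fraction_one_mult\<close>.\<close>

lemma character_of_group_ring:
  fixes \<theta> :: "'e \<Rightarrow> 'f::field"
  assumes H: "Group.comm_group H"
    and split: "splits_into_fields (total_quotient_ring (group_ring H)) r F pr"
    and l: "l < r" and \<theta>: "\<theta> \<in> ring_iso (F l) field_ring"
    and \<phi>: "\<phi> = (\<lambda>x. \<theta> (pr l (fraction (group_ring H) x \<one>\<^bsub>group_ring H\<^esub>)))"
  shows "\<phi> (point_mass \<one>\<^bsub>H\<^esub>) = 1"
    "g \<in> carrier H \<Longrightarrow> h \<in> carrier H \<Longrightarrow>
      \<phi> (point_mass (g \<otimes>\<^bsub>H\<^esub> h)) = \<phi> (point_mass g) * \<phi> (point_mass h)"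
proof -
  let ?R = "group_ring H" and ?Q = "total_quotient_ring (group_ring H)"
  note R = cring_group_ring[OF H]
  have pr: "pr l \<in> Ring.ring_hom ?Q (F l)" using split l by (simp add: splits_into_fields_def)
  have th: "\<theta> \<in> Ring.ring_hom (F l) field_ring" using \<theta> by (simp add: ring_iso_def)
  have "\<one>\<^bsub>?Q\<^esub> = fraction ?R \<one>\<^bsub>?R\<^esub> \<one>\<^bsub>?R\<^esub>" by (simp add: total_quotient_ring_def)
  then show "\<phi> (point_mass \<one>\<^bsub>H\<^esub>) = 1"
    unfolding \<phi> using ring_hom_one[OF pr] ring_hom_one[OF th] by (simp add: group_ring_simps)
  assume gh: "g \<in> carrier H" "h \<in> carrier H"
  note fr = cring.fraction_one_mult[OF R point_mass_group_ring[OF gh(1)] point_mass_group_ring[OF gh(2)]]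
    cring.fraction_one_mult(1)[OF R point_mass_group_ring[OF gh(2)] point_mass_group_ring[OF gh(2)]]
  show "\<phi> (point_mass (g \<otimes>\<^bsub>H\<^esub> h)) = \<phi> (point_mass g) * \<phi> (point_mass h)"
    unfolding \<phi> point_mass_mult[symmetric] fr(2)[symmetric]
    using ring_hom_mult[OF pr fr(1,3)] ring_hom_mult[OF th ring_hom_closed[OF pr fr(1)] ring_hom_closed[OF pr fr(3)]]
    by simp
qed

section \<open>Homology classes of cells\<close>

lemma singular_simplex_top_of_set:
  "singular_simplex n (top_of_set X) f \<longleftrightarrow>
    continuous_on (standard_simplex n) f \<and> f ` standard_simplex n \<subseteq> X \<and> f \<in> extensional (standard_simplex n)"
  by (auto simp: singular_simplex_def euclidean_product_topology continuous_map_in_subtopology)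

text \<open>The characteristic maps of cells and their lifts, for the filtrations \<open>S\<close> of the base and of the
  cover by skeleta; these are the simplices that represent a class in the cellular chain group.\<close>

definition cell_simplex :: "(nat \<Rightarrow> 'a::t2_space set) \<Rightarrow> nat \<Rightarrow> ((nat \<Rightarrow> real) \<Rightarrow> 'a) \<Rightarrow> bool" where
  "cell_simplex S n f \<longleftrightarrow> singular_simplex n (top_of_set (S (Suc n))) f \<and>
     f ` (standard_simplex n - open_simplex n) \<subseteq> S n"

lemma face_avoids_open_simplex:
  assumes "k \<le> n" "x \<in> standard_simplex (n - Suc 0)"
  shows "simplical_face k x \<notin> open_simplex n"
  using assms by (auto simp: open_simplex_def simplical_face_def dest!: spec[of _ k])

text \<open>The faces of the standard simplex miss its interior, so \<open>f\<close> maps them to the lower skeleton.\<close>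

lemma cell_simplex_relcycle:
  assumes "cell_simplex S n f"
  shows "singular_relcycle n (top_of_set (S (Suc n))) (S n) (frag_of f)"
proof -
  have f: "singular_simplex n (top_of_set (S (Suc n))) f"
    and bd: "f ` (standard_simplex n - open_simplex n) \<subseteq> S n"
    using assms by (auto simp: cell_simplex_def)
  have "singular_chain (n - 1) (subtopology (top_of_set (S (Suc n))) (S n)) (chain_boundary n (frag_of f))"
  proof (cases "n = 0")
    case False
    have "singular_simplex (n - 1) (subtopology (top_of_set (S (Suc n))) (S n)) (singular_face n k f)"
      if k: "k \<le> n" for k
    proof (rule iffD2[OF singular_simplex_subtopology], rule conjI)
      show "singular_simplex (n - 1) (top_of_set (S (Suc n))) (singular_face n k f)"
        using singular_simplex_singular_face[OF f] k False by simp
      show "singular_face n k f ` standard_simplex (n - 1) \<subseteq> S n"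
      proof
        fix y assume "y \<in> singular_face n k f ` standard_simplex (n - 1)"
        then obtain x where x: "x \<in> standard_simplex (n - Suc 0)" "y = f (simplical_face k x)"
          by (auto simp: singular_face_def)
        have "simplical_face k x \<in> standard_simplex n"
          using simplical_face_in_standard_simplex[of n k x] x(1) k False by simp
        then show "y \<in> S n" using face_avoids_open_simplex[OF k x(1)] bd x(2) by auto
      qed
    qed
    then show ?thesis
      using False by (auto simp: chain_boundary_of singular_chain_of intro!: singular_chain_sum singular_chain_cmul)
  qed (simp add: chain_boundary_of)
  then show ?thesis using f by (simp add: singular_relcycle singular_chain_of)
qed

lemma cell_chains_group: "comm_group (cell_chains S n)"
  by (simp add: cell_chains_def)

lemma cell_class_carrier:
  "cell_simplex S n f \<Longrightarrow> cell_class S n a f \<in> carrier (cell_chains S n)"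
  unfolding cell_class_def cell_chains_def carrier_relative_homology_group
  using singular_relcycle_cmul[OF cell_simplex_relcycle] by blast

lemma cell_class_minus:
  assumes "cell_simplex S n f"
  shows "cell_class S n (- a) f = inv\<^bsub>cell_chains S n\<^esub> cell_class S n a f"
proof -
  let ?G = "cell_chains S n" and ?X = "top_of_set (S (Suc n))"
  interpret Group.comm_group ?G by (rule cell_chains_group)
  have "cell_class S n (- a) f \<otimes>\<^bsub>?G\<^esub> cell_class S n a f = \<one>\<^bsub>?G\<^esub>"
  proof -
    have "(\<Union>r\<in>homologous_rel_set n ?X (S n) (frag_cmul (- a) (frag_of f)).
        \<Union>s\<in>homologous_rel_set n ?X (S n) (frag_cmul a (frag_of f)). {r + s}) = singular_relboundary_set n ?X (S n)"
    proof (intro equalityI subsetI)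
      fix z assume "z \<in> (\<Union>r\<in>homologous_rel_set n ?X (S n) (frag_cmul (- a) (frag_of f)).
        \<Union>s\<in>homologous_rel_set n ?X (S n) (frag_cmul a (frag_of f)). {r + s})"
      then obtain r s where rs: "homologous_rel n ?X (S n) (frag_cmul (- a) (frag_of f)) r"
        "homologous_rel n ?X (S n) (frag_cmul a (frag_of f)) s" "z = r + s"
        unfolding UN_iff singleton_iff mem_Collect_eq by blast
      have "homologous_rel n ?X (S n) (frag_cmul (- a) (frag_of f) + frag_cmul a (frag_of f)) z"
        unfolding rs(3) by (rule homologous_rel_add[OF rs(1,2)])
      then have "homologous_rel n ?X (S n) z 0"
        by (simp add: homologous_rel_sym flip: frag_cmul_distrib)
      then show "z \<in> singular_relboundary_set n ?X (S n)" by (simp add: homologous_rel_def)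
    next
      fix z assume "z \<in> singular_relboundary_set n ?X (S n)"
      then have z: "homologous_rel n ?X (S n) (frag_cmul (- a) (frag_of f)) (z + frag_cmul (- a) (frag_of f))"
        by (simp add: homologous_rel_def singular_relboundary_minus)
      have "z = (z + frag_cmul (- a) (frag_of f)) + frag_cmul a (frag_of f)"
        by (simp add: add.assoc flip: frag_cmul_distrib)
      then show "z \<in> (\<Union>r\<in>homologous_rel_set n ?X (S n) (frag_cmul (- a) (frag_of f)).
        \<Union>s\<in>homologous_rel_set n ?X (S n) (frag_cmul a (frag_of f)). {r + s})"
        using z by (blast intro: homologous_rel_refl)
    qed
    then show ?thesis unfolding cell_class_def cell_chains_def mult_relative_homology_group by simp
  qed
  then show ?thesis
    using inv_equality cell_class_carrier[OF assms] by metis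
qed

lemma cell_map_cell_class:
  assumes f: "cell_simplex S n f" and g: "continuous_on (S (Suc n)) g" "g ` S (Suc n) \<subseteq> S (Suc n)" "g ` S n \<subseteq> S n"
  shows "cell_map S n g (cell_class S n a f) = cell_class S n a (simplex_map n g f)"
proof -
  have "hom_induced n (top_of_set (S (Suc n))) (S n) (top_of_set (S (Suc n))) (S n) g
      (homologous_rel_set n (top_of_set (S (Suc n))) (S n) (frag_cmul a (frag_of f))) =
    homologous_rel_set n (top_of_set (S (Suc n))) (S n) (chain_map n g (frag_cmul a (frag_of f)))"
    using g by (intro hom_induced_chain_map singular_relcycle_cmul cell_simplex_relcycle f)
      (auto simp: continuous_map_in_subtopology)
  then show ?thesis by (simp add: cell_map_def cell_class_def)
qed

lemma cell_boundary_hom: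
  assumes "S (Suc n) \<subseteq> S (Suc (Suc n))"
  shows "cell_boundary S n \<in> Group.hom (cell_chains S (Suc n)) (cell_chains S n)"
proof -
  have "subtopology (top_of_set (S (Suc (Suc n)))) (S (Suc n)) = top_of_set (S (Suc n))"
    using assms by (simp add: subtopology_subtopology Int_absorb1)
  then have "hom_boundary (int (Suc n)) (top_of_set (S (Suc (Suc n)))) (S (Suc n)) \<in>
      Group.hom (cell_chains S (Suc n)) (homology_group (int n) (top_of_set (S (Suc n))))"
    using hom_boundary_hom[of "int (Suc n)" "top_of_set (S (Suc (Suc n)))" "S (Suc n)"]
    by (simp add: cell_chains_def)
  moreover have "hom_induced (int n) (top_of_set (S (Suc n))) {} (top_of_set (S (Suc n))) (S n) id \<in>
      Group.hom (homology_group (int n) (top_of_set (S (Suc n)))) (cell_chains S n)"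
    unfolding cell_chains_def by (rule hom_induced_hom)
  ultimately show ?thesis unfolding cell_boundary_def by (rule hom_compose)
qed

lemma skel_mono: "m \<le> n \<Longrightarrow> skel D m \<subseteq> skel D n"
  unfolding skel_def by auto

lemma cell_simplex_of_decomposition:
  assumes D: "is_cell_decomposition Y D" and c: "c \<in> D"
  shows "cell_simplex (skel D) (fst c) (snd c)"
proof -
  have s: "singular_simplex (fst c) (top_of_set (underlying Y)) (snd c)"
    and b: "snd c ` (standard_simplex (fst c) - open_simplex (fst c)) \<subseteq> skel D (fst c)"
    using D c by (auto simp: is_cell_decomposition_def)
  have "snd c x \<in> skel D (Suc (fst c))" if x: "x \<in> standard_simplex (fst c)" for x
  proof (cases "x \<in> open_simplex (fst c)")
    case True
    then show ?thesis
      unfolding skel_def open_cell_def UN_iff using c by (intro bexI[of _ c]) auto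
  next
    case False
    then have "snd c x \<in> skel D (fst c)" using x b by auto
    then show ?thesis using skel_mono[of "fst c" "Suc (fst c)" D] by auto
  qed
  then have "snd c ` standard_simplex (fst c) \<subseteq> skel D (Suc (fst c))" by auto
  then show ?thesis using s b by (simp add: cell_simplex_def singular_simplex_top_of_set)
qed

definition lifts_cell :: "('a, 'b::t2_space) orb_cover \<Rightarrow> 'a cell \<Rightarrow> ((nat \<Rightarrow> real) \<Rightarrow> 'b) \<Rightarrow> bool" where
  "lifts_cell P c f \<longleftrightarrow> singular_simplex (fst c) (top_of_set (total P)) f \<and> simplex_map (fst c) (proj P) f = snd c"

lemma lifts_cellD:
  assumes "lifts_cell P c f"
  shows "continuous_on (standard_simplex (fst c)) f" "f \<in> extensional (standard_simplex (fst c))"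
    "x \<in> standard_simplex (fst c) \<Longrightarrow> f x \<in> total P"
    "x \<in> standard_simplex (fst c) \<Longrightarrow> proj P (f x) = snd c x"
proof -
  show "continuous_on (standard_simplex (fst c)) f" "f \<in> extensional (standard_simplex (fst c))"
    "x \<in> standard_simplex (fst c) \<Longrightarrow> f x \<in> total P"
    using assms by (auto simp: lifts_cell_def singular_simplex_top_of_set)
  show "proj P (f x) = snd c x" if "x \<in> standard_simplex (fst c)"
  proof -
    have "simplex_map (fst c) (proj P) f x = snd c x" using assms by (simp add: lifts_cell_def)
    then show ?thesis using that by (simp add: simplex_map_def)
  qed
qed

lemma cell_simplex_lift:
  assumes D: "is_cell_decomposition Y D" and c: "c \<in> D" and f: "lifts_cell P c f"
  shows "cell_simplex (cover_skel P D) (fst c) f"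
  using cell_simplex_of_decomposition[OF D c] lifts_cellD[OF f]
  by (auto simp: cell_simplex_def singular_simplex_top_of_set cover_skel_def image_subset_iff)

lemma orientation_class:
  fixes \<xi> :: "'g \<Rightarrow> 'f::field"
  assumes "tensor_data (cell_chains S n) G \<rho>" and f: "cell_simplex S n f"
    and \<epsilon>: "\<epsilon> \<in> {1, -1}" "\<epsilon>' \<in> {1, -1}"
  shows "tensor_elt (cell_chains S n) G \<rho> \<xi> (cell_class S n \<epsilon>' f) =
    of_int (\<epsilon> * \<epsilon>') \<odot>\<^bsub>tensor_module (cell_chains S n) G \<rho> \<xi>\<^esub>
      tensor_elt (cell_chains S n) G \<rho> \<xi> (cell_class S n \<epsilon> f)"
proof -
  interpret T: tensor_data "cell_chains S n" G \<rho> \<xi> by fact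
  note c = cell_class_carrier[OF f]
  have oi: "of_int (\<epsilon> * \<epsilon>) = (1 :: 'f)" using \<epsilon> by auto
  consider "\<epsilon>' = \<epsilon>" | "\<epsilon>' = - \<epsilon>" using \<epsilon> by auto
  then show ?thesis
  proof cases
    case 1
    show ?thesis unfolding 1 oi by (rule T.T.smult_one'[OF T.elt_carrier[OF c], symmetric])
  next
    case 2
    show ?thesis
      unfolding 2 mult_minus_right of_int_minus oi cell_class_minus[OF f] by (rule T.elt_inv[OF c])
  qed
qed

lemma real_tensor_data: "tensor_data (cell_chains S n) ({} :: unit set) \<rho>"
  by (rule tensor_data.intro) (use cell_chains_group in \<open>auto simp: Group.comm_group_def\<close>)

lemma real_complex: "finite_complex m (real_chains D) (real_boundary D)"
proof (rule finite_complex.intro)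
  show "vector_module (real_chains D i)" for i
    unfolding real_chains_def by (rule tensor_data.T_vector_module[OF real_tensor_data])
  show "linear_map (real_chains D (Suc i)) (real_chains D i) (real_boundary D i)" for i
    unfolding real_chains_def real_boundary_def
    using cell_chains_group by (intro tensor_map_linear cell_boundary_hom skel_mono)
      (auto simp: Group.comm_group_def)
qed

section \<open>Uniqueness of lifts\<close>

definition locally_inj_on :: "('b::topological_space \<Rightarrow> 'a) \<Rightarrow> 'b set \<Rightarrow> bool" where
  "locally_inj_on p E \<longleftrightarrow> (\<forall>x\<in>E. \<exists>U. openin (top_of_set E) U \<and> x \<in> U \<and> inj_on p U)"

text \<open>The set where the two lifts agree is open as far as they run where \<open>p\<close> is locally injective, and
  closed as the space is Hausdorff. The end point, which may lie outside that region, follows by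
  continuity.\<close>

lemma lifts_of_path_agree:
  fixes \<alpha> \<beta> :: "real \<Rightarrow> 'b::t2_space"
  assumes cont: "continuous_on {0..1} \<alpha>" "continuous_on {0..1} \<beta>"
    and p: "\<And>s. s \<in> {0..1} \<Longrightarrow> p (\<alpha> s) = p (\<beta> s)"
    and E: "\<And>s. s \<in> {0..<1} \<Longrightarrow> \<alpha> s \<in> E" "\<And>s. s \<in> {0..<1} \<Longrightarrow> \<beta> s \<in> E"
    and inj: "locally_inj_on p E" and start: "\<alpha> 0 = \<beta> 0"
  shows "\<alpha> 1 = \<beta> 1"
proof -
  let ?S = "{0..<1::real}"
  define A where "A = {s \<in> ?S. \<alpha> s = \<beta> s}"
  have c: "continuous_on ?S \<alpha>" "continuous_on ?S \<beta>"
    using cont by (auto intro: continuous_on_subset)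
  have haus: "Hausdorff_space (euclidean :: 'b topology)"
    by (simp add: Hausdorff_space_def disjnt_def) (metis hausdorff)
  have closed_agree: "closedin (top_of_set T) {s \<in> T. \<alpha> s = \<beta> s}"
    if "continuous_on T \<alpha>" "continuous_on T \<beta>" for T
    using closedin_continuous_maps_eq[OF haus, of "top_of_set T" \<alpha> \<beta>] that by simp
  have "openin (top_of_set ?S) A"
  proof (subst openin_subopen, intro ballI)
    fix s assume s: "s \<in> A"
    then have sS: "s \<in> ?S" "\<alpha> s = \<beta> s" by (auto simp: A_def)
    obtain U where U: "openin (top_of_set E) U" "\<alpha> s \<in> U" "inj_on p U"
      using inj E(1)[OF sS(1)] by (auto simp: locally_inj_on_def)
    let ?W = "(?S \<inter> \<alpha> -` U) \<inter> (?S \<inter> \<beta> -` U)"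
    have "openin (top_of_set ?S) (?S \<inter> \<alpha> -` U)"
      by (rule continuous_openin_preimage[OF c(1) _ U(1)]) (use E(1) in auto)
    moreover have "openin (top_of_set ?S) (?S \<inter> \<beta> -` U)"
      by (rule continuous_openin_preimage[OF c(2) _ U(1)]) (use E(2) in auto)
    ultimately have "openin (top_of_set ?S) ?W" by (rule openin_Int)
    moreover have "s \<in> ?W" using sS U(2) by auto
    moreover have "?W \<subseteq> A"
    proof
      fix t assume t: "t \<in> ?W"
      then have "p (\<alpha> t) = p (\<beta> t)" using p by auto
      then have "\<alpha> t = \<beta> t" using t by (intro inj_onD[OF U(3)]) auto
      then show "t \<in> A" using t by (auto simp: A_def)
    qed
    ultimately show "\<exists>T. openin (top_of_set ?S) T \<and> s \<in> T \<and> T \<subseteq> A" by blast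
  qed
  moreover have "closedin (top_of_set ?S) A" unfolding A_def by (rule closed_agree[OF c])
  moreover have "connected ?S" by simp
  moreover have "0 \<in> A" using start by (simp add: A_def)
  ultimately have "A = {} \<or> A = ?S" and "A \<noteq> {}" unfolding connected_clopen by auto
  then have "A = ?S" by simp
  have cl: "closed {s \<in> {0..1}. \<alpha> s = \<beta> s}"
    by (rule closedin_closed_trans[OF closed_agree[OF cont]]) simp
  have "?S \<subseteq> {s \<in> {0..1}. \<alpha> s = \<beta> s}"
  proof
    fix s assume s: "s \<in> ?S"
    then have "s \<in> A" unfolding \<open>A = ?S\<close> .
    then show "s \<in> {s \<in> {0..1}. \<alpha> s = \<beta> s}" using s by (simp add: A_def)
  qed
  from closure_minimal[OF this cl] have "{0..1} \<subseteq> {s \<in> {0..1}. \<alpha> s = \<beta> s}" by simp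
  then have "1 \<in> {s \<in> {0..1}. \<alpha> s = \<beta> s}" by (rule subsetD) simp
  then show ?thesis by simp
qed

lemma segment_in_standard_simplex:
  assumes "x \<in> standard_simplex n" "y \<in> standard_simplex n" "s \<in> {0..1::real}"
  shows "(\<lambda>i. (1 - s) * x i + s * y i) \<in> standard_simplex n"
proof -
  have "0 \<le> (1 - s) * x i + s * y i" for i using assms by (auto simp: standard_simplex_def)
  moreover have "(1 - s) * x i + s * y i \<le> 1" for i
    using assms by (auto simp: standard_simplex_def intro!: convex_bound_le)
  moreover have "(\<Sum>i\<le>n. (1 - s) * x i + s * y i) = 1"
    using assms by (simp add: standard_simplex_def sum.distrib flip: sum_distrib_left)
  ultimately show ?thesis using assms by (simp add: standard_simplex_def)
qed

lemma segment_in_open_simplex: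
  assumes "x \<in> open_simplex n" "y \<in> standard_simplex n" "s \<in> {0..<1::real}"
  shows "(\<lambda>i. (1 - s) * x i + s * y i) \<in> open_simplex n"
proof -
  have "0 < (1 - s) * x i + s * y i" if "i \<le> n" for i
    using assms that by (auto simp: standard_simplex_def open_simplex_def intro!: add_pos_nonneg)
  then show ?thesis
    using segment_in_standard_simplex[of x n y s] assms by (auto simp: open_simplex_def)
qed

lemma open_simplex_nonempty: "\<exists>x. x \<in> open_simplex n"
proof
  show "(\<lambda>i. if i \<le> n then 1 / real (Suc n) else 0) \<in> open_simplex n"
    by (auto simp: open_simplex_def standard_simplex_def divide_simps)
qed

text \<open>A simplex is swept out by the segments from one of its points \<open>x0\<close>, so this reduces to paths.\<close>

lemma lifts_of_cell_agree:
  fixes f f' :: "(nat \<Rightarrow> real) \<Rightarrow> 'b::t2_space"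
  assumes f: "lifts_cell P c f" and f': "lifts_cell P c f'"
    and x0: "x0 \<in> standard_simplex (fst c)" and start: "f x0 = f' x0"
    and inj: "locally_inj_on (proj P) E"
    and E: "\<And>x s. x \<in> standard_simplex (fst c) \<Longrightarrow> s \<in> {0..<1} \<Longrightarrow>
      f (\<lambda>i. (1 - s) * x0 i + s * x i) \<in> E \<and> f' (\<lambda>i. (1 - s) * x0 i + s * x i) \<in> E"
  shows "f = f'"
proof
  fix x
  show "f x = f' x"
  proof (cases "x \<in> standard_simplex (fst c)")
    case True
    define \<gamma> where "\<gamma> = (\<lambda>s i. (1 - s) * x0 i + s * x i :: real)"
    have cg: "continuous_on {0..1} \<gamma>"
      unfolding \<gamma>_def by (intro continuous_on_coordinatewise_then_product continuous_intros)
    have g: "\<gamma> s \<in> standard_simplex (fst c)" if "s \<in> {0..1}" for s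
      unfolding \<gamma>_def by (rule segment_in_standard_simplex[OF x0 True that])
    have "(f \<circ> \<gamma>) 1 = (f' \<circ> \<gamma>) 1"
    proof (rule lifts_of_path_agree[where p = "proj P" and E = E])
      show "continuous_on {0..1} (f \<circ> \<gamma>)" "continuous_on {0..1} (f' \<circ> \<gamma>)"
        using g continuous_on_compose[OF cg continuous_on_subset[OF lifts_cellD(1)[OF f]]]
          continuous_on_compose[OF cg continuous_on_subset[OF lifts_cellD(1)[OF f']]] by blast+
      show "proj P ((f \<circ> \<gamma>) s) = proj P ((f' \<circ> \<gamma>) s)" if "s \<in> {0..1}" for s
        using lifts_cellD(4)[OF f g[OF that]] lifts_cellD(4)[OF f' g[OF that]] by simp
      show "(f \<circ> \<gamma>) s \<in> E" "(f' \<circ> \<gamma>) s \<in> E" if "s \<in> {0..<1}" for s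
        using E[OF True that] by (simp_all add: \<gamma>_def)
    qed (use inj start in \<open>simp_all add: \<gamma>_def\<close>)
    then show ?thesis by (simp add: \<gamma>_def)
  next
    case False
    then show ?thesis
      using lifts_cellD(2)[OF f] lifts_cellD(2)[OF f'] by (simp add: extensional_def)
  qed
qed

section \<open>The first orbifold homology group\<close>

lemma loop_class_carrier:
  assumes "path \<gamma>" "path_image \<gamma> \<subseteq> X" "\<gamma> 0 = \<gamma> 1"
  shows "loop_class X \<gamma> \<in> carrier (homology_group 1 (top_of_set X))"
proof -
  have s1: "x 1 \<in> {0..1}" if "x \<in> standard_simplex 1" for x using that by (auto simp: standard_simplex_def)
  have "singular_simplex 1 (top_of_set X) (path_simplex \<gamma>)"
    unfolding singular_simplex_top_of_set
  proof (intro conjI)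
    have "continuous_on (standard_simplex 1) (\<lambda>x :: nat \<Rightarrow> real. x 1)"
      by (rule continuous_on_subset[OF continuous_on_product_coordinates]) simp
    then have "continuous_on (standard_simplex 1) (\<lambda>x. \<gamma> (x 1))"
      by (rule continuous_on_compose2[OF assms(1)[unfolded path_def]]) (use s1 in blast)
    then show "continuous_on (standard_simplex 1) (path_simplex \<gamma>)"
      by (rule continuous_on_eq) (simp add: path_simplex_def)
    show "path_simplex \<gamma> ` standard_simplex 1 \<subseteq> X"
      using s1 assms(2) by (auto simp: path_simplex_def path_image_def)
  qed (simp add: path_simplex_def)
  moreover have "singular_face 1 0 (path_simplex \<gamma>) = singular_face 1 1 (path_simplex \<gamma>)"
  proof
    fix x :: "nat \<Rightarrow> real"
    show "singular_face 1 0 (path_simplex \<gamma>) x = singular_face 1 1 (path_simplex \<gamma>) x"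
    proof (cases "x \<in> standard_simplex 0")
      case True
      then have x0: "x 0 = 1" by (simp add: standard_simplex_def)
      have "simplical_face 0 x \<in> standard_simplex 1" "simplical_face 1 x \<in> standard_simplex 1"
        using simplical_face_in_standard_simplex[of 1 _ x] True by auto
      then show ?thesis
        using True assms(3) x0 by (simp add: singular_face_def path_simplex_def simplical_face_def)
    qed (simp add: singular_face_def)
  qed
  then have "chain_boundary 1 (frag_of (path_simplex \<gamma>)) = 0"
    by (simp add: chain_boundary_of flip: frag_cmul_distrib)
  ultimately have "singular_relcycle 1 (top_of_set X) {} (frag_of (path_simplex \<gamma>))"
    by (simp add: singular_cycle singular_chain_of)
  then show ?thesis
    using carrier_relative_homology_group[of 1 "top_of_set X" "{}"] by (auto simp: loop_class_def)
qed

locale link_orbifold =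
  fixes Y :: "'a::t2_space link_orbifold"
  assumes orb: "is_link_orbifold Y"
begin

lemma ord_at_ge: "i < ncomp Y \<Longrightarrow> 2 \<le> ord_at Y i"
  using orb by (simp add: is_link_orbifold_def)

lemma tube_homeomorphism:
  "i < ncomp Y \<Longrightarrow> \<exists>g. homeomorphism (circle \<times> ball 0 2) (tube Y i ` (circle \<times> ball 0 2)) (tube Y i) g"
  using orb by (simp add: is_link_orbifold_def)

lemma tube_inj: "i < ncomp Y \<Longrightarrow> inj_on (tube Y i) (circle \<times> ball 0 2)"
  using tube_homeomorphism[of i] by (auto intro: inj_on_inverseI dest: homeomorphism_apply1)

lemma tube_continuous: "i < ncomp Y \<Longrightarrow> continuous_on (circle \<times> ball 0 2) (tube Y i)"
  using tube_homeomorphism[of i] by (auto simp: homeomorphism_def)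

lemma tube_eqD:
  assumes "i < ncomp Y" "tube Y i (s, z) = tube Y i (s', z')" "s \<in> circle" "s' \<in> circle" "norm z < 2" "norm z' < 2"
  shows "s = s'" "z = z'"
  using inj_onD[OF tube_inj[OF assms(1)] assms(2)] assms by auto

lemma tube_underlying:
  assumes "i < ncomp Y" shows "tube Y i ` (circle \<times> ball 0 2) \<subseteq> underlying Y"
proof -
  have "openin (top_of_set (underlying Y)) (tube Y i ` (circle \<times> ball 0 2))"
    using orb assms by (simp add: is_link_orbifold_def)
  then show ?thesis by (rule openin_imp_subset)
qed

lemma tubes_disjoint:
  assumes "i < ncomp Y" "j < ncomp Y" "tube Y i (s, z) = tube Y j (s', z')"
    "s \<in> circle" "s' \<in> circle" "norm z < 2" "norm z' < 2"
  shows "i = j"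
proof (rule ccontr)
  assume "i \<noteq> j"
  then have "tube Y i ` (circle \<times> ball 0 2) \<inter> tube Y j ` (circle \<times> ball 0 2) = {}"
    using orb assms(1,2) by (simp add: is_link_orbifold_def)
  moreover have "tube Y i (s, z) \<in> tube Y i ` (circle \<times> ball 0 2)"
    using assms(4,6) by (intro imageI) simp
  moreover have "tube Y i (s, z) \<in> tube Y j ` (circle \<times> ball 0 2)"
    unfolding assms(3) using assms(5,7) by (intro imageI) simp
  ultimately show False by blast
qed

lemma tube_boundary_exterior:
  assumes "i < ncomp Y" "s \<in> circle" "norm z = 1"
  shows "tube Y i (s, z) \<in> exterior Y"
proof -
  have "tube Y i (s, z) \<in> underlying Y" using tube_underlying[OF assms(1)] assms by auto
  moreover have "tube Y i (s, z) \<notin> tube Y j ` (circle \<times> ball 0 1)" if j: "j < ncomp Y" for j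
  proof
    assume "tube Y i (s, z) \<in> tube Y j ` (circle \<times> ball 0 1)"
    then obtain s' z' where *: "tube Y i (s, z) = tube Y j (s', z')" "s' \<in> circle" "norm z' < 1" by auto
    have "i = j" by (rule tubes_disjoint[OF assms(1) j *(1)]) (use * assms in simp_all)
    have "z = z'"
      by (rule tube_eqD(2)[OF assms(1) *(1)[folded \<open>i = j\<close>]]) (use * assms in simp_all)
    then show False using * assms by simp
  qed
  ultimately show ?thesis by (auto simp: exterior_def)
qed

abbreviation "hom_ext \<equiv> homology_group 1 (top_of_set (exterior Y))"

lemma hom_ext_group: "comm_group hom_ext"
  by (rule abelian_homology_group)

lemma meridian_loop:
  assumes "i < ncomp Y"
  shows "loop_class (exterior Y) (meridian Y i) \<in> carrier hom_ext"
proof (rule loop_class_carrier)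
  have "continuous_on {0..1} (tube Y i \<circ> (\<lambda>t. (1, cis (2 * pi * t))))"
    by (rule continuous_on_compose[OF _ continuous_on_subset[OF tube_continuous[OF assms]]])
      (auto intro!: continuous_intros)
  then show "path (meridian Y i)" by (simp add: path_def meridian_def comp_def)
  show "path_image (meridian Y i) \<subseteq> exterior Y"
    using tube_boundary_exterior[OF assms, of 1] by (auto simp: path_image_def meridian_def)
qed (simp add: meridian_def)

lemma meridian_powers_subgroup: "subgroup (meridian_powers Y) hom_ext"
proof -
  interpret Group.comm_group hom_ext by (rule hom_ext_group)
  show ?thesis
    unfolding meridian_powers_def using meridian_loop by (intro generate_is_subgroup) auto
qed

lemma H1orb_group: "comm_group (H1orb Y)"
  unfolding H1orb_def by (rule comm_group.abelian_FactGroup[OF hom_ext_group meridian_powers_subgroup])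

lemma orb_class_carrier:
  assumes "loop_class (exterior Y) \<gamma> \<in> carrier hom_ext" shows "orb_class Y \<gamma> \<in> carrier (H1orb Y)"
  using assms by (auto simp: orb_class_def H1orb_def FactGroup_def RCOSETS_def)

text \<open>Meridian powers are killed in \<open>H1orb Y\<close>, so the meridian has finite order there; in \<open>ord\<close> an infinite
  order would be 0. This makes the power map that models the cover near the core a branched cover
  rather than a constant.\<close>

lemma meridian_order_pos:
  assumes i: "i < ncomp Y" shows "0 < group.ord (H1orb Y) (meridian_class Y i)"
proof -
  interpret K: Group.comm_group hom_ext by (rule hom_ext_group)
  interpret H: Group.comm_group "H1orb Y" by (rule H1orb_group)
  let ?x = "loop_class (exterior Y) (meridian Y i)" and ?N = "meridian_powers Y"
  have N: "?N \<lhd> hom_ext" using meridian_powers_subgroup K.normal_iff_subgroup by blast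
  have q: "group_hom hom_ext (H1orb Y) (\<lambda>x. ?N #>\<^bsub>hom_ext\<^esub> x)"
    using normal.r_coset_hom_Mod[OF N] K.group_axioms H.group_axioms
    by (auto simp: group_hom_def group_hom_axioms_def H1orb_def)
  have "?x [^]\<^bsub>hom_ext\<^esub> ord_at Y i \<in> ?N"
    unfolding meridian_powers_def by (rule generate.incl) (use i in auto)
  then have "?N #>\<^bsub>hom_ext\<^esub> (?x [^]\<^bsub>hom_ext\<^esub> ord_at Y i) = ?N"
    using K.coset_join2[OF _ meridian_powers_subgroup] meridian_loop[OF i] by simp
  then have "meridian_class Y i [^]\<^bsub>H1orb Y\<^esub> ord_at Y i = \<one>\<^bsub>H1orb Y\<^esub>"
    using group_hom.hom_nat_pow[OF q meridian_loop[OF i], of "ord_at Y i"]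
    by (simp add: meridian_class_def orb_class_def H1orb_def FactGroup_def)
  moreover have "meridian_class Y i \<in> carrier (H1orb Y)"
    unfolding meridian_class_def by (rule orb_class_carrier[OF meridian_loop[OF i]])
  moreover have "ord_at Y i \<noteq> 0" using ord_at_ge[OF i] by simp
  ultimately show ?thesis using H.ord_eq_0 by (metis neq0_conv)
qed

end

section \<open>The deck group\<close>

locale abelian_cover = link_orbifold Y for Y :: "'a::t2_space link_orbifold" +
  fixes P :: "('a, 'b::t2_space) orb_cover"
  assumes cov: "is_abelian_orb_cover Y P"
begin

abbreviation "over S \<equiv> total P \<inter> proj P -` S"

lemma proj_continuous: "continuous_on (total P) (proj P)"
  using cov unfolding is_abelian_orb_cover_def by (elim conjE)

lemma deck_continuous: "g \<in> carrier (H1orb Y) \<Longrightarrow> continuous_on (total P) (deck P g)"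
  using cov unfolding is_abelian_orb_cover_def by (elim conjE) simp

lemma deck_over:
  "g \<in> carrier (H1orb Y) \<Longrightarrow> x \<in> total P \<Longrightarrow> deck P g x \<in> total P"
  "g \<in> carrier (H1orb Y) \<Longrightarrow> x \<in> total P \<Longrightarrow> proj P (deck P g x) = proj P x"
  using cov unfolding is_abelian_orb_cover_def by (elim conjE, simp)+

lemma deck_one: "x \<in> total P \<Longrightarrow> deck P \<one>\<^bsub>H1orb Y\<^esub> x = x"
  using cov unfolding is_abelian_orb_cover_def by (elim conjE) simp

lemma deck_mult:
  "g \<in> carrier (H1orb Y) \<Longrightarrow> h \<in> carrier (H1orb Y) \<Longrightarrow> x \<in> total P \<Longrightarrow>
    deck P (g \<otimes>\<^bsub>H1orb Y\<^esub> h) x = deck P g (deck P h x)"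
  using cov unfolding is_abelian_orb_cover_def by (elim conjE) simp

lemma covering_exterior: "covering_space (over (exterior Y)) (proj P) (exterior Y)"
  using cov unfolding is_abelian_orb_cover_def by (elim conjE)

lemma path_connected_exterior: "path_connected (over (exterior Y))"
  using cov unfolding is_abelian_orb_cover_def by (elim conjE)

lemma deck_free_exterior:
  "g \<in> carrier (H1orb Y) \<Longrightarrow> x \<in> over (exterior Y) \<Longrightarrow> deck P g x = x \<Longrightarrow> g = \<one>\<^bsub>H1orb Y\<^esub>"
  using cov unfolding is_abelian_orb_cover_def by (elim conjE) blast

lemma monodromy:
  assumes "path \<gamma>" "path_image \<gamma> \<subseteq> over (exterior Y)" "proj P (pathstart \<gamma>) = proj P (pathfinish \<gamma>)"
  shows "pathfinish \<gamma> = deck P (orb_class Y (proj P \<circ> \<gamma>)) (pathstart \<gamma>)"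
  using cov assms unfolding is_abelian_orb_cover_def by (elim conjE) blast

text \<open>The local form of the cover over a solid torus, near the meridian disc at \<open>s\<close>: a disjoint union of
  copies of a product of an arc and a disc, on each of which the cover is a power map on the disc.\<close>

definition branched_product :: "nat \<Rightarrow> complex \<Rightarrow> bool" where
  "branched_product i s \<longleftrightarrow> (\<exists>A. s \<in> A \<and> openin (top_of_set circle) A \<and>
        (\<exists>\<V>. \<Union>\<V> = over (tube Y i ` (A \<times> cball 0 1)) \<and>
           pairwise disjnt \<V> \<and>
           (\<forall>V\<in>\<V>. openin (top_of_set (over (solid_torus Y i))) V \<and>
              (\<exists>f g. homeomorphism (A \<times> cball 0 1) V f g \<and>
                 (\<forall>t\<in>A. \<forall>z\<in>cball 0 1. proj P (f (t, z)) =
                    tube Y i (t, z ^ group.ord (H1orb Y) (meridian_class Y i)))))))"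

lemma solid_torus_model:
  assumes "i < ncomp Y" "s \<in> circle" shows "branched_product i s"
proof -
  have "\<forall>i<ncomp Y. \<forall>s\<in>circle. branched_product i s"
    using cov unfolding is_abelian_orb_cover_def branched_product_def by (elim conjE)
  then show ?thesis using assms by blast
qed

text \<open>A sheet through \<open>x\<close>, in its product coordinates. As the coordinates in the solid torus
  are unique, \<open>x\<close> itself has first coordinate \<open>s\<close>, and its second coordinate is an \<open>m\<close>-th root of \<open>z\<close>.\<close>

lemma chart_at:
  assumes i: "i < ncomp Y" and x: "x \<in> total P" "proj P x = tube Y i (s, z)" and s: "s \<in> circle"
    and z: "norm z \<le> 1"
  obtains A V f g u where "s \<in> A" "A \<subseteq> circle" "homeomorphism (A \<times> cball 0 1) V f g"
    "openin (top_of_set (over (solid_torus Y i))) V" "x = f (s, u)" "norm u \<le> 1"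
    "u ^ group.ord (H1orb Y) (meridian_class Y i) = z"
    "\<And>t z. t \<in> A \<Longrightarrow> norm z \<le> 1 \<Longrightarrow> f (t, z) \<in> total P \<and>
      proj P (f (t, z)) = tube Y i (t, z ^ group.ord (H1orb Y) (meridian_class Y i))"
proof -
  let ?m = "group.ord (H1orb Y) (meridian_class Y i)"
  obtain A \<V> where A: "s \<in> A" "openin (top_of_set circle) A"
    and V: "\<Union>\<V> = over (tube Y i ` (A \<times> cball 0 1))"
    and loc: "\<And>V. V \<in> \<V> \<Longrightarrow> openin (top_of_set (over (solid_torus Y i))) V \<and>
              (\<exists>f g. homeomorphism (A \<times> cball 0 1) V f g \<and>
                 (\<forall>t\<in>A. \<forall>z\<in>cball 0 1. proj P (f (t, z)) = tube Y i (t, z ^ ?m)))"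
    using solid_torus_model[OF i s] unfolding branched_product_def by (elim exE conjE) (rule that, assumption+, erule bspec)
  have "proj P x \<in> tube Y i ` (A \<times> cball 0 1)" unfolding x(2) using A(1) z by (intro imageI) simp
  then have "x \<in> \<Union>\<V>" using x(1) unfolding V by simp
  then obtain V where xV: "x \<in> V" "V \<in> \<V>" by (elim UnionE)
  obtain f g where f: "homeomorphism (A \<times> cball 0 1) V f g"
    and pf: "\<And>t z. t \<in> A \<Longrightarrow> z \<in> cball 0 1 \<Longrightarrow> proj P (f (t, z)) = tube Y i (t, z ^ ?m)"
    using loc[OF xV(2)] by (elim exE conjE) blast
  have AC: "A \<subseteq> circle" using openin_imp_subset[OF A(2)] .
  have VV: "V \<subseteq> total P" using xV(2) V by blast
  have im: "f ` (A \<times> cball 0 1) = V" using f by (rule homeomorphism_image1)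
  obtain t u where tu: "t \<in> A" "u \<in> cball 0 1" "x = f (t, u)" using xV(1) im by auto
  have u: "norm u \<le> 1" using tu(2) by simp
  then have "norm (u ^ ?m) \<le> 1" by (simp add: norm_power power_le_one)
  have "tube Y i (t, u ^ ?m) = tube Y i (s, z)" using pf[OF tu(1,2)] tu(3) x(2) by simp
  then have eq: "t = s" "u ^ ?m = z"
    using tube_eqD[OF i _ _ s, of t "u ^ ?m" z] tu(1) AC \<open>norm (u ^ ?m) \<le> 1\<close> z by (auto simp: subset_eq)
  have "f (t, z) \<in> total P \<and> proj P (f (t, z)) = tube Y i (t, z ^ ?m)" if "t \<in> A" "norm z \<le> 1" for t z
  proof
    have "f (t, z) \<in> V" unfolding im[symmetric] using that by (intro imageI) simp
    then show "f (t, z) \<in> total P" using VV by (rule rev_subsetD)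
  qed (use pf that in simp)
  then show thesis
    using that[OF A(1) AC f conjunct1[OF loc[OF xV(2)]] _ u eq(2)] tu(3) eq(1) by simp
qed

lemma image_TimesD: "w \<in> f ` (A \<times> B) \<Longrightarrow> \<exists>t\<in>A. \<exists>v\<in>B. w = f (t, v)"
  by blast

lemma power_locally_injective:
  assumes "u \<noteq> (0::complex)" "0 < m"
  shows "\<exists>W. open W \<and> u \<in> W \<and> inj_on (\<lambda>z. z ^ m) W"
proof -
  have "covering_space (- {0::complex}) (\<lambda>z. z ^ m) (- {0})"
    by (rule covering_space_power_punctured_plane[OF assms(2)])
  moreover have "u ^ m \<in> - {0}" using assms by simp
  ultimately obtain T v where T: "u ^ m \<in> T" "\<Union> v = - {0} \<inter> (\<lambda>z. z ^ m) -` T"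
    "\<And>U. U \<in> v \<Longrightarrow> openin (top_of_set (- {0})) U \<and> (\<exists>q. homeomorphism U T (\<lambda>z. z ^ m) q)"
    unfolding covering_space_def by (metis (no_types, lifting))
  have "u \<in> \<Union> v" using T(1,2) assms by simp
  then obtain W where W: "u \<in> W" "W \<in> v" by (elim UnionE)
  then obtain q where q: "homeomorphism W T (\<lambda>z. z ^ m) q" using T(3) by blast
  have "open W" using conjunct1[OF T(3)[OF W(2)]] by (rule openin_open_trans) (simp add: open_Compl)
  moreover have "inj_on (\<lambda>z. z ^ m) W" using homeomorphism_apply1[OF q] by (auto intro: inj_on_inverseI)
  ultimately show ?thesis using W(1) by (intro exI[of _ W] conjI)
qed

lemma proj_locally_injective_exterior: "locally_inj_on (proj P) (over (exterior Y))"
  unfolding locally_inj_on_def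
proof
  fix x assume x: "x \<in> over (exterior Y)"
  have "\<forall>y\<in>exterior Y. \<exists>T. y \<in> T \<and> openin (top_of_set (exterior Y)) T \<and>
      (\<exists>v. \<Union> v = over (exterior Y) \<inter> proj P -` T \<and>
        (\<forall>u\<in>v. openin (top_of_set (over (exterior Y))) u) \<and> disjoint v \<and>
        (\<forall>u\<in>v. \<exists>q. homeomorphism u T (proj P) q))"
    using covering_exterior unfolding covering_space_def by (elim conjE)
  moreover have "proj P x \<in> exterior Y" using x by simp
  ultimately have "\<exists>T. proj P x \<in> T \<and> openin (top_of_set (exterior Y)) T \<and>
      (\<exists>v. \<Union> v = over (exterior Y) \<inter> proj P -` T \<and>
        (\<forall>u\<in>v. openin (top_of_set (over (exterior Y))) u) \<and> disjoint v \<and>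
        (\<forall>u\<in>v. \<exists>q. homeomorphism u T (proj P) q))"
    by (rule bspec)
  then obtain T v where T: "proj P x \<in> T" "\<Union> v = over (exterior Y) \<inter> proj P -` T"
    "\<forall>u\<in>v. openin (top_of_set (over (exterior Y))) u"
    "\<forall>u\<in>v. \<exists>q. homeomorphism u T (proj P) q"
    by (elim exE conjE) (rule that)
  have "x \<in> \<Union> v" using T(1,2) x by simp
  then obtain U where U: "x \<in> U" "U \<in> v" by (elim UnionE)
  then obtain q where "homeomorphism U T (proj P) q" using T(4) by (elim ballE[of _ _ U] exE) auto
  then have "inj_on (proj P) U" by (auto intro: inj_on_inverseI dest: homeomorphism_apply1)
  then show "\<exists>U. openin (top_of_set (over (exterior Y))) U \<and> x \<in> U \<and> inj_on (proj P) U"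
    using bspec[OF T(3) U(2)] U(1) by (intro exI[of _ U] conjI)
qed

text \<open>Off the core, the power map in a chart is locally injective.\<close>

lemma proj_locally_injective_torus:
  assumes i: "i < ncomp Y"
  shows "locally_inj_on (proj P) (over (tube Y i ` (circle \<times> (cball 0 1 - {0}))))"
  unfolding locally_inj_on_def
proof
  let ?E = "over (tube Y i ` (circle \<times> (cball 0 1 - {0})))" and ?m = "group.ord (H1orb Y) (meridian_class Y i)"
  fix x assume x: "x \<in> ?E"
  then obtain w where w: "proj P x = tube Y i w" "w \<in> circle \<times> (cball 0 1 - {0})" "x \<in> total P" by blast
  obtain s z where "w = (s, z)" by (cases w)
  then have sz: "proj P x = tube Y i (s, z)" "s \<in> circle" "norm z \<le> 1" "z \<noteq> 0" "x \<in> total P"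
    using w by simp_all
  obtain A V f g u where ch: "s \<in> A" "A \<subseteq> circle" "homeomorphism (A \<times> cball 0 1) V f g"
    "openin (top_of_set (over (solid_torus Y i))) V" "x = f (s, u)" "norm u \<le> 1" "u ^ ?m = z"
    and pf: "\<And>t z. t \<in> A \<Longrightarrow> norm z \<le> 1 \<Longrightarrow> f (t, z) \<in> total P \<and> proj P (f (t, z)) = tube Y i (t, z ^ ?m)"
    by (rule chart_at[OF i sz(5,1,2,3)]) (rule that)
  have "u \<noteq> 0" using ch(7) sz(4) meridian_order_pos[OF i] by (auto simp: power_0_left)
  then obtain W where W: "open W" "u \<in> W" "inj_on (\<lambda>z. z ^ ?m) W"
    using power_locally_injective meridian_order_pos[OF i] by blast
  have im: "f ` (A \<times> cball 0 1) = V" using ch(3) by (rule homeomorphism_image1)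
  let ?D = "A \<times> (cball 0 1 \<inter> W)"
  have "openin (top_of_set (A \<times> cball 0 1)) ?D"
    using W(1) by (intro openin_Times) (auto intro: openin_open_Int)
  then have "openin (top_of_set V) (f ` ?D)"
    by (rule homeomorphism_imp_open_map[OF ch(3)])
  then have o: "openin (top_of_set (over (solid_torus Y i))) (f ` ?D)"
    using ch(4) by (rule openin_trans)
  have sub: "?E \<subseteq> over (solid_torus Y i)" by (auto simp: solid_torus_def)
  have "openin (top_of_set ?E) (?E \<inter> f ` ?D)"
    using openin_subtopology_Int2[OF o, of ?E] sub by (simp add: subtopology_subtopology Int_absorb1)
  moreover have "x \<in> ?E \<inter> f ` ?D"
    using x unfolding ch(5) using ch(1,6) W(2) by auto
  moreover have "inj_on (proj P) (?E \<inter> f ` ?D)"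
  proof (rule inj_onI)
    fix y y' assume y: "y \<in> ?E \<inter> f ` ?D" "y' \<in> ?E \<inter> f ` ?D" and eq: "proj P y = proj P y'"
    obtain t v where "t \<in> A" "v \<in> cball 0 1 \<inter> W" "y = f (t, v)"
      using image_TimesD[OF IntD2[OF y(1)]] by blast
    then have tv: "t \<in> A" "norm v \<le> 1" "v \<in> W" "y = f (t, v)" by simp_all
    obtain t' v' where "t' \<in> A" "v' \<in> cball 0 1 \<inter> W" "y' = f (t', v')"
      using image_TimesD[OF IntD2[OF y(2)]] by blast
    then have tv': "t' \<in> A" "norm v' \<le> 1" "v' \<in> W" "y' = f (t', v')" by simp_all
    have eqt: "tube Y i (t, v ^ ?m) = tube Y i (t', v' ^ ?m)"
      using eq pf[OF tv(1,2)] pf[OF tv'(1,2)] tv(4) tv'(4) by simp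
    have n: "norm (v ^ ?m) < 2" "norm (v' ^ ?m) < 2"
      using power_le_one[of "norm v" ?m] power_le_one[of "norm v'" ?m] tv(2) tv'(2) by (simp_all add: norm_power)
    note eqs = tube_eqD[OF i eqt subsetD[OF ch(2) tv(1)] subsetD[OF ch(2) tv'(1)] n]
    show "y = y'" using inj_onD[OF W(3) eqs(2) tv(3) tv'(3)] eqs(1) tv(4) tv'(4) by simp
  qed
  ultimately show "\<exists>U. openin (top_of_set ?E) U \<and> x \<in> U \<and> inj_on (proj P) U" by blast
qed

text \<open>The projection branches along the core, but its restriction to the preimage of the core is injective
  in each chart, since the only root of 0 is 0.\<close>

lemma proj_locally_injective_core:
  assumes i: "i < ncomp Y"
  shows "locally_inj_on (proj P) (over (tube Y i ` (circle \<times> {0})))"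
  unfolding locally_inj_on_def
proof
  let ?E = "over (tube Y i ` (circle \<times> {0}))" and ?m = "group.ord (H1orb Y) (meridian_class Y i)"
  fix x assume x: "x \<in> ?E"
  then obtain s where sz: "proj P x = tube Y i (s, 0)" "s \<in> circle" "x \<in> total P" by blast
  obtain A V f g u where ch: "s \<in> A" "A \<subseteq> circle" "homeomorphism (A \<times> cball 0 1) V f g"
    "openin (top_of_set (over (solid_torus Y i))) V" "x = f (s, u)" "norm u \<le> 1" "u ^ ?m = 0"
    and pf: "\<And>t z. t \<in> A \<Longrightarrow> norm z \<le> 1 \<Longrightarrow> f (t, z) \<in> total P \<and> proj P (f (t, z)) = tube Y i (t, z ^ ?m)"
    by (rule chart_at[OF i sz(3,1,2)]) (simp, rule that)
  have im: "f ` (A \<times> cball 0 1) = V" using ch(3) by (rule homeomorphism_image1)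
  have sub: "?E \<subseteq> over (solid_torus Y i)" by (auto simp: solid_torus_def)
  have "openin (top_of_set ?E) (?E \<inter> V)"
    using openin_subtopology_Int2[OF ch(4), of ?E] sub by (simp add: subtopology_subtopology Int_absorb1)
  moreover have "x \<in> ?E \<inter> V"
    using x unfolding ch(5) im[symmetric] using ch(1,6) by auto
  moreover have "inj_on (proj P) (?E \<inter> V)"
  proof (rule inj_onI)
    fix y y' assume y: "y \<in> ?E \<inter> V" "y' \<in> ?E \<inter> V" and eq: "proj P y = proj P y'"
    have model: "\<exists>t\<in>A. w = f (t, 0) \<and> proj P w = tube Y i (t, 0)" if w: "w \<in> ?E \<inter> V" for w
    proof -
      obtain t v where tv: "t \<in> A" "norm v \<le> 1" "w = f (t, v)" using w im by auto
      obtain t' where t': "t' \<in> circle" "proj P w = tube Y i (t', 0)" using w by auto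
      have "tube Y i (t, v ^ ?m) = tube Y i (t', 0)" using pf[OF tv(1,2)] tv(3) t' by simp
      then have "v ^ ?m = 0"
        using tube_eqD(2)[OF i, of t "v ^ ?m" t' 0] t'(1) tv ch(2) power_le_one[of "norm v" ?m]
        by (auto simp: norm_power subset_eq)
      then have "v = 0" by simp
      then show ?thesis using tv pf[OF tv(1,2)] meridian_order_pos[OF i] by (auto simp: power_0_left)
    qed
    obtain t t' where t: "t \<in> A" "y = f (t, 0)" "proj P y = tube Y i (t, 0)"
      and t': "t' \<in> A" "y' = f (t', 0)" "proj P y' = tube Y i (t', 0)"
      using model[OF y(1)] model[OF y(2)] by blast
    then have "t = t'" using tube_eqD(1)[OF i, of t 0 t' 0] eq ch(2) by (auto simp: subset_eq)
    then show "y = y'" using t t' by simp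
  qed
  ultimately show "\<exists>U. openin (top_of_set ?E) U \<and> x \<in> U \<and> inj_on (proj P) U" by blast
qed

text \<open>A path in the cover between the two points projects to a loop, whose class takes one to the other.\<close>

lemma deck_transitive_exterior:
  assumes x: "x \<in> total P" "y \<in> total P" "proj P x = proj P y" "proj P x \<in> exterior Y"
  shows "\<exists>g\<in>carrier (H1orb Y). deck P g x = y"
proof -
  obtain \<gamma> where \<gamma>: "path \<gamma>" "path_image \<gamma> \<subseteq> over (exterior Y)" "pathstart \<gamma> = x" "pathfinish \<gamma> = y"
    using path_connected_exterior x unfolding path_connected_def by fastforce
  have "path (proj P \<circ> \<gamma>)"
    using \<gamma>(1,2) by (intro path_continuous_image continuous_on_subset[OF proj_continuous]) auto
  moreover have "path_image (proj P \<circ> \<gamma>) \<subseteq> exterior Y"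
    using \<gamma>(2) by (auto simp: path_image_compose)
  moreover have "(proj P \<circ> \<gamma>) 0 = (proj P \<circ> \<gamma>) 1"
    using \<gamma>(3,4) x(3) by (simp add: pathstart_def pathfinish_def)
  ultimately have "orb_class Y (proj P \<circ> \<gamma>) \<in> carrier (H1orb Y)"
    by (intro orb_class_carrier loop_class_carrier)
  moreover have "y = deck P (orb_class Y (proj P \<circ> \<gamma>)) x"
    using monodromy[OF \<gamma>(1,2)] \<gamma>(3,4) x(3) by simp
  ultimately show ?thesis by auto
qed

text \<open>The two points are moved radially, in their charts, to points over the same point of the boundary
  torus. Some deck transformation relates these, and uniqueness of lifts along the radius carries this
  back to the given points, as a limit if they lie over the core.\<close>

lemma deck_transitive_torus:
  assumes i: "i < ncomp Y" and x: "x \<in> total P" "y \<in> total P" "proj P x = proj P y"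
    and sz: "proj P x = tube Y i (s, z)" "s \<in> circle" "norm z \<le> 1"
  shows "\<exists>g\<in>carrier (H1orb Y). deck P g x = y"
proof -
  let ?E = "over (tube Y i ` (circle \<times> (cball 0 1 - {0})))" and ?m = "group.ord (H1orb Y) (meridian_class Y i)"
  have m: "0 < ?m" by (rule meridian_order_pos[OF i])
  obtain A V f g u where ch: "s \<in> A" "A \<subseteq> circle" "homeomorphism (A \<times> cball 0 1) V f g"
    "openin (top_of_set (over (solid_torus Y i))) V" "x = f (s, u)" "norm u \<le> 1" "u ^ ?m = z"
    and pf: "\<And>t z. t \<in> A \<Longrightarrow> norm z \<le> 1 \<Longrightarrow> f (t, z) \<in> total P \<and> proj P (f (t, z)) = tube Y i (t, z ^ ?m)"
    by (rule chart_at[OF i x(1) sz]) (rule that)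
  obtain A' V' f' g' u' where ch': "s \<in> A'" "A' \<subseteq> circle" "homeomorphism (A' \<times> cball 0 1) V' f' g'"
    "openin (top_of_set (over (solid_torus Y i))) V'" "y = f' (s, u')" "norm u' \<le> 1" "u' ^ ?m = z"
    and pf': "\<And>t z. t \<in> A' \<Longrightarrow> norm z \<le> 1 \<Longrightarrow> f' (t, z) \<in> total P \<and> proj P (f' (t, z)) = tube Y i (t, z ^ ?m)"
    by (rule chart_at[OF i x(2) sz(1)[unfolded x(3)] sz(2,3)]) (rule that)
  have "norm u ^ ?m = norm u' ^ ?m" using ch(7) ch'(7) by (metis norm_power)
  then have nu: "norm u = norm u'" using power_eq_imp_eq_base[of "norm u" ?m "norm u'"] m by simp
  define \<rho> where "\<rho> = norm u"
  have \<rho>: "0 \<le> \<rho>" "\<rho> \<le> 1" using ch(6) by (auto simp: \<rho>_def)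
  \<comment> \<open>The directions of the two radii. Over the core they are arbitrary, up to having the same power.\<close>
  obtain v v' where v: "norm v = 1" "u = of_real \<rho> * v" "norm v' = 1" "u' = of_real \<rho> * v'" "v ^ ?m = v' ^ ?m"
  proof (cases "\<rho> = 0")
    case True
    then have "u = 0" "u' = 0" using nu by (auto simp: \<rho>_def)
    then show thesis using that[of 1 1] True by simp
  next
    case False
    have "(u / of_real \<rho>) ^ ?m = (u' / of_real \<rho>) ^ ?m" using ch(7) ch'(7) by (simp add: power_divide)
    then show thesis
      using that[of "u / of_real \<rho>" "u' / of_real \<rho>"] False nu by (simp add: \<rho>_def norm_divide)
  qed
  \<comment> \<open>The paths start at the boundary torus, so that they can run into the core only at the end.\<close>
  define r where "r \<tau> = 1 - \<tau> + \<tau> * \<rho>" for \<tau>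
  have r: "0 \<le> r \<tau>" "r \<tau> \<le> 1" if "\<tau> \<in> {0..1}" for \<tau>
    using that \<rho> mult_left_mono[of \<rho> 1 \<tau>] by (auto simp: r_def)
  have r_pos: "0 < r \<tau>" if "\<tau> \<in> {0..<1}" for \<tau>
    using that \<rho> by (auto simp: r_def intro!: add_pos_nonneg)
  define \<alpha> where "\<alpha> \<tau> = f (s, of_real (r \<tau>) * v)" for \<tau>
  define \<beta> where "\<beta> \<tau> = f' (s, of_real (r \<tau>) * v')" for \<tau>
  have nr: "norm (of_real (r \<tau>) * v) = r \<tau>" "norm (of_real (r \<tau>) * v') = r \<tau>" if "\<tau> \<in> {0..1}" for \<tau>
    using v r[OF that] by (simp_all add: norm_mult)
  have \<alpha>: "\<alpha> \<tau> \<in> total P" "proj P (\<alpha> \<tau>) = tube Y i (s, of_real (r \<tau>) ^ ?m * v ^ ?m)" if "\<tau> \<in> {0..1}" for \<tau>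
    using pf[OF ch(1), of "of_real (r \<tau>) * v"] nr[OF that] r[OF that] by (simp_all add: \<alpha>_def power_mult_distrib)
  have \<beta>: "\<beta> \<tau> \<in> total P" "proj P (\<beta> \<tau>) = tube Y i (s, of_real (r \<tau>) ^ ?m * v ^ ?m)" if "\<tau> \<in> {0..1}" for \<tau>
    using pf'[OF ch'(1), of "of_real (r \<tau>) * v'"] nr[OF that] r[OF that] v(5)
    by (simp_all add: \<beta>_def power_mult_distrib)
  have c\<alpha>: "continuous_on {0..1} \<alpha>"
    unfolding \<alpha>_def
  proof (rule continuous_on_compose2[OF homeomorphism_cont1[OF ch(3)]])
    show "continuous_on {0..1} (\<lambda>\<tau>. (s, of_real (r \<tau>) * v))"
      unfolding r_def by (intro continuous_intros)
  qed (use nr r ch(1) in auto)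
  have c\<beta>: "continuous_on {0..1} \<beta>"
    unfolding \<beta>_def
  proof (rule continuous_on_compose2[OF homeomorphism_cont1[OF ch'(3)]])
    show "continuous_on {0..1} (\<lambda>\<tau>. (s, of_real (r \<tau>) * v'))"
      unfolding r_def by (intro continuous_intros)
  qed (use nr r ch'(1) in auto)
  have "proj P (\<alpha> 0) \<in> exterior Y"
    unfolding \<alpha>(2)[of 0, simplified] using v(1) sz(2)
    by (intro tube_boundary_exterior[OF i]) (auto simp: r_def norm_power)
  then obtain h where h: "h \<in> carrier (H1orb Y)" "deck P h (\<alpha> 0) = \<beta> 0"
    using deck_transitive_exterior[of "\<alpha> 0" "\<beta> 0"] \<alpha>[of 0] \<beta>[of 0] by auto
  have "(deck P h \<circ> \<alpha>) 1 = \<beta> 1"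
  proof (rule lifts_of_path_agree[where p = "proj P" and E = ?E])
    show "continuous_on {0..1} (deck P h \<circ> \<alpha>)"
      using \<alpha>(1) by (intro continuous_on_compose[OF c\<alpha>] continuous_on_subset[OF deck_continuous[OF h(1)]]) blast
    have inE: "tube Y i (s, of_real (r \<tau>) ^ ?m * v ^ ?m) \<in> tube Y i ` (circle \<times> (cball 0 1 - {0}))"
      if "\<tau> \<in> {0..<1}" for \<tau>
    proof -
      have "norm (of_real (r \<tau>) ^ ?m * v ^ ?m) = r \<tau> ^ ?m"
        using v(1) r_pos[OF that] by (simp add: norm_mult norm_power)
      moreover have "r \<tau> ^ ?m \<le> 1" using r[of \<tau>] that by (intro power_le_one) auto
      moreover have "of_real (r \<tau>) ^ ?m * v ^ ?m \<noteq> 0" using r_pos[OF that] v(1) by auto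
      ultimately show ?thesis using sz(2) by (intro imageI) auto
    qed
    show "(deck P h \<circ> \<alpha>) \<tau> \<in> ?E" "\<beta> \<tau> \<in> ?E" if "\<tau> \<in> {0..<1}" for \<tau>
    proof -
      have t: "\<tau> \<in> {0..1}" using that by simp
      show "(deck P h \<circ> \<alpha>) \<tau> \<in> ?E"
        using deck_over[OF h(1) \<alpha>(1)[OF t]] inE[OF that] \<alpha>(2)[OF t] by simp
      show "\<beta> \<tau> \<in> ?E" using inE[OF that] \<beta>[OF t] by simp
    qed
    show "proj P ((deck P h \<circ> \<alpha>) \<tau>) = proj P (\<beta> \<tau>)" if "\<tau> \<in> {0..1}" for \<tau>
      using deck_over(2)[OF h(1) \<alpha>(1)[OF that]] \<alpha>(2)[OF that] \<beta>(2)[OF that] by simp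
  qed (use h(2) c\<beta> proj_locally_injective_torus[OF i] in simp_all)
  moreover have "\<alpha> 1 = x" "\<beta> 1 = y" using v ch(5) ch'(5) by (simp_all add: \<alpha>_def \<beta>_def r_def)
  ultimately show ?thesis using h(1) by auto
qed

text \<open>A deck transformation that fixes \<open>x\<close> also fixes the lift of the radius from \<open>x\<close> outwards, hence a point
  over the boundary torus, where the action is free.\<close>

lemma deck_free_torus:
  assumes i: "i < ncomp Y" and x: "x \<in> total P"
    and sz: "proj P x = tube Y i (s, z)" "s \<in> circle" "norm z \<le> 1" "z \<noteq> 0"
    and h: "h \<in> carrier (H1orb Y)" "deck P h x = x"
  shows "h = \<one>\<^bsub>H1orb Y\<^esub>"
proof -
  let ?E = "over (tube Y i ` (circle \<times> (cball 0 1 - {0})))" and ?m = "group.ord (H1orb Y) (meridian_class Y i)"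
  have m: "0 < ?m" by (rule meridian_order_pos[OF i])
  obtain A V f g u where ch: "s \<in> A" "A \<subseteq> circle" "homeomorphism (A \<times> cball 0 1) V f g"
    "openin (top_of_set (over (solid_torus Y i))) V" "x = f (s, u)" "norm u \<le> 1" "u ^ ?m = z"
    and pf: "\<And>t z. t \<in> A \<Longrightarrow> norm z \<le> 1 \<Longrightarrow> f (t, z) \<in> total P \<and> proj P (f (t, z)) = tube Y i (t, z ^ ?m)"
    by (rule chart_at[OF i x sz(1,2,3)]) (rule that)
  have "u \<noteq> 0" using ch(7) sz(4) m by (auto simp: power_0_left)
  \<comment> \<open>The factor grows from 1 to the one that takes \<open>u\<close> to the unit circle.\<close>
  define r where "r \<tau> = 1 - \<tau> + \<tau> / norm u" for \<tau>
  define \<alpha> where "\<alpha> \<tau> = f (s, of_real (r \<tau>) * u)" for \<tau>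
  have ru: "r \<tau> * norm u = (1 - \<tau>) * norm u + \<tau>" for \<tau> using \<open>u \<noteq> 0\<close> by (simp add: r_def distrib_right)
  have r: "0 < r \<tau>" "r \<tau> * norm u \<le> 1" if "\<tau> \<in> {0..1}" for \<tau>
  proof -
    show "r \<tau> * norm u \<le> 1"
      unfolding ru using that ch(6) mult_left_mono[of "norm u" 1 "1 - \<tau>"] by auto
    have "0 < (1 - \<tau>) * norm u + \<tau>"
      using that \<open>u \<noteq> 0\<close> by (cases "\<tau> = 0") (auto intro!: add_nonneg_pos)
    then show "0 < r \<tau>" unfolding ru[symmetric] using zero_less_mult_pos2[of "r \<tau>" "norm u"] \<open>u \<noteq> 0\<close> by simp
  qed
  have nr: "norm (of_real (r \<tau>) * u) \<le> 1" if "\<tau> \<in> {0..1}" for \<tau>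
    using r[OF that] by (simp add: norm_mult)
  have \<alpha>: "\<alpha> \<tau> \<in> total P" "proj P (\<alpha> \<tau>) = tube Y i (s, (of_real (r \<tau>) * u) ^ ?m)" if "\<tau> \<in> {0..1}" for \<tau>
    using pf[OF ch(1) nr[OF that]] by (simp_all add: \<alpha>_def)
  have inE: "\<alpha> \<tau> \<in> ?E" if "\<tau> \<in> {0..1}" for \<tau>
  proof -
    have "norm ((of_real (r \<tau>) * u) ^ ?m) \<le> 1"
      using power_le_one[OF _ nr[OF that]] by (simp add: norm_power)
    moreover have "(of_real (r \<tau>) * u) ^ ?m \<noteq> 0" using r(1)[OF that] \<open>u \<noteq> 0\<close> by simp
    ultimately have "tube Y i (s, (of_real (r \<tau>) * u) ^ ?m) \<in> tube Y i ` (circle \<times> (cball 0 1 - {0}))"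
      using sz(2) by (intro imageI) auto
    then show ?thesis using \<alpha>[OF that] by simp
  qed
  have c\<alpha>: "continuous_on {0..1} \<alpha>"
    unfolding \<alpha>_def
  proof (rule continuous_on_compose2[OF homeomorphism_cont1[OF ch(3)]])
    show "continuous_on {0..1} (\<lambda>\<tau>. (s, of_real (r \<tau>) * u))"
      unfolding r_def divide_inverse by (intro continuous_intros)
  qed (use nr ch(1) in auto)
  have "(deck P h \<circ> \<alpha>) 1 = \<alpha> 1"
  proof (rule lifts_of_path_agree[where p = "proj P" and E = ?E])
    show "continuous_on {0..1} (deck P h \<circ> \<alpha>)"
      using \<alpha>(1) by (intro continuous_on_compose[OF c\<alpha>] continuous_on_subset[OF deck_continuous[OF h(1)]]) blast
    show "(deck P h \<circ> \<alpha>) \<tau> \<in> ?E" "\<alpha> \<tau> \<in> ?E" if "\<tau> \<in> {0..<1}" for \<tau>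
      using deck_over[OF h(1)] inE[of \<tau>] that by auto
    show "proj P ((deck P h \<circ> \<alpha>) \<tau>) = proj P (\<alpha> \<tau>)" if "\<tau> \<in> {0..1}" for \<tau>
      using deck_over(2)[OF h(1) \<alpha>(1)[OF that]] by simp
    show "(deck P h \<circ> \<alpha>) 0 = \<alpha> 0" using h(2) ch(5) by (simp add: \<alpha>_def r_def)
  qed (use c\<alpha> proj_locally_injective_torus[OF i] in simp_all)
  moreover have "\<alpha> 1 \<in> over (exterior Y)"
  proof -
    have "norm ((of_real (r 1) * u) ^ ?m) = 1"
      using \<open>u \<noteq> 0\<close> by (simp add: r_def norm_power norm_mult norm_divide)
    then show ?thesis using \<alpha>[of 1] tube_boundary_exterior[OF i sz(2)] by simp
  qed
  ultimately show ?thesis using deck_free_exterior[OF h(1), of "\<alpha> 1"] by simp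
qed

end

section \<open>Lifts of a cell are translates of each other\<close>

lemma tube_cells_cover:
  assumes "s \<in> circle" "norm z \<le> 1" shows "\<exists>n A. (n, A) \<in> tube_cells \<and> (s, z) \<in> A"
proof -
  define S where "S = circle - {1::complex}"
  define I where "I = complex_of_real ` {0<..<1}"
  define B where "B = ball 0 1 - complex_of_real ` {0..<1}"
  have tc: "tube_cells = {(0, {(1, 1)}), (1, S \<times> {1}), (1, {1} \<times> S), (2, S \<times> S),
      (0, {(1, 0)}), (1, {1} \<times> I), (1, S \<times> {0}), (2, S \<times> I), (2, {1} \<times> B), (3, S \<times> B)}"
    by (simp add: tube_cells_def Let_def S_def I_def B_def)
  have s: "s = 1 \<or> s \<in> S" using assms by (simp add: S_def)
  have z: "z = 1 \<or> z \<in> S \<or> z = 0 \<or> z \<in> I \<or> z \<in> B"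
  proof (cases "norm z = 1")
    case True then show ?thesis by (simp add: S_def)
  next
    case False
    then have n: "norm z < 1" using assms by simp
    show ?thesis
    proof (cases "z \<in> complex_of_real ` {0..<1}")
      case True
      then obtain x where "z = complex_of_real x" "0 \<le> x" "x < 1" by auto
      then show ?thesis by (cases "x = 0") (simp_all add: I_def)
    next
      case False then show ?thesis using n by (simp add: B_def)
    qed
  qed
  have "(s, z) \<in> \<Union> (snd ` tube_cells)" unfolding tc using s z by auto
  then show ?thesis by force
qed

lemma tube_cells_cases:
  assumes "(n, A) \<in> tube_cells"
  shows "A = {(1, 0)} \<or> A = (circle - {1}) \<times> {0} \<or> A \<subseteq> circle \<times> (cball 0 1 - {0})"
proof -
  define S where "S = circle - {1::complex}"
  define I where "I = complex_of_real ` {0<..<1}"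
  define B where "B = ball 0 1 - complex_of_real ` {0..<1}"
  have tc: "tube_cells = {(0, {(1, 1)}), (1, S \<times> {1}), (1, {1} \<times> S), (2, S \<times> S),
      (0, {(1, 0)}), (1, {1} \<times> I), (1, S \<times> {0}), (2, S \<times> I), (2, {1} \<times> B), (3, S \<times> B)}"
    by (simp add: tube_cells_def Let_def S_def I_def B_def)
  let ?C = "cball 0 1 - {0::complex}"
  have zero: "0 \<in> complex_of_real ` {0..<1}" by (auto intro!: image_eqI[of _ _ 0])
  have sub: "S \<subseteq> circle" "{1} \<subseteq> circle" "S \<subseteq> ?C" "I \<subseteq> ?C" "B \<subseteq> ?C" "{1} \<subseteq> ?C"
    using zero by (auto simp: S_def I_def B_def)
  have one: "{(1, 1)} = {1::complex} \<times> {1::complex}" by simp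
  have "A = {(1, 0)} \<or> A = S \<times> {0} \<or> A \<subseteq> circle \<times> ?C"
    using assms unfolding tc insert_iff prod.inject empty_iff one
    by (elim disjE conjE FalseE; hypsubst)
      (((rule disjI1, rule refl) | (rule disjI2, rule disjI1, rule refl)
        | (rule disjI2, rule disjI2, rule Sigma_mono, rule sub, rule sub))+)
  then show ?thesis unfolding S_def .
qed

lemma standard_simplex_0: "standard_simplex 0 = {start_vertex}"
  by (auto simp: standard_simplex_def start_vertex_def fun_eq_iff)

lemma start_vertex_simplex: "start_vertex \<in> standard_simplex n"
  by (auto simp: standard_simplex_def start_vertex_def)

context abelian_cover
begin

lemma lifts_cell_deck:
  assumes f: "lifts_cell P c f" and g: "g \<in> carrier (H1orb Y)"
  shows "lifts_cell P c (simplex_map (fst c) (deck P g) f)"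
proof -
  note fD = lifts_cellD[OF f]
  let ?f = "simplex_map (fst c) (deck P g) f"
  have eq: "?f x = deck P g (f x)" if "x \<in> standard_simplex (fst c)" for x
    using that by (simp add: simplex_map_def)
  have "continuous_on (standard_simplex (fst c)) (\<lambda>x. deck P g (f x))"
    by (rule continuous_on_compose2[OF deck_continuous[OF g] fD(1)]) (use fD(3) in blast)
  then have "continuous_on (standard_simplex (fst c)) ?f"
    by (rule continuous_on_eq) (simp add: eq)
  moreover have "?f ` standard_simplex (fst c) \<subseteq> total P"
    using deck_over(1)[OF g fD(3)] by (auto simp: eq)
  moreover have "?f \<in> extensional (standard_simplex (fst c))" by (simp add: simplex_map_def)
  moreover have "simplex_map (fst c) (proj P) ?f = snd c"
  proof -
    have "simplex_map (fst c) (proj P) ?f = simplex_map (fst c) (proj P) f"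
      using deck_over(2)[OF g fD(3)] by (auto simp: simplex_map_def fun_eq_iff)
    then show ?thesis using f by (simp add: lifts_cell_def)
  qed
  ultimately show ?thesis by (simp add: lifts_cell_def singular_simplex_top_of_set)
qed

lemma deck_inverse:
  assumes g: "g \<in> carrier (H1orb Y)" "h \<in> carrier (H1orb Y)" and x: "x \<in> total P"
    and eq: "deck P g x = deck P h x"
  shows "deck P (inv\<^bsub>H1orb Y\<^esub> h \<otimes>\<^bsub>H1orb Y\<^esub> g) x = x"
proof -
  interpret H: Group.comm_group "H1orb Y" by (rule H1orb_group)
  have i: "inv\<^bsub>H1orb Y\<^esub> h \<in> carrier (H1orb Y)" using g(2) by simp
  have "deck P (inv\<^bsub>H1orb Y\<^esub> h \<otimes>\<^bsub>H1orb Y\<^esub> g) x = deck P (inv\<^bsub>H1orb Y\<^esub> h) (deck P h x)"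
    using deck_mult[OF i g(1) x] eq by simp
  also have "\<dots> = deck P (inv\<^bsub>H1orb Y\<^esub> h \<otimes>\<^bsub>H1orb Y\<^esub> h) x" using deck_mult[OF i g(2) x] by simp
  also have "\<dots> = x" using deck_one[OF x] g(2) by simp
  finally show ?thesis .
qed

text \<open>Each of the two cells of a component contains a point by which it is recognized among all the cells.\<close>

lemma core_cells_meet:
  "tube Y i (1, 0) \<in> open_cell (core0 Y i)" "tube Y i (-1, 0) \<in> open_cell (core1 Y i)"
proof -
  have dim: "fst (core0 Y i) = 0" "fst (core1 Y i) = 1" by (simp_all add: core0_def core1_def)
  obtain x where x: "x \<in> open_simplex 0" using open_simplex_nonempty by blast
  then have "x \<in> standard_simplex 0" by (simp add: open_simplex_def)
  then have "snd (core0 Y i) x = tube Y i (1, 0)" by (simp add: core0_def)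
  then show "tube Y i (1, 0) \<in> open_cell (core0 Y i)"
    unfolding open_cell_def using x by (intro image_eqI[of _ _ x]) (simp_all add: dim)
  define y :: "nat \<Rightarrow> real" where "y = (\<lambda>i. if i \<le> 1 then 1 / 2 else 0)"
  have y: "y \<in> open_simplex 1" "y \<in> standard_simplex 1" "y 1 = 1 / 2"
    by (auto simp: y_def open_simplex_def standard_simplex_def)
  have "2 * pi * y 1 = pi" unfolding y(3) by simp
  moreover have "snd (core1 Y i) y = tube Y i (cis (2 * pi * y 1), 0)"
    using y(2) by (simp add: core1_def path_simplex_def)
  ultimately have "snd (core1 Y i) y = tube Y i (-1, 0)" by (simp only: cis_pi)
  then show "tube Y i (-1, 0) \<in> open_cell (core1 Y i)"
    unfolding open_cell_def using y(1) by (intro image_eqI[of _ _ y]) (simp_all add: dim)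
qed

text \<open>Besides the simply transitive action on fibres, local injectivity is included, which makes lifts
  unique.\<close>

definition simply_transitive_over :: "'a set \<Rightarrow> bool" where
  "simply_transitive_over S \<longleftrightarrow> locally_inj_on (proj P) (over S) \<and>
    (\<forall>x\<in>total P. \<forall>y\<in>total P. proj P x = proj P y \<longrightarrow> proj P x \<in> S \<longrightarrow> (\<exists>g\<in>carrier (H1orb Y). deck P g x = y)) \<and>
    (\<forall>x\<in>total P. \<forall>g\<in>carrier (H1orb Y). proj P x \<in> S \<longrightarrow> deck P g x = x \<longrightarrow> g = \<one>\<^bsub>H1orb Y\<^esub>)"

lemma simply_transitive_overD:
  assumes "simply_transitive_over S"
  shows "locally_inj_on (proj P) (over S)"
    "x \<in> total P \<Longrightarrow> y \<in> total P \<Longrightarrow> proj P x = proj P y \<Longrightarrow> proj P x \<in> S \<Longrightarrow>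
      \<exists>g\<in>carrier (H1orb Y). deck P g x = y"
    "x \<in> total P \<Longrightarrow> g \<in> carrier (H1orb Y) \<Longrightarrow> proj P x \<in> S \<Longrightarrow> deck P g x = x \<Longrightarrow> g = \<one>\<^bsub>H1orb Y\<^esub>"
  using assms unfolding simply_transitive_over_def by auto

text \<open>The cell either misses the solid tori or is one of the cells prescribed in them, as open cells are
  disjoint. In the latter case it misses the core, because the two cells in the core are singular.\<close>

lemma nonsingular_cell_region:
  assumes D: "is_cell_decomposition Y D" and c: "c \<in> D" "c \<notin> singular_cells Y"
  shows "\<exists>S. open_cell c \<subseteq> S \<and> simply_transitive_over S"
proof (cases "\<exists>i<ncomp Y. open_cell c \<inter> solid_torus Y i \<noteq> {}")
  case True
  then obtain i p where i: "i < ncomp Y" and p: "p \<in> open_cell c" "p \<in> solid_torus Y i" by blast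
  have disj: "c' = c" if "c' \<in> D" "q \<in> open_cell c'" "q \<in> open_cell c" for c' q
  proof (rule ccontr)
    assume "c' \<noteq> c"
    then have "open_cell c' \<inter> open_cell c = {}" using D that(1) c(1) by (simp add: is_cell_decomposition_def)
    then show False using that by blast
  qed
  obtain s z where sz: "p = tube Y i (s, z)" "s \<in> circle" "norm z \<le> 1"
  proof -
    obtain w where w: "p = tube Y i w" "w \<in> circle \<times> cball 0 1" using p(2) by (auto simp: solid_torus_def)
    obtain s z where "w = (s, z)" by (cases w)
    then show thesis using that[of s z] w by simp
  qed
  obtain n A where A: "(n, A) \<in> tube_cells" "(s, z) \<in> A" using tube_cells_cover[OF sz(2,3)] by blast
  have "\<forall>i<ncomp Y. \<forall>(n, A) \<in> tube_cells. \<exists>c\<in>D. fst c = n \<and> open_cell c = tube Y i ` A"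
    using D unfolding is_cell_decomposition_def by (elim conjE)
  then obtain c' where c': "c' \<in> D" "open_cell c' = tube Y i ` A" using i A(1) by blast
  have "p \<in> open_cell c'" unfolding c'(2) sz(1) using A(2) by (rule imageI)
  then have "c' = c" using disj[OF c'(1)] p(1) by blast
  then have cA: "open_cell c = tube Y i ` A" using c'(2) by simp
  have sing: "singular_cells Y \<subseteq> D" using D by (simp add: is_cell_decomposition_def)
  have cores: "core0 Y i \<in> singular_cells Y" "core1 Y i \<in> singular_cells Y"
    using i by (auto simp: singular_cells_def)
  have "A \<noteq> {(1, 0)}"
  proof
    assume "A = {(1, 0)}"
    then have "core0 Y i = c" using disj[of "core0 Y i"] core_cells_meet(1)[of i] cA sing cores by auto
    then show False using c(2) cores by simp
  qed
  moreover have "A \<noteq> (circle - {1}) \<times> {0}"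
  proof
    assume "A = (circle - {1}) \<times> {0}"
    then have "tube Y i (-1, 0) \<in> open_cell c" unfolding cA by (intro imageI) simp
    then have "core1 Y i = c" using disj[of "core1 Y i"] core_cells_meet(2)[of i] sing cores by auto
    then show False using c(2) cores by simp
  qed
  ultimately have sub: "A \<subseteq> circle \<times> (cball 0 1 - {0})" using tube_cells_cases[OF A(1)] by blast
  let ?S = "tube Y i ` (circle \<times> (cball 0 1 - {0}))"
  have S: "\<exists>s z. q = tube Y i (s, z) \<and> s \<in> circle \<and> norm z \<le> 1 \<and> z \<noteq> 0" if qS: "q \<in> ?S" for q
  proof -
    obtain w where w: "q = tube Y i w" "w \<in> circle \<times> (cball 0 1 - {0})" using qS by blast
    obtain s z where "w = (s, z)" by (cases w)
    then show ?thesis using w by (intro exI[of _ s] exI[of _ z]) simp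
  qed
  show ?thesis
    unfolding simply_transitive_over_def
  proof (intro exI[of _ ?S] conjI ballI impI)
    show "open_cell c \<subseteq> ?S" unfolding cA using sub by (rule image_mono)
    show "locally_inj_on (proj P) (over ?S)" by (rule proj_locally_injective_torus[OF i])
    fix x assume x: "x \<in> total P"
    show "\<exists>g\<in>carrier (H1orb Y). deck P g x = y"
      if y: "y \<in> total P" and eq: "proj P x = proj P y" and xS: "proj P x \<in> ?S" for y
    proof -
      obtain s z where "proj P x = tube Y i (s, z)" "s \<in> circle" "norm z \<le> 1" using S[OF xS] by blast
      then show ?thesis by (rule deck_transitive_torus[OF i x y eq])
    qed
    show "g = \<one>\<^bsub>H1orb Y\<^esub>" if g: "g \<in> carrier (H1orb Y)" and xS: "proj P x \<in> ?S" and fx: "deck P g x = x" for g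
    proof -
      obtain s z where "proj P x = tube Y i (s, z)" "s \<in> circle" "norm z \<le> 1" "z \<noteq> 0" using S[OF xS] by blast
      then show ?thesis by (rule deck_free_torus[OF i x _ _ _ _ g fx])
    qed
  qed
next
  case False
  have "open_cell c \<subseteq> underlying Y" using D c(1) by (auto simp: is_cell_decomposition_def)
  then have sub: "open_cell c \<subseteq> exterior Y" using False by (fastforce simp: exterior_def solid_torus_def)
  show ?thesis
    unfolding simply_transitive_over_def
    using sub proj_locally_injective_exterior deck_transitive_exterior deck_free_exterior
    by (intro exI[of _ "exterior Y"] conjI ballI impI) auto
qed

text \<open>The deck transformation is determined by one point \<open>x0\<close> of the open simplex. The segments from \<open>x0\<close> run
  in the open simplex up to their end points, over a region where lifts are unique.\<close>

lemma nonsingular_cell_translate: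
  assumes D: "is_cell_decomposition Y D" and c: "c \<in> D" "c \<notin> singular_cells Y"
    and f: "lifts_cell P c f" "lifts_cell P c f'"
  shows "\<exists>!g. g \<in> carrier (H1orb Y) \<and> simplex_map (fst c) (deck P g) f = f'"
proof -
  interpret H: Group.comm_group "H1orb Y" by (rule H1orb_group)
  obtain S where S: "open_cell c \<subseteq> S" and st: "simply_transitive_over S"
    using nonsingular_cell_region[OF D c] by blast
  obtain x0 where x0: "x0 \<in> open_simplex (fst c)" using open_simplex_nonempty by blast
  then have x0': "x0 \<in> standard_simplex (fst c)" by (simp add: open_simplex_def)
  have inS: "f1 x \<in> over S" if f1: "lifts_cell P c f1" and x: "x \<in> open_simplex (fst c)" for f1 x
  proof -
    have "x \<in> standard_simplex (fst c)" using x by (simp add: open_simplex_def)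
    then have "f1 x \<in> total P" "proj P (f1 x) = snd c x" using lifts_cellD(3,4)[OF f1] by blast+
    moreover have "snd c x \<in> open_cell c" unfolding open_cell_def using x by (rule imageI)
    ultimately show ?thesis using S by auto
  qed
  note t0 = lifts_cellD(3,4)[OF f(1) x0'] lifts_cellD(3,4)[OF f(2) x0']
  obtain g where g: "g \<in> carrier (H1orb Y)" "deck P g (f x0) = f' x0"
    using simply_transitive_overD(2)[OF st t0(1,3)] t0(2,4) inS[OF f(1) x0] by auto
  note tr = lifts_cell_deck[OF f(1) g(1)]
  have "simplex_map (fst c) (deck P g) f = f'"
  proof (rule lifts_of_cell_agree[OF tr f(2) x0' _ simply_transitive_overD(1)[OF st]])
    show "simplex_map (fst c) (deck P g) f x0 = f' x0" using g(2) x0' by (simp add: simplex_map_def)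
  qed (intro conjI inS[OF tr] inS[OF f(2)] segment_in_open_simplex[OF x0])
  moreover have "h = g" if h: "h \<in> carrier (H1orb Y)" "simplex_map (fst c) (deck P h) f = f'" for h
  proof -
    have "deck P h (f x0) = f' x0" using h(2) x0' by (auto simp: simplex_map_def)
    then have "deck P (inv\<^bsub>H1orb Y\<^esub> g \<otimes>\<^bsub>H1orb Y\<^esub> h) (f x0) = f x0"
      using deck_inverse[OF h(1) g(1) t0(1)] g(2) by simp
    then have "inv\<^bsub>H1orb Y\<^esub> g \<otimes>\<^bsub>H1orb Y\<^esub> h = \<one>\<^bsub>H1orb Y\<^esub>"
      using g(1) h(1) inS[OF f(1) x0] by (intro simply_transitive_overD(3)[OF st t0(1)]) auto
    then show "h = g" using g(1) h(1) by (metis H.inv_closed H.inv_equality H.inv_inv H.m_comm)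
  qed
  ultimately show ?thesis using g(1) by blast
qed

lemma euler_lifts_lift:
  assumes "e \<in> euler_lifts Y P D" "c \<in> D" shows "lifts_cell P c (e c)"
  using assms by (simp add: euler_lifts_def lifts_cell_def)

lemma euler_lifts_start:
  assumes "e \<in> euler_lifts Y P D" "i < ncomp Y"
  shows "e (core1 Y i) start_vertex = e (core0 Y i) start_vertex"
  using assms by (simp add: euler_lifts_def Let_def)

text \<open>The chosen lift of the 1-cell starts at the chosen lift of the 0-cell, so a deck transformation that
  translates the latter translates the former as well, by uniqueness of lifts in the preimage of
  the core.\<close>

lemma core_cells_translate:
  assumes D: "is_cell_decomposition Y D" and i: "i < ncomp Y"
    and e: "e \<in> euler_lifts Y P D" "e' \<in> euler_lifts Y P D"
  shows "\<exists>g\<in>carrier (H1orb Y). simplex_map 0 (deck P g) (e (core0 Y i)) = e' (core0 Y i) \<and>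
    simplex_map 1 (deck P g) (e (core1 Y i)) = e' (core1 Y i)"
proof -
  let ?v = start_vertex
  have cD: "core0 Y i \<in> D" "core1 Y i \<in> D"
    using D i by (auto simp: is_cell_decomposition_def singular_cells_def)
  have dim: "fst (core0 Y i) = 0" "fst (core1 Y i) = 1" by (simp_all add: core0_def core1_def)
  note l0 = euler_lifts_lift[OF e(1) cD(1)] and l0' = euler_lifts_lift[OF e(2) cD(1)]
  note l1 = euler_lifts_lift[OF e(1) cD(2)] and l1' = euler_lifts_lift[OF e(2) cD(2)]
  have v0: "?v \<in> standard_simplex (fst (core0 Y i))" and v1: "?v \<in> standard_simplex (fst (core1 Y i))"
    by (simp_all add: start_vertex_simplex)
  have p: "snd (core0 Y i) ?v = tube Y i (1, 0)" using v0 by (simp add: core0_def)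
  note t = lifts_cellD(3,4)[OF l0 v0] and t' = lifts_cellD(3,4)[OF l0' v0]
  obtain g where g: "g \<in> carrier (H1orb Y)" "deck P g (e (core0 Y i) ?v) = e' (core0 Y i) ?v"
    using deck_transitive_torus[OF i t(1) t'(1), of 1 0] t(2) t'(2) p by auto
  have "simplex_map 0 (deck P g) (e (core0 Y i)) = e' (core0 Y i)"
  proof
    fix x
    show "simplex_map 0 (deck P g) (e (core0 Y i)) x = e' (core0 Y i) x"
      using g(2) lifts_cellD(2)[OF l0'] unfolding dim
      by (cases "x = ?v") (auto simp: simplex_map_def standard_simplex_0 extensional_def)
  qed
  moreover have "simplex_map (fst (core1 Y i)) (deck P g) (e (core1 Y i)) = e' (core1 Y i)"
  proof (rule lifts_of_cell_agree[OF lifts_cell_deck[OF l1 g(1)] l1' v1 _ proj_locally_injective_core[OF i]])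
    show "simplex_map (fst (core1 Y i)) (deck P g) (e (core1 Y i)) ?v = e' (core1 Y i) ?v"
      using g(2) v1 euler_lifts_start[OF e(1) i] euler_lifts_start[OF e(2) i] by (simp add: simplex_map_def)
    have inC: "f x \<in> over (tube Y i ` (circle \<times> {0}))"
      if f: "lifts_cell P (core1 Y i) f" and x: "x \<in> standard_simplex (fst (core1 Y i))" for f x
    proof -
      have "snd (core1 Y i) x = tube Y i (cis (2 * pi * x 1), 0)"
        using x by (simp add: core1_def path_simplex_def)
      then show ?thesis using lifts_cellD(3,4)[OF f x] by auto
    qed
    fix x s assume x: "x \<in> standard_simplex (fst (core1 Y i))" and s: "s \<in> {0..<1::real}"
    have "(\<lambda>j. (1 - s) * ?v j + s * x j) \<in> standard_simplex (fst (core1 Y i))"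
      by (rule segment_in_standard_simplex[OF v1 x]) (use s in simp)
    then show "simplex_map (fst (core1 Y i)) (deck P g) (e (core1 Y i)) (\<lambda>j. (1 - s) * ?v j + s * x j)
        \<in> over (tube Y i ` (circle \<times> {0})) \<and>
      e' (core1 Y i) (\<lambda>j. (1 - s) * ?v j + s * x j) \<in> over (tube Y i ` (circle \<times> {0}))"
      using inC[OF lifts_cell_deck[OF l1 g(1)]] inC[OF l1'] by blast
  qed
  ultimately show ?thesis using g(1) unfolding dim by blast
qed

lemma core_index_inj:
  assumes "i < ncomp Y" "j < ncomp Y"
  shows "core0 Y i = core0 Y j \<Longrightarrow> i = j" "core1 Y i = core1 Y j \<Longrightarrow> i = j"
proof -
  have v: "start_vertex \<in> standard_simplex n" for n by (rule start_vertex_simplex)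
  assume "core0 Y i = core0 Y j"
  then have "snd (core0 Y i) start_vertex = snd (core0 Y j) start_vertex" by simp
  then have "tube Y i (1, 0) = tube Y j (1, 0)" using v by (simp add: core0_def)
  then show "i = j" by (rule tubes_disjoint[OF assms]) simp_all
next
  have v: "start_vertex \<in> standard_simplex n" for n by (rule start_vertex_simplex)
  have 0: "start_vertex 1 = 0" by (simp add: start_vertex_def)
  assume "core1 Y i = core1 Y j"
  then have "snd (core1 Y i) start_vertex = snd (core1 Y j) start_vertex" by simp
  then have "tube Y i (1, 0) = tube Y j (1, 0)" using v 0 by (simp add: core1_def path_simplex_def)
  then show "i = j" by (rule tubes_disjoint[OF assms]) simp_all
qed

end

section \<open>Reordering lists of cells\<close>

text \<open>The marked elements occur in the same order and at the same positions, so the permutation that maps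
  \<open>xs\<close> to \<open>ys\<close> entry by entry fixes them.\<close>

lemma reordering_permutation:
  assumes "distinct xs" "distinct ys" "set xs = set ys"
    and "map p xs = map p ys" "filter p xs = filter p ys"
  shows "\<exists>\<sigma>. \<sigma> permutes {x \<in> set xs. \<not> p x} \<and> ys = map \<sigma> xs"
proof -
  have len: "length xs = length ys" using assms(4) by (metis length_map)
  have fixed: "\<forall>k<length xs. p (xs ! k) \<longrightarrow> ys ! k = xs ! k"
    using len assms(4,5)
  proof (induction xs ys rule: list_induct2)
    case (Cons x xs y ys)
    then have "map p xs = map p ys" "p x = p y" "filter p xs = filter p ys" "p x \<Longrightarrow> x = y"
      by (auto split: if_splits)
    then show ?case using Cons.IH by (auto simp: nth_Cons split: nat.splits)
  qed simp
  define \<sigma> where "\<sigma> x = (if x \<in> set xs then the (map_of (zip xs ys) x) else x)" for x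
  have \<sigma>: "\<sigma> (xs ! k) = ys ! k" if "k < length xs" for k
    using that map_of_zip_nth[OF len assms(1), of k] len by (simp add: \<sigma>_def)
  have ys: "ys = map \<sigma> xs" using len \<sigma> by (intro nth_equalityI) auto
  have "\<sigma> ` set xs = set xs" using arg_cong[OF ys, of set] assms(3) by simp
  then have "bij_betw \<sigma> (set xs) (set xs)"
    by (simp add: bij_betw_def eq_card_imp_inj_on)
  then have "\<sigma> permutes set xs" by (rule bij_imp_permutes) (simp add: \<sigma>_def)
  moreover have "\<sigma> x = x" if "x \<in> set xs - {x \<in> set xs. \<not> p x}" for x
  proof -
    have x: "x \<in> set xs" "p x" using that by auto
    then obtain k where k: "k < length xs" "xs ! k = x" unfolding in_set_conv_nth by blast
    have "ys ! k = xs ! k" using spec[OF fixed, of k] k x(2) by simp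
    then show ?thesis using \<sigma>[OF k(1)] unfolding k(2) by (rule trans[rotated])
  qed
  ultimately have "\<sigma> permutes {x \<in> set xs. \<not> p x}" by (rule permutes_superset)
  then show ?thesis using ys by blast
qed

lemma power_int_prod: "(\<Prod>x\<in>A. f x) powi n = (\<Prod>x\<in>A. f x powi n)" for f :: "'c \<Rightarrow> 'f::field"
  by (induction A rule: infinite_finite_induct) (auto simp: power_int_mult_distrib)

lemma prod_by_dimension:
  fixes h :: "nat \<times> 'c \<Rightarrow> 'f::field"
  assumes "finite A" "\<And>c. c \<in> A \<Longrightarrow> fst c \<le> m"
  shows "(\<Prod>i\<le>m. (\<Prod>c\<in>{c \<in> A. fst c = i}. h c) powi ((-1) ^ (i + 1))) =
    (\<Prod>c\<in>A. h c powi ((-1) ^ (fst c + 1)))"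
proof -
  have "(\<Prod>i\<le>m. (\<Prod>c\<in>{c \<in> A. fst c = i}. h c) powi ((-1) ^ (i + 1))) =
      (\<Prod>i\<le>m. \<Prod>c\<in>{c \<in> A. fst c = i}. h c powi ((-1) ^ (fst c + 1)))"
    unfolding power_int_prod by (intro prod.cong) auto
  also have "\<dots> = (\<Prod>c\<in>A. h c powi ((-1) ^ (fst c + 1)))"
    using assms by (intro prod.group) auto
  finally show ?thesis .
qed

section \<open>Invariance of the torsion\<close>

locale torsion_setting = abelian_cover Y P
  for Y :: "'a::t2_space link_orbifold" and P :: "('a, 'b::t2_space) orb_cover" +
  fixes D :: "'a cell set" and \<phi> :: "('a chain set set \<Rightarrow> int) \<Rightarrow> 'f::field"
  assumes D: "is_cell_decomposition Y D"
    and \<phi>_one: "\<phi> (point_mass \<one>\<^bsub>H1orb Y\<^esub>) = 1"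
    and \<phi>_mult: "g \<in> carrier (H1orb Y) \<Longrightarrow> h \<in> carrier (H1orb Y) \<Longrightarrow>
      \<phi> (point_mass (g \<otimes>\<^bsub>H1orb Y\<^esub> h)) = \<phi> (point_mass g) * \<phi> (point_mass h)"
begin

sublocale H: Group.comm_group "H1orb Y" by (rule H1orb_group)

abbreviation "\<psi> g \<equiv> \<phi> (point_mass g)"
abbreviation "sk \<equiv> cover_skel P D"
abbreviation "TC \<equiv> twisted_chains Y P D \<phi>"
abbreviation "TB \<equiv> twisted_boundary Y P D \<phi>"

text \<open>The vector \<open>[f] \<otimes> 1\<close> of a lifted cell with orientation \<open>a\<close>.\<close>

definition tw :: "nat \<Rightarrow> int \<Rightarrow> ((nat \<Rightarrow> real) \<Rightarrow> 'b) \<Rightarrow> ('b chain set \<Rightarrow> 'f) set" where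
  "tw n a f = tensor_elt (cell_chains sk n) (carrier (H1orb Y)) (\<lambda>g. cell_map sk n (deck P g)) (\<lambda>g. \<psi> g)
    (cell_class sk n a f)"

lemma \<psi>_inv: "g \<in> carrier (H1orb Y) \<Longrightarrow> \<psi> g * \<psi> (inv\<^bsub>H1orb Y\<^esub> g) = 1"
  using \<phi>_mult[of g "inv\<^bsub>H1orb Y\<^esub> g"] \<phi>_one by simp

lemma \<psi>_nonzero: "g \<in> carrier (H1orb Y) \<Longrightarrow> \<psi> g \<noteq> 0"
  using \<psi>_inv[of g] by auto

lemma \<psi>_alternating:
  assumes g: "g \<in> carrier (H1orb Y)"
  shows "\<psi> (g [^]\<^bsub>H1orb Y\<^esub> ((-1) ^ n :: int)) = \<psi> g powi ((-1) ^ n)"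
proof (cases "even n")
  case True
  then show ?thesis using g by (simp add: H.int_pow_1)
next
  case False
  have "inverse (\<psi> g) = \<psi> (inv\<^bsub>H1orb Y\<^esub> g)" by (rule inverse_unique[OF \<psi>_inv[OF g]])
  then show ?thesis using False g by (simp add: H.int_pow_neg H.int_pow_1 power_int_minus)
qed

lemma \<psi>_finprod:
  assumes "finite A" "\<And>c. c \<in> A \<Longrightarrow> h c \<in> carrier (H1orb Y)"
  shows "\<psi> (\<Otimes>\<^bsub>H1orb Y\<^esub>c\<in>A. h c) = (\<Prod>c\<in>A. \<psi> (h c))"
  using assms
proof (induction A rule: finite_induct)
  case empty
  then show ?case using \<phi>_one by simp
next
  case (insert x A)
  then have "(\<Otimes>\<^bsub>H1orb Y\<^esub>c\<in>A. h c) \<in> carrier (H1orb Y)" "h x \<in> carrier (H1orb Y)"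
    by (auto intro: H.finprod_closed)
  moreover have "(\<Otimes>\<^bsub>H1orb Y\<^esub>c\<in>insert x A. h c) = h x \<otimes>\<^bsub>H1orb Y\<^esub> (\<Otimes>\<^bsub>H1orb Y\<^esub>c\<in>A. h c)"
    using insert by (intro H.finprod_insert) auto
  ultimately show ?case using insert by (simp add: \<phi>_mult)
qed

lemma twisted_tensor_data:
  "tensor_data (cell_chains sk n) (carrier (H1orb Y)) (\<lambda>g. cell_map sk n (deck P g))"
  by (rule tensor_data.intro)
    (use cell_chains_group in \<open>auto simp: Group.comm_group_def cell_map_def cell_chains_def intro: hom_induced_carrier\<close>)

lemma TC_module: "vector_module (TC n)"
  unfolding twisted_chains_def by (rule tensor_data.T_vector_module[OF twisted_tensor_data])

lemma tw_carrier:
  assumes "c \<in> D" "lifts_cell P c f" shows "tw (fst c) a f \<in> carrier (TC (fst c))"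
  unfolding tw_def twisted_chains_def
  by (rule tensor_data.elt_carrier[OF twisted_tensor_data cell_class_carrier[OF cell_simplex_lift[OF D assms]]])

lemma tw_translate:
  assumes c: "c \<in> D" "lifts_cell P c f" and g: "g \<in> carrier (H1orb Y)"
  shows "tw (fst c) a (simplex_map (fst c) (deck P g) f) = \<psi> g \<odot>\<^bsub>TC (fst c)\<^esub> tw (fst c) a f"
proof -
  have into: "deck P g ` sk n \<subseteq> sk n" for n
    using deck_over[OF g] by (auto simp: cover_skel_def)
  have "continuous_on (sk (Suc (fst c))) (deck P g)"
    by (rule continuous_on_subset[OF deck_continuous[OF g]]) (auto simp: cover_skel_def)
  then have "cell_map sk (fst c) (deck P g) (cell_class sk (fst c) a f) =
      cell_class sk (fst c) a (simplex_map (fst c) (deck P g) f)"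
    by (intro cell_map_cell_class[OF cell_simplex_lift[OF D c]] into)
  then show ?thesis
    unfolding tw_def twisted_chains_def
    using tensor_data.elt_action[OF twisted_tensor_data g cell_class_carrier[OF cell_simplex_lift[OF D c]]]
    by metis
qed

lemma tw_orientation:
  assumes c: "c \<in> D" "lifts_cell P c f" and \<epsilon>: "\<epsilon> \<in> {1, -1}" "\<epsilon>' \<in> {1, -1}"
  shows "tw (fst c) \<epsilon>' f = of_int (\<epsilon> * \<epsilon>') \<odot>\<^bsub>TC (fst c)\<^esub> tw (fst c) \<epsilon> f"
  unfolding tw_def twisted_chains_def
  by (rule orientation_class[OF twisted_tensor_data cell_simplex_lift[OF D c] \<epsilon>])

lemma twisted_basis_eq:
  assumes "cell_order Y D ls"
  shows "twisted_basis Y P D \<phi> e ls \<epsilon> n =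
    map (\<lambda>c. tw (fst c) (\<epsilon> c) (e c)) (filter (\<lambda>c. c \<notin> omitted_cells Y \<phi>) (ls n))"
proof -
  have "fst c = n" if "c \<in> set (ls n)" for c using assms that by (auto simp: cell_order_def)
  then show ?thesis unfolding twisted_basis_def tw_def by (intro map_cong) auto
qed

lemma cells_facts:
  assumes "cell_order Y D ls"
  shows "distinct (ls n)" "set (ls n) = {c \<in> D. fst c = n}"
  using assms by (simp_all add: cell_order_def)

lemma finite_cells: "finite D" and dim_le: "c \<in> D \<Longrightarrow> fst c \<le> 3" and singular_cells_subset: "singular_cells Y \<subseteq> D"
  using D by (simp_all add: is_cell_decomposition_def)

lemma omitted_singular: "omitted_cells Y \<phi> \<subseteq> singular_cells Y"
  by (auto simp: omitted_cells_def singular_cells_def)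

lemma core_dims: "fst (core0 Y i) = 0" "fst (core1 Y i) = 1"
  by (simp_all add: core0_def core1_def)

lemma core_cells_distinct: "core0 Y i \<noteq> core1 Y j"
  using core_dims by (metis zero_neq_one)

text \<open>Off the link the alternating product is the inverse of the image of the ratio of the lifts. On a
  component of the link one element translates both cells; these have adjacent dimensions and are
  omitted together, so their factors cancel.\<close>

lemma translating_elements:
  assumes e: "e \<in> euler_lifts Y P D" "e' \<in> euler_lifts Y P D" and ratio: "lift_ratio Y P D e' e = \<one>\<^bsub>H1orb Y\<^esub>"
  shows "\<exists>g. (\<forall>c\<in>D. g c \<in> carrier (H1orb Y) \<and> simplex_map (fst c) (deck P (g c)) (e c) = e' c) \<and>
    (\<Prod>c\<in>{c \<in> D. c \<notin> omitted_cells Y \<phi>}. \<psi> (g c) powi ((-1) ^ (fst c + 1))) = 1"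
proof -
  define gn where "gn c = (THE g. g \<in> carrier (H1orb Y) \<and> simplex_map (fst c) (deck P g) (e c) = e' c)" for c
  have gn: "gn c \<in> carrier (H1orb Y) \<and> simplex_map (fst c) (deck P (gn c)) (e c) = e' c"
    if "c \<in> D" "c \<notin> singular_cells Y" for c
    unfolding gn_def
    by (rule theI'[OF nonsingular_cell_translate[OF D that euler_lifts_lift[OF e(1) that(1)] euler_lifts_lift[OF e(2) that(1)]]])
  have "\<forall>i. \<exists>g. i < ncomp Y \<longrightarrow> g \<in> carrier (H1orb Y) \<and> simplex_map 0 (deck P g) (e (core0 Y i)) = e' (core0 Y i) \<and>
    simplex_map 1 (deck P g) (e (core1 Y i)) = e' (core1 Y i)"
    using core_cells_translate[OF D _ e] by blast
  then obtain \<gamma> where \<gamma>: "\<And>i. i < ncomp Y \<Longrightarrow> \<gamma> i \<in> carrier (H1orb Y) \<and>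
    simplex_map 0 (deck P (\<gamma> i)) (e (core0 Y i)) = e' (core0 Y i) \<and>
    simplex_map 1 (deck P (\<gamma> i)) (e (core1 Y i)) = e' (core1 Y i)"
    by metis
  define idx where "idx c = (THE i. i < ncomp Y \<and> (c = core0 Y i \<or> c = core1 Y i))" for c
  have idx: "idx (core0 Y i) = i" "idx (core1 Y i) = i" if i: "i < ncomp Y" for i
    unfolding idx_def
    using i core_index_inj[OF i] core_cells_distinct core_cells_distinct[symmetric]
    by (auto intro!: the_equality)
  define g where "g c = (if c \<in> singular_cells Y then \<gamma> (idx c) else gn c)" for c
  have sing: "core0 Y i \<in> singular_cells Y" "core1 Y i \<in> singular_cells Y" if "i < ncomp Y" for i
    using that by (auto simp: singular_cells_def)
  have gc: "g (core0 Y i) = \<gamma> i" "g (core1 Y i) = \<gamma> i" if "i < ncomp Y" for i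
    using sing[OF that] idx[OF that] by (simp_all add: g_def)
  have g: "g c \<in> carrier (H1orb Y) \<and> simplex_map (fst c) (deck P (g c)) (e c) = e' c" if c: "c \<in> D" for c
  proof (cases "c \<in> singular_cells Y")
    case True
    then obtain i where i: "i < ncomp Y" "c = core0 Y i \<or> c = core1 Y i" by (auto simp: singular_cells_def)
    show ?thesis
      using i(2) gc[OF i(1)] \<gamma>[OF i(1)] core_dims[of i] by (elim disjE) simp_all
  next
    case False
    then show ?thesis using gn[OF c False] by (simp add: g_def)
  qed
  let ?h = "\<lambda>c. \<psi> (g c) powi ((-1) ^ (fst c + 1))"
  let ?N = "D - singular_cells Y" and ?S = "{c \<in> singular_cells Y. c \<notin> omitted_cells Y \<phi>}"
  have finN: "finite ?N" using finite_cells by simp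
  have "prod ?h ?N = 1"
  proof -
    have "(\<Prod>c\<in>?N. \<psi> (gn c) powi ((-1) ^ fst c)) = \<psi> (lift_ratio Y P D e' e)"
    proof -
      have "\<psi> (lift_ratio Y P D e' e) = (\<Prod>c\<in>?N. \<psi> (gn c [^]\<^bsub>H1orb Y\<^esub> ((-1) ^ fst c :: int)))"
        unfolding lift_ratio_def gn_def[symmetric] using gn by (intro \<psi>_finprod finN H.int_pow_closed) auto
      also have "\<dots> = (\<Prod>c\<in>?N. \<psi> (gn c) powi ((-1) ^ fst c))"
        using gn by (intro prod.cong \<psi>_alternating) auto
      finally show ?thesis by simp
    qed
    then have one: "(\<Prod>c\<in>?N. \<psi> (gn c) powi ((-1) ^ fst c)) = 1" using ratio \<phi>_one by simp
    have "prod ?h ?N = (\<Prod>c\<in>?N. inverse (\<psi> (gn c) powi ((-1) ^ fst c)))"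
      by (intro prod.cong) (auto simp: g_def power_int_minus)
    also have "\<dots> = inverse (\<Prod>c\<in>?N. \<psi> (gn c) powi ((-1) ^ fst c))" by (rule prod_inversef[unfolded comp_def])
    finally show ?thesis using one by simp
  qed
  moreover have "prod ?h ?S = 1"
  proof -
    let ?I = "{i. i < ncomp Y \<and> \<psi> (meridian_class Y i) = 1}"
    have om: "core0 Y i \<in> omitted_cells Y \<phi> \<longleftrightarrow> \<psi> (meridian_class Y i) \<noteq> 1"
      "core1 Y i \<in> omitted_cells Y \<phi> \<longleftrightarrow> \<psi> (meridian_class Y i) \<noteq> 1" if i: "i < ncomp Y" for i
      using i core_index_inj[OF i] core_cells_distinct core_cells_distinct[symmetric]
      by (auto simp: omitted_cells_def)
    have S: "?S = core0 Y ` ?I \<union> core1 Y ` ?I" using om by (auto simp: singular_cells_def)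
    have "prod ?h ?S = prod ?h (core0 Y ` ?I) * prod ?h (core1 Y ` ?I)"
      unfolding S using core_cells_distinct by (intro prod.union_disjoint) (simp, simp, blast)
    also have "prod ?h (core0 Y ` ?I) = (\<Prod>i\<in>?I. ?h (core0 Y i))"
      using core_index_inj by (intro prod.reindex[unfolded comp_def] inj_onI) auto
    also have "prod ?h (core1 Y ` ?I) = (\<Prod>i\<in>?I. ?h (core1 Y i))"
      using core_index_inj by (intro prod.reindex[unfolded comp_def] inj_onI) auto
    also have "(\<Prod>i\<in>?I. ?h (core0 Y i)) * (\<Prod>i\<in>?I. ?h (core1 Y i)) = (\<Prod>i\<in>?I. 1)"
      unfolding prod.distrib[symmetric]
    proof (intro prod.cong refl)
      fix i assume "i \<in> ?I"
      then have i: "i < ncomp Y" by simp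
      have "\<psi> (\<gamma> i) \<noteq> 0" using \<gamma>[OF i] by (intro \<psi>_nonzero) simp
      then show "?h (core0 Y i) * ?h (core1 Y i) = 1"
        unfolding gc[OF i] core_dims by (simp add: power_int_minus)
    qed
    finally show ?thesis by simp
  qed
  moreover have "{c \<in> D. c \<notin> omitted_cells Y \<phi>} = ?N \<union> ?S"
    using singular_cells_subset omitted_singular by auto
  moreover have "finite ?S"
    by (rule finite_subset[OF _ finite_cells]) (use singular_cells_subset in blast)
  then have "prod ?h (?N \<union> ?S) = prod ?h ?N * prod ?h ?S"
    by (intro prod.union_disjoint finN) auto
  ultimately have "prod ?h {c \<in> D. c \<notin> omitted_cells Y \<phi>} = 1" by simp
  then show ?thesis using g by (intro exI[of _ g] conjI) simp_all
qed

lemma twisted_torsion_change_of_lift: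
  assumes e: "e \<in> euler_lifts Y P D" "e' \<in> euler_lifts Y P D" and ratio: "lift_ratio Y P D e' e = \<one>\<^bsub>H1orb Y\<^esub>"
    and ls: "cell_order Y D ls"
  shows "torsion 3 TC TB (twisted_basis Y P D \<phi> e ls \<epsilon>) w = torsion 3 TC TB (twisted_basis Y P D \<phi> e' ls \<epsilon>) w"
proof -
  obtain g where g: "\<And>c. c \<in> D \<Longrightarrow> g c \<in> carrier (H1orb Y) \<and> simplex_map (fst c) (deck P (g c)) (e c) = e' c"
    and one: "(\<Prod>c\<in>{c \<in> D. c \<notin> omitted_cells Y \<phi>}. \<psi> (g c) powi ((-1) ^ (fst c + 1))) = 1"
    using translating_elements[OF e ratio] by blast
  let ?xs = "\<lambda>i. filter (\<lambda>c. c \<notin> omitted_cells Y \<phi>) (ls i)"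
  have set: "set (?xs i) = {c \<in> {c \<in> D. c \<notin> omitted_cells Y \<phi>}. fst c = i}" for i
    using cells_facts(2)[OF ls, of i] by auto
  have "torsion 3 TC TB (twisted_basis Y P D \<phi> e ls \<epsilon>) w =
    (\<Prod>i\<le>3. (\<Prod>c\<in>set (?xs i). \<psi> (g c)) powi ((-1) ^ (i + 1))) *
      torsion 3 TC TB (twisted_basis Y P D \<phi> e' ls \<epsilon>) w"
  proof (rule torsion_change_of_chain_bases)
    fix i a
    interpret vector_module "TC i" by (rule TC_module)
    have "basis_det (TC i) a (map (\<lambda>c. tw (fst c) (\<epsilon> c) (e c)) (?xs i)) =
      (\<Prod>c\<in>set (?xs i). \<psi> (g c)) * of_int (sign (id :: 'a cell \<Rightarrow> 'a cell)) *
        basis_det (TC i) a (map (\<lambda>c. tw (fst c) (\<epsilon> c) (e' c)) (map id (?xs i)))"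
    proof (rule basis_det_monomial_change)
      fix c assume "c \<in> set (?xs i)"
      then have c: "c \<in> D" "fst c = i" unfolding set by auto
      show "tw (fst c) (\<epsilon> c) (e c) \<in> carrier (TC i)"
        using tw_carrier[OF c(1) euler_lifts_lift[OF e(1) c(1)]] c(2) by simp
      show "tw (fst c) (\<epsilon> c) (e' c) = \<psi> (g c) \<odot>\<^bsub>TC i\<^esub> tw (fst c) (\<epsilon> c) (e c)"
        using tw_translate[OF c(1) euler_lifts_lift[OF e(1) c(1)], of "g c" "\<epsilon> c"] g[OF c(1)] c(2) by simp
      show "\<psi> (g c) \<noteq> 0" using g[OF c(1)] \<psi>_nonzero by simp
    qed (use cells_facts(1)[OF ls] in \<open>simp_all add: permutes_id\<close>)
    then show "basis_det (TC i) a (twisted_basis Y P D \<phi> e ls \<epsilon> i) =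
      (\<Prod>c\<in>set (?xs i). \<psi> (g c)) * basis_det (TC i) a (twisted_basis Y P D \<phi> e' ls \<epsilon> i)"
      unfolding twisted_basis_eq[OF ls] by simp
  qed (simp add: twisted_basis_eq[OF ls])
  also have "(\<Prod>i\<le>3. (\<Prod>c\<in>set (?xs i). \<psi> (g c)) powi ((-1) ^ (i + 1))) = 1"
    unfolding set using one finite_cells dim_le by (subst prod_by_dimension) auto
  finally show ?thesis by simp
qed

text \<open>In dimensions 0 and 1 the order of the cells in the link is prescribed, and in higher dimensions
  there are none.\<close>

lemma cell_reordering:
  assumes "cell_order Y D ls" "cell_order Y D ls'" "same_link_positions Y ls ls'"
  shows "\<exists>\<sigma>. \<sigma> permutes {c \<in> set (ls i). c \<notin> singular_cells Y} \<and> ls' i = map \<sigma> (ls i)"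
proof (rule reordering_permutation)
  show "map (\<lambda>c. c \<in> singular_cells Y) (ls i) = map (\<lambda>c. c \<in> singular_cells Y) (ls' i)"
    using assms(3) by (simp add: same_link_positions_def)
  show "filter (\<lambda>c. c \<in> singular_cells Y) (ls i) = filter (\<lambda>c. c \<in> singular_cells Y) (ls' i)"
  proof -
    consider "i = 0" | "i = 1" | "2 \<le> i" by linarith
    then show ?thesis
    proof cases
      case 3
      have "c \<notin> singular_cells Y" if "fst c = i" for c
        using that 3 core_dims by (auto simp: singular_cells_def)
      then have "filter (\<lambda>c. c \<in> singular_cells Y) (ks i) = []" if "cell_order Y D ks" for ks
        using cells_facts(2)[OF that, of i] by (auto simp: filter_empty_conv)
      then show ?thesis using assms(1,2) by simp
    qed (use assms(1,2) in \<open>simp_all add: cell_order_def\<close>)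
  qed
  show "distinct (ls i)" "distinct (ls' i)" by (rule cells_facts(1)[OF assms(1)] cells_facts(1)[OF assms(2)])+
  show "set (ls i) = set (ls' i)" unfolding cells_facts(2)[OF assms(1)] cells_facts(2)[OF assms(2)] ..
qed

text \<open>The real and the twisted torsion change by the same sign, since the cells that the twisted complex
  omits are neither reoriented nor moved.\<close>

lemma orb_torsion_change_of_cells:
  assumes e: "e \<in> euler_lifts Y P D"
    and \<epsilon>: "cell_orientation Y D \<epsilon>" "cell_orientation Y D \<epsilon>'"
    and ls: "cell_order Y D ls" "cell_order Y D ls'" "same_link_positions Y ls ls'"
  shows "orb_torsion Y P D \<phi> e ls \<epsilon> w = orb_torsion Y P D \<phi> e ls' \<epsilon>' w"
proof -
  have "\<forall>i. \<exists>\<sigma>. \<sigma> permutes {c \<in> set (ls i). c \<notin> singular_cells Y} \<and> ls' i = map \<sigma> (ls i)"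
    by (rule allI) (rule cell_reordering[OF ls])
  from choice[OF this] obtain \<sigma> where
    "\<forall>i. \<sigma> i permutes {c \<in> set (ls i). c \<notin> singular_cells Y} \<and> ls' i = map (\<sigma> i) (ls i)" ..
  then have \<sigma>: "\<sigma> i permutes {c \<in> set (ls i). c \<notin> singular_cells Y}" "ls' i = map (\<sigma> i) (ls i)" for i
    by simp_all
  \<comment> \<open>\<open>\<delta>\<close> records the cells that are reoriented, and \<open>\<kappa> i\<close> is the sign of the whole change in degree \<open>i\<close>.\<close>
  define \<delta> where "\<delta> c = \<epsilon> c * \<epsilon>' c" for c
  define \<kappa> where "\<kappa> i = (\<Prod>c\<in>set (ls i). \<delta> c) * sign (\<sigma> i)" for i
  have eps: "\<epsilon> c \<in> {1, -1}" "\<epsilon>' c \<in> {1, -1}" if "c \<in> D" for c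
    using \<epsilon> that by (simp_all add: cell_orientation_def)
  have \<delta>1: "\<delta> c = 1" if "c \<in> singular_cells Y" for c
    using \<epsilon> that by (simp add: cell_orientation_def \<delta>_def)
  have \<delta>: "\<delta> c \<in> {1, -1}" if "c \<in> D" for c
    using eps[OF that] by (auto simp: \<delta>_def)
  have \<kappa>: "\<kappa> i \<in> {1, -1}" for i
  proof -
    have "\<bar>\<Prod>c\<in>set (ls i). \<delta> c\<bar> = (\<Prod>c\<in>set (ls i). 1)"
      unfolding abs_prod
    proof (rule prod.cong[OF refl])
      fix c assume "c \<in> set (ls i)"
      then have "\<delta> c \<in> {1, -1}" by (intro \<delta>) (simp add: cells_facts(2)[OF ls(1)])
      then show "\<bar>\<delta> c\<bar> = 1" by (elim insertE) simp_all
    qed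
    then have "\<bar>\<kappa> i\<bar> = 1" unfolding \<kappa>_def abs_mult by (simp add: sign_def)
    then show ?thesis by (simp add: abs_if split: if_splits)
  qed
  define K where "K = (\<Prod>i\<le>3. \<kappa> i)"
  have K: "K \<in> {1, -1}"
    using \<kappa>[of 0] \<kappa>[of 1] \<kappa>[of 2] \<kappa>[of 3] by (auto simp: K_def numeral_eq_Suc)
  have powK: "(\<Prod>i\<le>3. of_int (\<kappa> i) powi ((-1) ^ (i + 1))) = (of_int K :: 'g::field)"
  proof -
    have "of_int (\<kappa> i) powi ((-1) ^ (i + 1)) = (of_int (\<kappa> i) :: 'g)" for i
      using \<kappa>[of i] unfolding powi_alternating by auto
    then show ?thesis unfolding K_def of_int_prod by (intro prod.cong) auto
  qed
  have real: "torsion 3 (real_chains D) (real_boundary D) (real_basis D ls \<epsilon>) w =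
      of_int K * torsion 3 (real_chains D) (real_boundary D) (real_basis D ls' \<epsilon>') w"
    unfolding powK[symmetric]
  proof (rule torsion_change_of_chain_bases)
    fix i a
    interpret vector_module "real_chains D i"
      unfolding real_chains_def by (rule tensor_data.T_vector_module[OF real_tensor_data])
    let ?v = "\<lambda>\<epsilon> c. tensor_elt (cell_chains (skel D) i) ({} :: unit set) (\<lambda>_ x. x) (\<lambda>_. 1)
      (cell_class (skel D) i (\<epsilon> c) (snd c)) :: ('a chain set \<Rightarrow> real) set"
    have "basis_det (real_chains D i) a (map (?v \<epsilon>) (ls i)) =
      (\<Prod>c\<in>set (ls i). of_int (\<delta> c)) * of_int (sign (\<sigma> i)) * basis_det (real_chains D i) a (map (?v \<epsilon>') (map (\<sigma> i) (ls i)))"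
    proof (rule basis_det_monomial_change)
      show "\<sigma> i permutes set (ls i)" by (rule permutes_subset[OF \<sigma>(1)]) auto
      fix c assume "c \<in> set (ls i)"
      then have c: "c \<in> D" "fst c = i" using cells_facts(2)[OF ls(1)] by auto
      note cs = cell_simplex_of_decomposition[OF D c(1), unfolded c(2)]
      show "?v \<epsilon> c \<in> carrier (real_chains D i)"
        unfolding real_chains_def by (rule tensor_data.elt_carrier[OF real_tensor_data cell_class_carrier[OF cs]])
      show "?v \<epsilon>' c = of_int (\<delta> c) \<odot>\<^bsub>real_chains D i\<^esub> ?v \<epsilon> c"
        unfolding real_chains_def \<delta>_def by (rule orientation_class[OF real_tensor_data cs eps[OF c(1)]])
      show "(of_int (\<delta> c) :: real) \<noteq> 0" using \<delta>[OF c(1)] by auto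
    qed (rule cells_facts(1)[OF ls(1)])
    then show "basis_det (real_chains D i) a (real_basis D ls \<epsilon> i) =
        of_int (\<kappa> i) * basis_det (real_chains D i) a (real_basis D ls' \<epsilon>' i)"
      unfolding real_basis_def \<kappa>_def \<sigma>(2) by simp
  qed (simp add: real_basis_def \<sigma>(2))
  let ?good = "\<lambda>c. c \<notin> omitted_cells Y \<phi>"
  have fl: "filter ?good (ls' i) = map (\<sigma> i) (filter ?good (ls i))" for i
  proof -
    have good: "?good (\<sigma> i c) \<longleftrightarrow> ?good c" for c
    proof (cases "c \<in> {c \<in> set (ls i). c \<notin> singular_cells Y}")
      case True
      then have "\<sigma> i c \<in> {c \<in> set (ls i). c \<notin> singular_cells Y}" using permutes_in_image[OF \<sigma>(1)] by blast
      then show ?thesis using True omitted_singular by auto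
    next
      case False
      then show ?thesis using permutes_not_in[OF \<sigma>(1) False] by simp
    qed
    show ?thesis unfolding \<sigma>(2) filter_map comp_def good by simp
  qed
  have twisted: "torsion 3 TC TB (twisted_basis Y P D \<phi> e ls \<epsilon>) (\<lambda>_. []) =
      of_int K * torsion 3 TC TB (twisted_basis Y P D \<phi> e ls' \<epsilon>') (\<lambda>_. [])"
    unfolding powK[symmetric]
  proof (rule torsion_change_of_chain_bases)
    fix i a
    interpret vector_module "TC i" by (rule TC_module)
    let ?xs = "filter ?good (ls i)" and ?v = "\<lambda>\<epsilon> c. tw (fst c) (\<epsilon> c) (e c)"
    have "basis_det (TC i) a (map (?v \<epsilon>) ?xs) =
      (\<Prod>c\<in>set ?xs. of_int (\<delta> c)) * of_int (sign (\<sigma> i)) * basis_det (TC i) a (map (?v \<epsilon>') (map (\<sigma> i) ?xs))"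
    proof (rule basis_det_monomial_change)
      show "\<sigma> i permutes set ?xs" by (rule permutes_subset[OF \<sigma>(1)]) (use omitted_singular in auto)
      fix c assume "c \<in> set ?xs"
      then have c: "c \<in> D" "fst c = i" using cells_facts(2)[OF ls(1)] by auto
      note l = euler_lifts_lift[OF e c(1)]
      show "?v \<epsilon> c \<in> carrier (TC i)" using tw_carrier[OF c(1) l] c(2) by simp
      show "?v \<epsilon>' c = of_int (\<delta> c) \<odot>\<^bsub>TC i\<^esub> ?v \<epsilon> c"
        using tw_orientation[OF c(1) l eps[OF c(1)]] c(2) by (simp add: \<delta>_def)
      show "(of_int (\<delta> c) :: 'f) \<noteq> 0" using \<delta>[OF c(1)] by auto
    qed (use cells_facts(1)[OF ls(1)] in simp)
    moreover have "(\<Prod>c\<in>set ?xs. \<delta> c) = (\<Prod>c\<in>set (ls i). \<delta> c)"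
      using \<delta>1 omitted_singular by (intro prod.mono_neutral_left) auto
    ultimately show "basis_det (TC i) a (twisted_basis Y P D \<phi> e ls \<epsilon> i) =
        of_int (\<kappa> i) * basis_det (TC i) a (twisted_basis Y P D \<phi> e ls' \<epsilon>' i)"
      unfolding twisted_basis_eq[OF ls(1)] twisted_basis_eq[OF ls(2)] fl \<kappa>_def
      by (simp flip: of_int_prod)
  qed (simp add: twisted_basis_eq[OF ls(1)] twisted_basis_eq[OF ls(2)] fl)
  consider "K = 1" | "K = -1" using K by auto
  then show ?thesis
  proof cases
    case 1
    then show ?thesis using real twisted by (simp add: orb_torsion_def torsion_sign_def)
  next
    case 2
    let ?t = "torsion 3 (real_chains D) (real_boundary D) (real_basis D ls' \<epsilon>') w"
    have "\<lfloor>- 1 :: real\<rfloor> = - 1" using floor_of_int[of "- 1", where 'a = real] by simp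
    then have "\<lfloor>- sgn ?t\<rfloor> = - \<lfloor>sgn ?t\<rfloor>" by (simp add: sgn_if)
    then show ?thesis using real twisted 2 by (simp add: orb_torsion_def torsion_sign_def)
  qed
qed

end

lemma sgn_powi_alternating: "sgn (x powi ((-1) ^ k)) = sgn (x :: real)"
  unfolding powi_alternating by (simp add: sgn_inverse sgn_if)

lemma sgn_prod: "sgn (\<Prod>i\<in>A. f i) = (\<Prod>i\<in>A. sgn (f i :: real))"
  by (induction A rule: infinite_finite_induct) (auto simp: sgn_mult)

text \<open>The determinants of the changes enter to alternating powers \<open>\<plusminus>1\<close>, which have no effect on signs, and
  their product is positive.\<close>

lemma torsion_sign_change_of_homology_bases:
  assumes \<omega>: "\<omega> \<in> homology_orientations D"
    and w: "realizes_orientation 3 (real_homology D) \<omega> w" "realizes_orientation 3 (real_homology D) \<omega> w'"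
  shows "torsion_sign D ls \<epsilon> w' = torsion_sign D ls \<epsilon> w"
proof -
  interpret finite_complex 3 "real_chains D" "real_boundary D" by (rule real_complex)
  let ?H = "real_homology D"
  have H: "?H = homology_module 3 (real_chains D) (real_boundary D)" by (simp add: real_homology_def)
  have "0 < (\<Prod>n\<le>3. basis_det (?H n) (w' n) (w n))"
    by (rule realizes_orientation_det_pos[OF _ \<omega>[unfolded homology_orientations_def] w])
      (unfold H, rule homology_vector_module)
  then have "sgn (\<Prod>n\<le>3. basis_det (?H n) (w' n) (w n) powi ((-1) ^ (n + 1))) = 1"
    unfolding sgn_prod sgn_powi_alternating unfolding sgn_prod[symmetric] by simp
  moreover have "ordered_basis (homology_module 3 (real_chains D) (real_boundary D) i) (w i)"
    "ordered_basis (homology_module 3 (real_chains D) (real_boundary D) i) (w' i)" if "i \<le> 3" for i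
    using w that unfolding realizes_orientation_def H by blast+
  ultimately show ?thesis
    unfolding torsion_sign_def using torsion_change_of_homology_bases[of w w'] unfolding H by (simp add: sgn_mult)
qed

theorem theorem4p2:
  fixes Y :: "'a::t2_space link_orbifold"
    and P :: "('a, 'b::t2_space) orb_cover"
    and D :: "'a cell set"
    and F :: "nat \<Rightarrow> 'e ring"
    and \<theta> :: "'e \<Rightarrow> 'f::field"
    and \<phi> :: "('a chain set set \<Rightarrow> int) \<Rightarrow> 'f"
  assumes "is_link_orbifold Y"
    and "is_abelian_orb_cover Y P"
    and "is_cell_decomposition Y D"
    and "splits_into_fields (total_quotient_ring (group_ring (H1orb Y))) r F pr"
    and "l < r" and "\<theta> \<in> ring_iso (F l) field_ring"
    and "\<phi> = (\<lambda>x. \<theta> (pr l (fraction (group_ring (H1orb Y)) x \<one>\<^bsub>group_ring (H1orb Y)\<^esub>)))"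
    and "E \<in> euler_structures Y P D"
    and "\<omega> \<in> homology_orientations D"
    and "e \<in> E" and "e' \<in> E"
    and "cell_orientation Y D \<epsilon>" and "cell_orientation Y D \<epsilon>'"
    and "cell_order Y D ls" and "cell_order Y D ls'" and "same_link_positions Y ls ls'"
    and "realizes_orientation 3 (real_homology D) \<omega> w"
    and "realizes_orientation 3 (real_homology D) \<omega> w'"
  shows "orb_torsion Y P D \<phi> e ls \<epsilon> w = orb_torsion Y P D \<phi> e' ls' \<epsilon>' w'"
proof -
  have H: "Group.comm_group (H1orb Y)" by (rule link_orbifold.H1orb_group[OF link_orbifold.intro[OF assms(1)]])
  interpret torsion_setting Y P D \<phi>
    by unfold_locales (use assms(1-3) character_of_group_ring[OF H assms(4-7)] in simp_all)
  obtain x where x: "x \<in> euler_lifts Y P D" and E: "\<And>f. f \<in> E \<Longrightarrow> f \<in> euler_lifts Y P D \<and> lift_ratio Y P D f x = \<one>\<^bsub>H1orb Y\<^esub>"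
    using assms(8) unfolding euler_structures_def quotient_def by auto
  have lift: "orb_torsion Y P D \<phi> x ks \<eta> v = orb_torsion Y P D \<phi> f ks \<eta> v" if "f \<in> E" "cell_order Y D ks" for f ks \<eta> v
    using twisted_torsion_change_of_lift[OF x _ _ that(2)] E[OF that(1)] by (simp add: orb_torsion_def)
  have "orb_torsion Y P D \<phi> e ls \<epsilon> w = orb_torsion Y P D \<phi> x ls \<epsilon> w"
    using lift[OF assms(10,14)] by simp
  also have "\<dots> = orb_torsion Y P D \<phi> x ls' \<epsilon>' w"
    by (rule orb_torsion_change_of_cells[OF x assms(12-16)])
  also have "\<dots> = orb_torsion Y P D \<phi> x ls' \<epsilon>' w'"
    using torsion_sign_change_of_homology_bases[OF assms(9,18,17)] by (simp add: orb_torsion_def)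
  also have "\<dots> = orb_torsion Y P D \<phi> e' ls' \<epsilon>' w'" by (rule lift[OF assms(11,15)])
  finally show ?thesis .
qed

end
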